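(* For every fixed integer $d\geq 6$, the decision version of LLDS+$(d)$ is NP-complete.
   Context: Let $S$ be a sequence over a finite alphabet $\Sigma$. A subsequence $S'$ of $S$ is a letter-duplicated subsequence (LDS) of $S$ if it has the form $x_1^{d_1}x_2^{d_2}\cdots x_k^{d_k}$ with $x_i\in\Sigma$, $x_j\neq x_{j+1}$ and $d_i\geq 2$ for all $i\in[k]$, $j\in[k-1]$; each $x_i^{d_i}$ is called an LD-block. The decision problem LLDS+ (constrained longest letter-duplicated subsequence) is: given a sequence $S$ of length $n$ over $\Sigma$ and an integer $\ell$, does $S$ contain an LDS $S'$ of length at least $\ell$ such that every letter of $\Sigma$ appears in $S'$? LLDS+$(d)$ denotes this problem restricted to inputs where $d$ is the maximum number of times a letter of $\Sigma$ appears in $S$. *)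

theory Defs
  imports "HOL-Library.Sublist" "HOL-Computational_Algebra.Polynomial"
begin

section \<open>Deterministic multi-tape Turing machines\<close>

text \<open>
  Tapes are infinite in both directions. Symbol 0 is the blank; symbols 1 and 2 stand for the
  bits 0 and 1; further work symbols may be used. A machine with \<open>n = states M\<close> works in the
  states \<open>{..<n}\<close>, starts in state 0 and halts on entering state \<open>n\<close>.
  Tape 0 holds the input and tape 1 the output.
\<close>

datatype move = MoveLeft | Stay | MoveRight

fun offset :: "move \<Rightarrow> int" where
  "offset MoveLeft = -1"
| "offset Stay = 0"
| "offset MoveRight = 1"

record tm =
  tapes :: nat
  states :: nat
  symbols :: nat
  delta :: "nat \<Rightarrow> nat list \<Rightarrow> nat \<times> (nat \<times> move) list"

definition wf_tm :: "tm \<Rightarrow> bool" where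
  "wf_tm M \<longleftrightarrow> 2 \<le> tapes M \<and> 3 \<le> symbols M \<and>
     (\<forall>q < states M. \<forall>v. length v = tapes M \<and> set v \<subseteq> {..<symbols M} \<longrightarrow>
        (case delta M q v of (q', as) \<Rightarrow>
           q' \<le> states M \<and> length as = tapes M \<and> fst ` set as \<subseteq> {..<symbols M}))"

text \<open>A tape is its content together with the position of the head.\<close>

type_synonym tape = "(int \<Rightarrow> nat) \<times> int"
type_synonym config = "nat \<times> tape list"

fun tape_read :: "tape \<Rightarrow> nat" where
  "tape_read (c, h) = c h"

fun tape_act :: "nat \<times> move \<Rightarrow> tape \<Rightarrow> tape" where
  "tape_act (s, m) (c, h) = (c(h := s), h + offset m)"

fun step :: "tm \<Rightarrow> config \<Rightarrow> config" where
  "step M (q, ts) =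
     (if q < states M
      then case delta M q (map tape_read ts) of (q', as) \<Rightarrow> (q', map2 tape_act as ts)
      else (q, ts))"

definition word_content :: "bool list \<Rightarrow> int \<Rightarrow> nat" where
  "word_content w i =
     (if 0 \<le> i \<and> i < int (length w) then (if w ! nat i then 2 else 1) else 0)"

definition init_config :: "tm \<Rightarrow> bool list \<Rightarrow> config" where
  "init_config M x =
     (0, map (\<lambda>j. (word_content (if j = 0 then x else []), 0)) [0..<tapes M])"

definition computes_in_time :: "tm \<Rightarrow> (bool list \<Rightarrow> bool list) \<Rightarrow> (nat \<Rightarrow> nat) \<Rightarrow> bool" where
  "computes_in_time M f T \<longleftrightarrow>
     (\<forall>x. \<exists>t \<le> T (length x). \<exists>ts. (step M ^^ t) (init_config M x) = (states M, ts) \<and>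
        fst (ts ! 1) = word_content (f x))"

definition polytime :: "(bool list \<Rightarrow> bool list) \<Rightarrow> bool" where
  "polytime f \<longleftrightarrow> (\<exists>M (p :: nat poly). wf_tm M \<and> computes_in_time M f (poly p))"


section \<open>Encodings as bit strings\<close>

text \<open>
  Every element is announced by a 1 and the end of the list by a 0, so that \<open>enc_list e\<close>
  is a prefix code whenever \<open>e\<close> is.
\<close>

definition enc_list :: "('a \<Rightarrow> bool list) \<Rightarrow> 'a list \<Rightarrow> bool list" where
  "enc_list e xs = concat (map (\<lambda>x. True # e x) xs) @ [False]"

definition enc_word :: "bool list \<Rightarrow> bool list" where
  "enc_word = enc_list (\<lambda>b. [b])"

definition enc_pair :: "bool list \<Rightarrow> bool list \<Rightarrow> bool list" where
  "enc_pair x u = enc_word x @ u"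

text \<open>Binary notation, least significant bit first.\<close>

fun nat_bits :: "nat \<Rightarrow> bool list" where
  "nat_bits n = (if n = 0 then [] else odd n # nat_bits (n div 2))"

declare nat_bits.simps [simp del]

definition enc_int :: "int \<Rightarrow> bool list" where
  "enc_int l = (l < 0) # enc_word (nat_bits (nat \<bar>l\<bar>))"


section \<open>NP-completeness\<close>

definition NP :: "bool list set set" where
  "NP = {L. \<exists>f (p :: nat poly). polytime f \<and>
     (\<forall>x. x \<in> L \<longleftrightarrow> (\<exists>u. length u \<le> poly p (length x) \<and> f (enc_pair x u) = [True]))}"

definition polytime_reducible :: "bool list set \<Rightarrow> bool list set \<Rightarrow> bool" where
  "polytime_reducible L L' \<longleftrightarrow> (\<exists>f. polytime f \<and> (\<forall>x. x \<in> L \<longleftrightarrow> f x \<in> L'))"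

definition NP_hard :: "bool list set \<Rightarrow> bool" where
  "NP_hard L \<longleftrightarrow> (\<forall>L' \<in> NP. polytime_reducible L' L)"

definition NP_complete :: "bool list set \<Rightarrow> bool" where
  "NP_complete L \<longleftrightarrow> L \<in> NP \<and> NP_hard L"


section \<open>Letter-duplicated subsequences\<close>

text \<open>The list \<open>bs\<close> of pairs \<open>(x, e)\<close> gives the LD-blocks \<open>x\<^sup>e\<close>.\<close>

definition letter_duplicated :: "'a set \<Rightarrow> 'a list \<Rightarrow> bool" where
  "letter_duplicated \<Sigma> T \<longleftrightarrow>
     (\<exists>bs. T = concat (map (\<lambda>(x, e). replicate e x) bs) \<and>
           (\<forall>(x, e) \<in> set bs. x \<in> \<Sigma> \<and> 2 \<le> e) \<and>
           successively (\<noteq>) (map fst bs))"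

definition is_LDS :: "'a set \<Rightarrow> 'a list \<Rightarrow> 'a list \<Rightarrow> bool" where
  "is_LDS \<Sigma> S T \<longleftrightarrow> subseq T S \<and> letter_duplicated \<Sigma> T"

definition LLDS_plus :: "'a set \<Rightarrow> 'a list \<Rightarrow> int \<Rightarrow> bool" where
  "LLDS_plus \<Sigma> S l \<longleftrightarrow> (\<exists>T. is_LDS \<Sigma> S T \<and> l \<le> int (length T) \<and> (\<forall>a \<in> \<Sigma>. a \<in> set T))"

definition max_occurrences :: "'a set \<Rightarrow> 'a list \<Rightarrow> nat \<Rightarrow> bool" where
  "max_occurrences \<Sigma> S d \<longleftrightarrow> (\<forall>a \<in> \<Sigma>. count_list S a \<le> d) \<and> (\<exists>a \<in> \<Sigma>. count_list S a = d)"

text \<open>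
  The alphabet is part of the input and its size is unbounded, so letters are named by bit
  strings. The alphabet is given by an enumeration \<open>A\<close>, in which order and repetitions are
  immaterial.
\<close>

type_synonym letter = "bool list"

definition enc_instance :: "letter list \<Rightarrow> letter list \<Rightarrow> int \<Rightarrow> bool list" where
  "enc_instance A S l = enc_list enc_word A @ enc_list enc_word S @ enc_int l"

definition LLDS_plus_lang :: "nat \<Rightarrow> bool list set" where
  "LLDS_plus_lang d =
     {enc_instance A S l | A S l.
        set S \<subseteq> set A \<and> max_occurrences (set A) S d \<and> LLDS_plus (set A) S l}"

text \<open>The encoding of instances is unambiguous.\<close>

lemma enc_list_simps [simp]:
  "enc_list e [] = [False]"
  "enc_list e (x # xs) = True # e x @ enc_list e xs"
  by (simp_all add: enc_list_def)

lemma enc_list_prefix_code: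
  assumes "\<And>x y r s. e x @ r = e y @ s \<Longrightarrow> x = y \<and> r = s"
    and "enc_list e xs @ r = enc_list e ys @ s"
  shows "xs = ys \<and> r = s"
  using assms(2)
proof (induction xs arbitrary: ys)
  case Nil
  then show ?case by (cases ys) auto
next
  case (Cons x xs)
  then obtain y ys' where ys: "ys = y # ys'" by (cases ys) auto
  with Cons.prems have "e x @ enc_list e xs @ r = e y @ enc_list e ys' @ s" by simp
  from assms(1)[OF this] Cons.IH ys show ?case by blast
qed

lemma enc_word_prefix_code: "enc_word x @ r = enc_word y @ s \<Longrightarrow> x = y \<and> r = s"
  unfolding enc_word_def by (rule enc_list_prefix_code) auto

lemma nat_bits_inject: "nat_bits m = nat_bits n \<Longrightarrow> m = n"
proof (induction m arbitrary: n rule: nat_bits.induct)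
  case (1 m)
  show ?case
  proof (cases "m = 0 \<or> n = 0")
    case True
    with "1.prems" show ?thesis by (auto simp: nat_bits.simps split: if_splits)
  next
    case False
    with "1.prems" have "odd m = odd n" "nat_bits (m div 2) = nat_bits (n div 2)"
      by (simp_all add: nat_bits.simps[of m] nat_bits.simps[of n])
    with "1.IH" False have "m div 2 = n div 2" by blast
    with \<open>odd m = odd n\<close> show ?thesis
      by (metis bit_eq_rec)
  qed
qed

lemma enc_int_inject: "enc_int k = enc_int l \<Longrightarrow> k = l"
proof -
  assume "enc_int k = enc_int l"
  then have "(k < 0) = (l < 0)" "enc_word (nat_bits (nat \<bar>k\<bar>)) @ [] = enc_word (nat_bits (nat \<bar>l\<bar>)) @ []"
    by (simp_all add: enc_int_def)
  with enc_word_prefix_code nat_bits_inject have "nat \<bar>k\<bar> = nat \<bar>l\<bar>" by blast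
  with \<open>(k < 0) = (l < 0)\<close> show "k = l" by linarith
qed

lemma enc_instance_inject:
  assumes "enc_instance A S l = enc_instance A' S' l'"
  shows "A = A' \<and> S = S' \<and> l = l'"
proof -
  have code: "xs = ys \<and> r = s" if "enc_list enc_word xs @ r = enc_list enc_word ys @ s" for xs ys r s
    by (rule enc_list_prefix_code[OF _ that]) (rule enc_word_prefix_code)
  have A: "A = A' \<and> enc_list enc_word S @ enc_int l = enc_list enc_word S' @ enc_int l'"
    using assms unfolding enc_instance_def by (rule code)
  from A[THEN conjunct2] have "S = S' \<and> enc_int l = enc_int l'" by (rule code)
  with A show ?thesis using enc_int_inject by blast
qed

end

theory Submission
  imports Defs "HOL-Library.Countable"
begin

text \<open>
  Turing machines are programmed in a language of stack registers whose only loop sweeps over a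
  register that its body leaves unchanged; if moreover the lengths of the swept registers are
  fixed, the running time is polynomial for syntactic reasons.

  For membership in NP the certificate selects positions of the sequence. A selected subsequence
  is letter-duplicated iff for every letter all its runs have length at least 2, so a machine
  only has to compare, for every letter, all letters of the sequence with it.

  For hardness, a computation is described by clauses of at most three literals. With tape
  contents relative to the heads, all rules are Horn clauses between neighbouring cells of a
  space-time diagram: every satisfying assignment makes at least the facts of the actual
  computation true. A variable \<open>v\<close> with positive occurrences \<open>c\<^sub>1, c\<^sub>2, \<dots>\<close> and negative occurrences
  \<open>d\<^sub>1, d\<^sub>2, \<dots>\<close> becomes the segment \<open>v c\<^sub>1 c\<^sub>1 c\<^sub>2 c\<^sub>2 \<dots> v d\<^sub>1 d\<^sub>1 d\<^sub>2 d\<^sub>2 \<dots> v\<close>: a selected run of \<open>v\<close>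
  blocks one of the two groups. A clause has at most three literals, so its letter occurs at
  most six times; a fresh letter occurring \<open>d\<close> times makes the maximum equal to \<open>d\<close>. At the border
  of the diagram the letters of variables are omitted, which makes all literals there true.
\<close>

section \<open>Loop programs on stacks\<close>

text \<open>The reduction must itself be a program of this language, and that shapes the hard
  direction. Whether a literal is present depends only on the codes of its own row and column, and a
  clause connects cells at most one row and two columns apart. Hence the whole sequence is the
  output of two nested sweeps with a finite table in the innermost body, where the part of a
  register still to be swept serves as a coordinate in unary. Three literals per clause are few for
  a transition of a machine with many tapes. The symbols under the heads are therefore collected
  tape by tape; the completed transition is then passed on from cell to cell, because contents
  relative to a head shift everywhere when this head moves. Nondeterminism is confined to the first
  row, which guesses the certificate. The length bound of the constructed instance is 0: the
  difficulty lies entirely in the demand that every letter appear.\<close>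

datatype com =
    Skip
  | Push nat nat
  | Pop nat
  | Out nat
  | Seq com com
  | If nat nat com com
  | For nat com

type_synonym store = "nat \<Rightarrow> nat list"

text \<open>An empty stack reads as 0, the blank of its tape. As 0 is never pushed, emptiness is
  just one more symbol to test for.\<close>

definition top :: "nat list \<Rightarrow> nat" where
  "top xs = (case xs of [] \<Rightarrow> 0 | a # _ \<Rightarrow> a)"

lemma top_simps [simp]: "top [] = 0" "top (a # xs) = a"
  by (simp_all add: top_def)

text \<open>The body of a loop sees the part of \<open>r\<close> still to be swept: its top is the
  current symbol, and its length is a unary coordinate that inner loops over \<open>r\<close> can
  write out.\<close>

primrec exec :: "com \<Rightarrow> store \<Rightarrow> store" where
  "exec Skip s = s"
| "exec (Push r a) s = s(r := a # s r)"
| "exec (Pop r) s = s(r := tl (s r))"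
| "exec (Out a) s = s(1 := s 1 @ [a])"
| "exec (Seq c d) s = exec d (exec c s)"
| "exec (If r a c d) s = (if top (s r) = a then exec c s else exec d s)"
| "exec (For r c) s = (((\<lambda>s. (exec c s)(r := tl (s r))) ^^ length (s r)) s)(r := s r)"

text \<open>The exact number of steps of the compiled code. A \<open>Push\<close> moves and writes,
  the first branch of \<open>If\<close> ends with a jump, and an iteration of \<open>For\<close>
  adds a test, two steps to push onto the counter and one to advance; the rest is the exit and the
  rewinding.\<close>

primrec cost :: "com \<Rightarrow> store \<Rightarrow> nat" where
  "cost Skip s = 0"
| "cost (Push r a) s = 2"
| "cost (Pop r) s = 1"
| "cost (Out a) s = 1"
| "cost (Seq c d) s = cost c s + cost d (exec c s)"
| "cost (If r a c d) s = (if top (s r) = a then cost c s + 2 else cost d s + 1)"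
| "cost (For r c) s =
     (\<Sum>i<length (s r). cost c (((\<lambda>s. (exec c s)(r := tl (s r))) ^^ i) s) + 4) + 2 * length (s r) + 2"

primrec mods :: "com \<Rightarrow> nat set" where
  "mods Skip = {}"
| "mods (Push r a) = {r}"
| "mods (Pop r) = {r}"
| "mods (Out a) = {1}"
| "mods (Seq c d) = mods c \<union> mods d"
| "mods (If r a c d) = mods c \<union> mods d"
| "mods (For r c) = mods c"

text \<open>Register 1 is the output; it can only be appended to.\<close>

primrec wfc :: "com \<Rightarrow> bool" where
  "wfc Skip = True"
| "wfc (Push r a) = (r \<noteq> 1 \<and> 1 \<le> a)"
| "wfc (Pop r) = (r \<noteq> 1)"
| "wfc (Out a) = (a = 1 \<or> a = 2)"
| "wfc (Seq c d) = (wfc c \<and> wfc d)"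
| "wfc (If r a c d) = (r \<noteq> 1 \<and> wfc c \<and> wfc d)"
| "wfc (For r c) = (r \<noteq> 1 \<and> r \<notin> mods c \<and> wfc c)"

primrec reglim :: "com \<Rightarrow> nat" where
  "reglim Skip = 0"
| "reglim (Push r a) = Suc r"
| "reglim (Pop r) = Suc r"
| "reglim (Out a) = 2"
| "reglim (Seq c d) = max (reglim c) (reglim d)"
| "reglim (If r a c d) = max (Suc r) (max (reglim c) (reglim d))"
| "reglim (For r c) = max (Suc r) (reglim c)"

primrec symlim :: "com \<Rightarrow> nat" where
  "symlim Skip = 3"
| "symlim (Push r a) = max 3 (Suc a)"
| "symlim (Pop r) = 3"
| "symlim (Out a) = 3"
| "symlim (Seq c d) = max (symlim c) (symlim d)"
| "symlim (If r a c d) = max (symlim c) (symlim d)"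
| "symlim (For r c) = symlim c"

primrec nest :: "com \<Rightarrow> nat" where
  "nest Skip = 0"
| "nest (Push r a) = 0"
| "nest (Pop r) = 0"
| "nest (Out a) = 0"
| "nest (Seq c d) = max (nest c) (nest d)"
| "nest (If r a c d) = max (nest c) (nest d)"
| "nest (For r c) = Suc (nest c)"

section \<open>Compilation\<close>

type_synonym instr = "nat \<times> (nat \<Rightarrow> nat \<times> move \<times> nat)"

primrec size :: "com \<Rightarrow> nat" where
  "size Skip = 0"
| "size (Push r a) = 2"
| "size (Pop r) = 1"
| "size (Out a) = 1"
| "size (Seq c d) = size c + size d"
| "size (If r a c d) = size c + size d + 2"
| "size (For r c) = size c + 6"

text \<open>
  \<open>compile R c d p\<close> is the code of \<open>c\<close> placed at address \<open>p\<close> and below \<open>d\<close> loops. Every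
  instruction acts on a single tape. Tape \<open>R + d\<close> counts the iterations of a loop at depth
  \<open>d\<close>, so that the head of the loop register can be moved back.
\<close>

primrec compile :: "nat \<Rightarrow> com \<Rightarrow> nat \<Rightarrow> nat \<Rightarrow> instr list" where
  "compile R Skip d p = []"
| "compile R (Push r a) d p = [(r, \<lambda>x. (x, MoveLeft, p + 1)), (r, \<lambda>x. (a, Stay, p + 2))]"
| "compile R (Pop r) d p = [(r, \<lambda>x. (x, MoveRight, p + 1))]"
| "compile R (Out a) d p = [(1, \<lambda>x. (a, MoveRight, p + 1))]"
| "compile R (Seq c c') d p = compile R c d p @ compile R c' d (p + size c)"
| "compile R (If r a c c') d p =
     (r, \<lambda>x. (x, Stay, if x = a then p + 1 else p + 2 + size c)) # compile R c d (p + 1) @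
     (0, \<lambda>x. (x, Stay, p + 2 + size c + size c')) # compile R c' d (p + 2 + size c)"
| "compile R (For r c) d p =
     (r, \<lambda>x. (x, Stay, if x = 0 then p + 4 + size c else p + 1)) #
     (R + d, \<lambda>x. (x, MoveLeft, p + 2)) # (R + d, \<lambda>x. (1, Stay, p + 3)) #
     compile R c (Suc d) (p + 3) @
     [(r, \<lambda>x. (x, MoveRight, p)),
      (R + d, \<lambda>x. if x = 0 then (x, Stay, p + 6 + size c) else (x, MoveRight, p + 5 + size c)),
      (r, \<lambda>x. (x, MoveLeft, p + 4 + size c))]"

lemma length_compile [simp]: "length (compile R c d p) = size c"
  by (induction c arbitrary: d p) auto

definition code_at :: "(nat \<Rightarrow> instr) \<Rightarrow> nat \<Rightarrow> instr list \<Rightarrow> bool" where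
  "code_at P p xs \<longleftrightarrow> (\<forall>i<length xs. P (p + i) = xs ! i)"

lemma code_at_simps [simp]:
  "code_at P p []"
  "code_at P p (x # xs) \<longleftrightarrow> P p = x \<and> code_at P (Suc p) xs"
  by (auto simp: code_at_def less_Suc_eq_0_disj)

lemma code_at_append [simp]:
  "code_at P p (xs @ ys) \<longleftrightarrow> code_at P p xs \<and> code_at P (p + length xs) ys"
  by (induction xs arbitrary: p) auto

section \<open>Runs of the compiled code and the tapes that represent a store\<close>

type_synonym mem = "nat \<Rightarrow> tape"

fun mstep :: "(nat \<Rightarrow> instr) \<Rightarrow> nat \<times> mem \<Rightarrow> nat \<times> mem" where
  "mstep P (p, ts) = (case P p of (r, f) \<Rightarrow> case f (tape_read (ts r)) of (w, m, p') \<Rightarrow>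
     (p', ts(r := tape_act (w, m) (ts r))))"

definition reach :: "(nat \<Rightarrow> instr) \<Rightarrow> nat \<Rightarrow> nat \<times> mem \<Rightarrow> nat \<times> mem \<Rightarrow> bool" where
  "reach P t x y \<longleftrightarrow> (mstep P ^^ t) x = y"

lemma reach_refl: "reach P 0 x x"
  by (simp add: reach_def)

lemma reach_trans: "reach P t x y \<Longrightarrow> reach P u y z \<Longrightarrow> reach P (t + u) x z"
  by (simp add: reach_def add.commute[of t] funpow_add)

lemma reach_1: "mstep P x = y \<Longrightarrow> reach P 1 x y"
  by (simp add: reach_def)

text \<open>A stack register extends to the right of the head; what is on the left is junk.\<close>

definition holds :: "nat list \<Rightarrow> tape \<Rightarrow> bool" where
  "holds xs T \<longleftrightarrow> 0 \<notin> set xs \<and>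
     (\<forall>i. fst T (snd T + int i) = (if i < length xs then xs ! i else 0))"

text \<open>In contrast to a stack, tape 1 must be known everywhere, because
  \<open>computes_in_time\<close> compares its entire content.\<close>

definition written :: "nat list \<Rightarrow> tape \<Rightarrow> bool" where
  "written xs T \<longleftrightarrow> snd T = int (length xs) \<and>
     (\<forall>i. fst T i = (if 0 \<le> i \<and> i < int (length xs) then xs ! nat i else 0))"

lemma holds_read: "holds xs T \<Longrightarrow> tape_read T = top xs"
  by (cases T; cases xs) (auto simp: holds_def dest: spec[of _ 0])

lemma holds_stay: "holds xs T \<Longrightarrow> tape_act (tape_read T, Stay) T = T"
  by (cases T) auto

lemma act_keep: "tape_act (tape_read T, m) T = (fst T, snd T + offset m)"
  by (cases T) auto

lemma holds_tl: "holds xs T \<Longrightarrow> holds (tl xs) (fst T, snd T + 1)"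
proof -
  assume h: "holds xs T"
  have "fst T (snd T + 1 + int i) = (if i < length (tl xs) then tl xs ! i else 0)" for i
    using h[unfolded holds_def, THEN conjunct2, rule_format, of "Suc i"]
    by (auto simp: algebra_simps nth_tl split: if_splits)
  with h show ?thesis by (auto simp: holds_def dest: list.set_sel(2)[rotated] split: list.splits)
      (metis list.sel(2) list.set_sel(2))
qed

lemma holds_push:
  assumes "holds xs T" "a \<noteq> 0"
  shows "holds (a # xs) ((fst T)(snd T - 1 := a), snd T - 1)"
proof -
  have "((fst T)(snd T - 1 := a)) (snd T - 1 + int i) = (if i < length (a # xs) then (a # xs) ! i else 0)" for i
    using assms(1)[unfolded holds_def, THEN conjunct2, rule_format, of "i - 1"]
    by (cases i) (auto simp: algebra_simps)
  with assms show ?thesis by (simp add: holds_def)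
qed

lemma written_append: "written xs T \<Longrightarrow> written (xs @ [a]) (tape_act (a, MoveRight) T)"
  by (cases T) (auto simp: written_def nth_append nat_less_iff)

definition rep :: "nat \<Rightarrow> store \<Rightarrow> mem \<Rightarrow> bool" where
  "rep R s ts \<longleftrightarrow> written (s 1) (ts 1) \<and> (\<forall>r<R. r \<noteq> 1 \<longrightarrow> holds (s r) (ts r))"

definition counters :: "nat \<Rightarrow> nat \<Rightarrow> mem \<Rightarrow> bool" where
  "counters R d ts \<longleftrightarrow> (\<forall>j\<ge>d. holds [] (ts (R + j)))"

text \<open>Untouched tapes are kept verbatim and not merely up to \<open>holds\<close>: the symbols
  left of the head of a swept register are junk for the body, but the rewinding brings them back.
  The counters of enclosing loops, on tapes below \<open>R + d\<close>, are protected in the same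
  way.\<close>

definition frame :: "nat \<Rightarrow> nat \<Rightarrow> nat set \<Rightarrow> mem \<Rightarrow> mem \<Rightarrow> bool" where
  "frame R d X ts ts' \<longleftrightarrow> (\<forall>r. r < R + d \<and> r \<notin> X \<longrightarrow> ts' r = ts r)"

lemma frame_trans: "frame R d X ts ts' \<Longrightarrow> frame R d Y ts' ts'' \<Longrightarrow> frame R d (X \<union> Y) ts ts''"
  by (simp add: frame_def)

lemma mods_lim: "mods c \<subseteq> {..<reglim c}"
  by (induction c) auto

abbreviation body :: "nat \<Rightarrow> com \<Rightarrow> store \<Rightarrow> store" where
  "body r c s \<equiv> (exec c s)(r := tl (s r))"

definition correct :: "(nat \<Rightarrow> instr) \<Rightarrow> nat \<Rightarrow> com \<Rightarrow> nat \<Rightarrow> nat \<Rightarrow> bool" where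
  "correct P R c d p \<longleftrightarrow> (\<forall>s ts. rep R s ts \<longrightarrow> counters R d ts \<longrightarrow>
     (\<exists>ts'. reach P (cost c s) (p, ts) (p + size c, ts') \<and> rep R (exec c s) ts' \<and>
        counters R d ts' \<and> frame R d (mods c) ts ts'))"

lemma correctE:
  assumes "correct P R c d p" "rep R s ts" "counters R d ts"
  obtains ts' where "reach P (cost c s) (p, ts) (p + size c, ts')" "rep R (exec c s) ts'"
    "counters R d ts'" "frame R d (mods c) ts ts'"
  using assms unfolding correct_def by blast

text \<open>The invariant is general in \<open>cs\<close>, the counter symbols of the iterations
  already made. That only the head of the tape of \<open>r\<close> is displaced is what lets the
  rewinding restore it.\<close>

lemma for_forward:
  assumes body: "correct P R c (Suc d) (p + 3)"
    and code: "code_at P p (compile R (For r c) d p)"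
    and r: "r < R" "r \<noteq> 1" "r \<notin> mods c" "mods c \<subseteq> {..<R}" "1 < R"
  shows "rep R s ts \<Longrightarrow> counters R (Suc d) ts \<Longrightarrow> holds cs (ts (R + d)) \<Longrightarrow>
    \<exists>ts'. reach P ((\<Sum>i<length (s r). cost c (((\<lambda>s. body r c s) ^^ i) s) + 4) + 1) (p, ts) (p + 4 + size c, ts') \<and>
      rep R (((\<lambda>s. body r c s) ^^ length (s r)) s) ts' \<and> counters R (Suc d) ts' \<and>
      holds (replicate (length (s r)) 1 @ cs) (ts' (R + d)) \<and>
      ts' r = (fst (ts r), snd (ts r) + int (length (s r))) \<and>
      frame R d (insert r (mods c)) ts ts'"
proof (induction "s r" arbitrary: s ts cs)
  case Nil
  have h: "holds [] (ts r)" using Nil r by (auto simp: rep_def)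
  have "mstep P (p, ts) = (p + 4 + size c, ts)"
    using code holds_read[OF h] holds_stay[OF h] by auto
  from reach_1[OF this] show ?case using Nil(1)[symmetric] Nil(2-)
    by (intro exI[of _ ts]) (auto simp: frame_def)
next
  case (Cons a xs)
  have h: "holds (a # xs) (ts r)" using Cons r by (auto simp: rep_def)
  then have a: "a \<noteq> 0" by (auto simp: holds_def)
  let ?k = "R + d"
  have P: "P p = (r, \<lambda>x. (x, Stay, if x = 0 then p + 4 + size c else p + 1))"
    "P (p + 1) = (?k, \<lambda>x. (x, MoveLeft, p + 2))" "P (p + 2) = (?k, \<lambda>x. (1, Stay, p + 3))"
    "P (p + 3 + size c) = (r, \<lambda>x. (x, MoveRight, p))"
    using code by (auto simp: eval_nat_numeral)
  define ts1 where "ts1 = ts(?k := ((fst (ts ?k))(snd (ts ?k) - 1 := 1), snd (ts ?k) - 1))"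
  have "mstep P (p, ts) = (p + 1, ts)"
    using a holds_read[OF h] holds_stay[OF h] by (simp add: P)
  moreover have "mstep P (p + 1, ts) = (p + 2, ts(?k := (fst (ts ?k), snd (ts ?k) - 1)))"
    by (simp only: mstep.simps P) (simp add: act_keep)
  moreover have "mstep P (p + 2, ts(?k := (fst (ts ?k), snd (ts ?k) - 1))) = (p + 3, ts1)"
    by (simp only: mstep.simps P) (simp add: ts1_def)
  ultimately have r1: "reach P 3 (p, ts) (p + 3, ts1)"
    by (simp add: reach_def eval_nat_numeral del: mstep.simps)
  have k1: "holds (1 # cs) (ts1 ?k)" using holds_push[OF Cons.prems(3)] by (simp add: ts1_def)
  have rep1: "rep R s ts1" using Cons.prems(1) r by (auto simp: rep_def ts1_def)
  have cn1: "counters R (Suc d) ts1" using Cons.prems(2) by (auto simp: counters_def ts1_def)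
  from correctE[OF body rep1 cn1] obtain ts2 where
    r2: "reach P (cost c s) (p + 3, ts1) (p + 3 + size c, ts2)" and rep2: "rep R (exec c s) ts2"
    and cn2: "counters R (Suc d) ts2" and f2: "frame R (Suc d) (mods c) ts1 ts2" by blast
  define ts3 where "ts3 = ts2(r := (fst (ts2 r), snd (ts2 r) + 1))"
  have r3: "reach P 1 (p + 3 + size c, ts2) (p, ts3)"
    by (rule reach_1) (simp only: mstep.simps P, simp add: act_keep ts3_def)
  have t2r: "ts2 r = ts r" using f2 r by (auto simp: frame_def ts1_def)
  have t2k: "ts2 ?k = ts1 ?k" using f2 r by (auto simp: frame_def)
  have hr: "holds (tl (s r)) (ts3 r)" using holds_tl[OF h] Cons(2)[symmetric] t2r by (simp add: ts3_def)
  let ?s' = "body r c s"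
  have rep3: "rep R ?s' ts3" using rep2 hr r by (auto simp: rep_def ts3_def)
  have cn3: "counters R (Suc d) ts3" using cn2 r by (auto simp: counters_def ts3_def)
  have k3: "holds (1 # cs) (ts3 ?k)" using k1 t2k r by (simp add: ts3_def)
  have xs: "xs = ?s' r" using Cons(2)[symmetric] by simp
  from Cons(1)[OF xs rep3 cn3 k3] obtain ts' where
    ih: "reach P ((\<Sum>i<length xs. cost c (((\<lambda>s. body r c s) ^^ i) ?s') + 4) + 1) (p, ts3) (p + 4 + size c, ts')"
      "rep R (((\<lambda>s. body r c s) ^^ length xs) ?s') ts'" "counters R (Suc d) ts'"
      "holds (replicate (length xs) 1 @ 1 # cs) (ts' ?k)"
      "ts' r = (fst (ts3 r), snd (ts3 r) + int (length xs))" "frame R d (insert r (mods c)) ts3 ts'"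
    unfolding xs[symmetric] by blast
  have len: "length (s r) = Suc (length xs)" using Cons(2) by (metis length_Cons)
  \<comment> \<open>The induction peels off the first iteration, whereas \<open>funpow\<close> peels
    off the last.\<close>
  have sw: "((\<lambda>s. body r c s) ^^ i) ?s' = ((\<lambda>s. body r c s) ^^ Suc i) s" for i
    using funpow_swap1[of "\<lambda>s. body r c s" i s] by simp
  have time: "(\<Sum>i<length (s r). cost c (((\<lambda>s. body r c s) ^^ i) s) + 4) + 1
     = 3 + (cost c s + (1 + ((\<Sum>i<length xs. cost c (((\<lambda>s. body r c s) ^^ i) ?s') + 4) + 1)))"
    unfolding len sum.lessThan_Suc_shift sw by simp
  have "reach P ((\<Sum>i<length (s r). cost c (((\<lambda>s. body r c s) ^^ i) s) + 4) + 1) (p, ts) (p + 4 + size c, ts')"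
    unfolding time by (intro reach_trans[OF r1] reach_trans[OF r2] reach_trans[OF r3] ih(1))
  moreover have "rep R (((\<lambda>s. body r c s) ^^ length (s r)) s) ts'"
    unfolding len using ih(2) unfolding sw .
  moreover have "holds (replicate (length (s r)) 1 @ cs) (ts' ?k)"
    using ih(4) unfolding len replicate_app_Cons_same by simp
  moreover have "ts' r = (fst (ts r), snd (ts r) + int (length (s r)))"
    unfolding ih(5) len using t2r by (simp add: ts3_def)
  moreover have "frame R d (insert r (mods c)) ts ts'"
    using ih(6) f2 by (auto simp: frame_def ts3_def ts1_def)
  ultimately show ?case using ih(3) by blast
qed

text \<open>Each pass through the last two instructions trades one counter symbol for one step of
  the head of \<open>r\<close> to the left.\<close>

lemma for_rewind:
  assumes code: "code_at P p (compile R (For r c) d p)" and r: "r < R"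
  shows "holds (replicate n 1) (ts (R + d)) \<Longrightarrow>
    \<exists>T. holds [] T \<and> reach P (2 * n + 1) (p + 4 + size c, ts)
      (p + 6 + size c, ts(r := (fst (ts r), snd (ts r) - int n), R + d := T))"
proof (induction n arbitrary: ts)
  case 0
  then have h: "holds [] (ts (R + d))" by simp
  have "mstep P (p + 4 + size c, ts) = (p + 6 + size c, ts)"
    using code holds_read[OF h] holds_stay[OF h] by (auto simp: eval_nat_numeral)
  from reach_1[OF this] show ?case using h by (intro exI[of _ "ts (R + d)"]) auto
next
  case (Suc n)
  then have h: "holds (1 # replicate n 1) (ts (R + d))" by simp
  let ?k = "R + d"
  define ts1 where "ts1 = ts(?k := (fst (ts ?k), snd (ts ?k) + 1))"
  define ts2 where "ts2 = ts1(r := (fst (ts r), snd (ts r) - 1))"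
  have P: "P (p + 4 + size c) = (?k, \<lambda>x. if x = 0 then (x, Stay, p + 6 + size c) else (x, MoveRight, p + 5 + size c))"
    "P (p + 5 + size c) = (r, \<lambda>x. (x, MoveLeft, p + 4 + size c))"
    using code by (auto simp: eval_nat_numeral)
  have "mstep P (p + 4 + size c, ts) = (p + 5 + size c, ts1)"
    by (simp only: mstep.simps P) (use holds_read[OF h] act_keep[of "ts ?k" MoveRight] in \<open>simp add: ts1_def\<close>)
  moreover have "mstep P (p + 5 + size c, ts1) = (p + 4 + size c, ts2)"
    by (simp only: mstep.simps P) (use r in \<open>simp add: act_keep ts1_def ts2_def\<close>)
  ultimately have r1: "reach P 2 (p + 4 + size c, ts) (p + 4 + size c, ts2)"
    by (simp add: reach_def eval_nat_numeral del: mstep.simps)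
  have "holds (replicate n 1) (ts2 ?k)" using holds_tl[OF h] r by (simp add: ts2_def ts1_def)
  from Suc.IH[of ts2, OF this] obtain T where T: "holds [] T" and
    r2: "reach P (2 * n + 1) (p + 4 + size c, ts2)
      (p + 6 + size c, ts2(r := (fst (ts2 r), snd (ts2 r) - int n), ?k := T))" by blast
  have "ts2(r := (fst (ts2 r), snd (ts2 r) - int n), ?k := T) =
      ts(r := (fst (ts r), snd (ts r) - int (Suc n)), ?k := T)"
    using r by (auto simp: ts2_def ts1_def fun_eq_iff)
  with reach_trans[OF r1 r2] have "reach P (2 * Suc n + 1) (p + 4 + size c, ts)
      (p + 6 + size c, ts(r := (fst (ts r), snd (ts r) - int (Suc n)), ?k := T))"
    by (simp del: fun_upd_apply)
  with T show ?case by blast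
qed

lemma compile_correct:
  assumes "wfc c" "reglim c \<le> R" "code_at P p (compile R c d p)" "1 < R"
  shows "correct P R c d p"
  using assms
proof (induction c arbitrary: d p)
  case Skip
  then show ?case by (auto simp: correct_def intro: reach_refl simp: frame_def)
next
  case (Push r a)
  show ?case unfolding correct_def
  proof (intro allI impI)
    fix s ts assume rp: "rep R s ts" and cn: "counters R d ts"
    have h: "holds (s r) (ts r)" using Push rp by (auto simp: rep_def)
    let ?T = "((fst (ts r))(snd (ts r) - 1 := a), snd (ts r) - 1)"
    have P: "P p = (r, \<lambda>x. (x, MoveLeft, p + 1))" "P (p + 1) = (r, \<lambda>x. (a, Stay, p + 2))"
      using Push by auto
    have "mstep P (p, ts) = (p + 1, ts(r := (fst (ts r), snd (ts r) - 1)))"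
      by (simp only: mstep.simps P) (simp add: act_keep)
    moreover have "mstep P (p + 1, ts(r := (fst (ts r), snd (ts r) - 1))) = (p + 2, ts(r := ?T))"
      by (simp only: mstep.simps P) simp
    ultimately have "reach P 2 (p, ts) (p + 2, ts(r := ?T))"
      by (simp add: reach_def eval_nat_numeral del: mstep.simps)
    moreover have "holds (a # s r) ?T" using holds_push[OF h] Push by simp
    ultimately show "\<exists>ts'. reach P (cost (Push r a) s) (p, ts) (p + size (Push r a), ts') \<and>
      rep R (exec (Push r a) s) ts' \<and> counters R d ts' \<and> frame R d (mods (Push r a)) ts ts'"
      using rp cn Push by (intro exI[of _ "ts(r := ?T)"]) (auto simp: rep_def counters_def frame_def)
  qed
next
  case (Pop r)
  show ?case unfolding correct_def
  proof (intro allI impI)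
    fix s ts assume rp: "rep R s ts" and cn: "counters R d ts"
    have h: "holds (s r) (ts r)" using Pop rp by (auto simp: rep_def)
    let ?T = "(fst (ts r), snd (ts r) + 1)"
    have "mstep P (p, ts) = (p + 1, ts(r := ?T))" using Pop by (simp add: act_keep)
    from reach_1[OF this] holds_tl[OF h] show "\<exists>ts'. reach P (cost (Pop r) s) (p, ts) (p + size (Pop r), ts') \<and>
      rep R (exec (Pop r) s) ts' \<and> counters R d ts' \<and> frame R d (mods (Pop r)) ts ts'"
      using rp cn Pop by (intro exI[of _ "ts(r := ?T)"]) (auto simp: rep_def counters_def frame_def)
  qed
next
  case (Out a)
  show ?case unfolding correct_def
  proof (intro allI impI)
    fix s ts assume rp: "rep R s ts" and cn: "counters R d ts"
    let ?T = "tape_act (a, MoveRight) (ts 1)"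
    have "mstep P (p, ts) = (p + 1, ts(1 := ?T))" using Out by simp
    from reach_1[OF this] show "\<exists>ts'. reach P (cost (Out a) s) (p, ts) (p + size (Out a), ts') \<and>
      rep R (exec (Out a) s) ts' \<and> counters R d ts' \<and> frame R d (mods (Out a)) ts ts'"
      using rp cn Out by (intro exI[of _ "ts(1 := ?T)"])
        (auto simp: rep_def counters_def frame_def intro: written_append[simplified])
  qed
next
  case (Seq c1 c2)
  have c: "correct P R c1 d p" "correct P R c2 d (p + size c1)" using Seq by auto
  show ?case unfolding correct_def
  proof (intro allI impI)
    fix s ts assume rp: "rep R s ts" and cn: "counters R d ts"
    from correctE[OF c(1) rp cn] obtain ts1 where 1: "reach P (cost c1 s) (p, ts) (p + size c1, ts1)"
      "rep R (exec c1 s) ts1" "counters R d ts1" "frame R d (mods c1) ts ts1" .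
    from correctE[OF c(2) 1(2,3)] obtain ts2 where 2:
      "reach P (cost c2 (exec c1 s)) (p + size c1, ts1) (p + size c1 + size c2, ts2)"
      "rep R (exec c2 (exec c1 s)) ts2" "counters R d ts2" "frame R d (mods c2) ts1 ts2" .
    show "\<exists>ts'. reach P (cost (Seq c1 c2) s) (p, ts) (p + size (Seq c1 c2), ts') \<and>
      rep R (exec (Seq c1 c2) s) ts' \<and> counters R d ts' \<and> frame R d (mods (Seq c1 c2)) ts ts'"
      using reach_trans[OF 1(1) 2(1)] 2 frame_trans[OF 1(4) 2(4)]
      by (intro exI[of _ ts2]) (simp add: add.assoc)
  qed
next
  case (If r a c1 c2)
  have c: "correct P R c1 d (p + 1)" "correct P R c2 d (p + 2 + size c1)"
    using If.prems by (auto intro!: If.IH)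
  have P: "P p = (r, \<lambda>x. (x, Stay, if x = a then p + 1 else p + 2 + size c1))"
    "P (p + 1 + size c1) = (0, \<lambda>x. (x, Stay, p + 2 + size c1 + size c2))"
    using If.prems by auto
  show ?case unfolding correct_def
  proof (intro allI impI)
    fix s ts assume rp: "rep R s ts" and cn: "counters R d ts"
    have h: "holds (s r) (ts r)" using If.prems rp by (auto simp: rep_def)
    have 0: "reach P 1 (p, ts) (if top (s r) = a then p + 1 else p + 2 + size c1, ts)"
      by (rule reach_1) (use P holds_read[OF h] holds_stay[OF h] in simp)
    have j: "reach P 1 (p + 1 + size c1, ts1) (p + 2 + size c1 + size c2, ts1)" for ts1
      by (rule reach_1, simp only: mstep.simps P) (simp add: act_keep)
    show "\<exists>ts'. reach P (cost (If r a c1 c2) s) (p, ts) (p + size (If r a c1 c2), ts') \<and>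
      rep R (exec (If r a c1 c2) s) ts' \<and> counters R d ts' \<and> frame R d (mods (If r a c1 c2)) ts ts'"
    proof (cases "top (s r) = a")
      case True
      from correctE[OF c(1) rp cn] obtain ts1 where 1: "reach P (cost c1 s) (p + 1, ts) (p + 1 + size c1, ts1)"
        "rep R (exec c1 s) ts1" "counters R d ts1" "frame R d (mods c1) ts ts1" .
      have "reach P (1 + (cost c1 s + 1)) (p, ts) (p + 2 + size c1 + size c2, ts1)"
        by (rule reach_trans[OF _ reach_trans[OF 1(1) j]]) (use 0 True in simp)
      then show ?thesis using 1 True by (intro exI[of _ ts1]) (auto simp: frame_def ac_simps)
    next
      case False
      from correctE[OF c(2) rp cn] obtain ts1 where 1:
        "reach P (cost c2 s) (p + 2 + size c1, ts) (p + 2 + size c1 + size c2, ts1)"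
        "rep R (exec c2 s) ts1" "counters R d ts1" "frame R d (mods c2) ts ts1" .
      have "reach P (1 + cost c2 s) (p, ts) (p + 2 + size c1 + size c2, ts1)"
        by (rule reach_trans[OF _ 1(1)]) (use 0 False in simp)
      then show ?thesis using 1 False by (intro exI[of _ ts1]) (auto simp: frame_def ac_simps)
    qed
  qed
next
  case (For r c)
  have b: "correct P R c (Suc d) (p + 3)"
    using For.prems by (auto intro!: For.IH simp: eval_nat_numeral)
  have m: "mods c \<subseteq> {..<R}" using mods_lim[of c] For.prems by auto
  show ?case unfolding correct_def
  proof (intro allI impI)
    fix s ts assume rp: "rep R s ts" and cn: "counters R d ts"
    have "counters R (Suc d) ts" "holds [] (ts (R + d))" using cn by (auto simp: counters_def)
    from for_forward[OF b For.prems(3) _ _ _ m _ rp this] For.prems obtain ts1 where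
      1: "reach P ((\<Sum>i<length (s r). cost c (((\<lambda>s. body r c s) ^^ i) s) + 4) + 1) (p, ts) (p + 4 + size c, ts1)"
      "rep R (((\<lambda>s. body r c s) ^^ length (s r)) s) ts1" "counters R (Suc d) ts1"
      "holds (replicate (length (s r)) 1) (ts1 (R + d))"
      "ts1 r = (fst (ts r), snd (ts r) + int (length (s r)))"
      "frame R d (insert r (mods c)) ts ts1" by auto
    from for_rewind[OF For.prems(3), of "length (s r)" ts1] 1(4) For.prems obtain T where T: "holds [] T"
      "reach P (2 * length (s r) + 1) (p + 4 + size c, ts1)
      (p + 6 + size c, ts1(r := (fst (ts1 r), snd (ts1 r) - int (length (s r))), R + d := T))" by auto
    let ?ts = "ts1(r := (fst (ts1 r), snd (ts1 r) - int (length (s r))), R + d := T)"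
    \<comment> \<open>The content of tape \<open>r\<close> was never changed and its head is back,
      so the tape is literally the old one.\<close>
    have rr: "?ts r = ts r" using 1(5) For.prems by auto
    have hr: "holds (s r) (ts r)" using rp For.prems by (auto simp: rep_def)
    have "rep R (exec (For r c) s) ?ts" using 1(2) For.prems hr rr by (auto simp: rep_def)
    moreover have "counters R d ?ts"
    proof (unfold counters_def, intro allI impI)
      fix j assume "d \<le> j"
      show "holds [] (?ts (R + j))"
      proof (cases "j = d")
        case False
        with \<open>d \<le> j\<close> 1(3) have "holds [] (ts1 (R + j))" by (auto simp: counters_def)
        with False For.prems show ?thesis by auto
      qed (use T in simp)
    qed
    moreover have "frame R d (mods (For r c)) ts ?ts" using 1(6) rr by (auto simp: frame_def)
    moreover have "cost (For r c) s = (\<Sum>i<length (s r). cost c (((\<lambda>s. body r c s) ^^ i) s) + 4) + 1 + (2 * length (s r) + 1)"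
      by simp
    ultimately show "\<exists>ts'. reach P (cost (For r c) s) (p, ts) (p + size (For r c), ts') \<and>
      rep R (exec (For r c) s) ts' \<and> counters R d ts' \<and> frame R d (mods (For r c)) ts ts'"
      using reach_trans[OF 1(1) T(2)] by (intro exI[of _ ?ts]) (simp add: ac_simps del: fun_upd_apply exec.simps cost.simps)
  qed
qed


section \<open>Polynomial running time\<close>

lemma symlim_ge: "3 \<le> symlim c"
  by (induction c) auto

text \<open>What \<open>wf_tm\<close> asks of a transition function: existing tapes, existing
  symbols, and jumps no further than the end of the code.\<close>

lemma instr_ok:
  assumes "wfc c" "reglim c \<le> R" "symlim c \<le> K" "d + nest c \<le> D" "1 < R" "i \<in> set (compile R c d p)"
  shows "fst i < R + D \<and> (\<forall>x. (x < K \<longrightarrow> fst (snd i x) < K) \<and> snd (snd (snd i x)) \<le> p + size c)"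
  using assms
proof (induction c arbitrary: d p)
  case (Seq c c')
  then consider "i \<in> set (compile R c d p)" | "i \<in> set (compile R c' d (p + size c))" by auto
  then show ?case
  proof cases
    case 1
    have "fst i < R + D \<and> (\<forall>x. (x < K \<longrightarrow> fst (snd i x) < K) \<and> snd (snd (snd i x)) \<le> p + size c)"
      using Seq.IH(1)[OF _ _ _ _ _ 1] Seq.prems by simp
    then show ?thesis by (auto intro: le_trans)
  next
    case 2
    have "fst i < R + D \<and> (\<forall>x. (x < K \<longrightarrow> fst (snd i x) < K) \<and> snd (snd (snd i x)) \<le> p + size c + size c')"
      using Seq.IH(2)[OF _ _ _ _ _ 2] Seq.prems by simp
    then show ?thesis by (simp add: add.assoc)
  qed
next
  case (If r a c c')
  then consider "i \<in> set (compile R c d (p + 1))" | "i \<in> set (compile R c' d (p + 2 + size c))"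
    | "i = (r, \<lambda>x. (x, Stay, if x = a then p + 1 else p + 2 + size c)) \<or>
       i = (0, \<lambda>x. (x, Stay, p + 2 + size c + size c'))" by auto
  then show ?case
  proof cases
    case 1
    have "fst i < R + D \<and> (\<forall>x. (x < K \<longrightarrow> fst (snd i x) < K) \<and> snd (snd (snd i x)) \<le> p + 1 + size c)"
      using If.IH(1)[OF _ _ _ _ _ 1] If.prems by simp
    then show ?thesis by (auto intro: le_trans)
  next
    case 2
    have "fst i < R + D \<and> (\<forall>x. (x < K \<longrightarrow> fst (snd i x) < K) \<and> snd (snd (snd i x)) \<le> p + 2 + size c + size c')"
      using If.IH(2)[OF _ _ _ _ _ 2] If.prems by simp
    then show ?thesis by (simp add: ac_simps)
  next
    case 3
    then show ?thesis using If.prems by auto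
  qed
next
  case (For r c)
  then consider "i \<in> set (compile R c (Suc d) (p + 3))" | "i \<notin> set (compile R c (Suc d) (p + 3))" by auto
  then show ?case
  proof cases
    case 1
    have "fst i < R + D \<and> (\<forall>x. (x < K \<longrightarrow> fst (snd i x) < K) \<and> snd (snd (snd i x)) \<le> p + 3 + size c)"
      using For.IH[OF _ _ _ _ _ 1] For.prems by simp
    then show ?thesis by (auto intro: le_trans)
  next
    case 2
    with For.prems symlim_ge[of c] show ?thesis by auto
  qed
qed auto

section \<open>Polynomial bounds read off the syntax\<close>

primrec bnd :: "nat set \<Rightarrow> com \<Rightarrow> bool" where
  "bnd X Skip = True"
| "bnd X (Push r a) = (r \<notin> X)"
| "bnd X (Pop r) = True"
| "bnd X (Out a) = (1 \<notin> X)"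
| "bnd X (Seq c d) = (bnd X c \<and> bnd X d)"
| "bnd X (If r a c d) = (bnd X c \<and> bnd X d)"
| "bnd X (For r c) = (r \<in> X \<and> bnd X c)"

primrec tbound :: "com \<Rightarrow> nat \<Rightarrow> nat" where
  "tbound Skip n = 0"
| "tbound (Push r a) n = 2"
| "tbound (Pop r) n = 1"
| "tbound (Out a) n = 1"
| "tbound (Seq c d) n = tbound c n + tbound d n"
| "tbound (If r a c d) n = tbound c n + tbound d n + 2"
| "tbound (For r c) n = n * (tbound c n + 4) + 2 * n + 2"

lemma tbound_poly: "\<exists>p :: nat poly. \<forall>n. tbound c n = poly p n"
proof (induction c)
  case (For r c)
  then obtain p where "\<forall>n. tbound c n = poly p n" by blast
  then have "\<forall>n. tbound (For r c) n = poly ([:0,1:] * (p + [:4:]) + [:2,2:]) n" by (simp add: algebra_simps)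
  then show ?case by blast
next
  case (Seq c d)
  then obtain p q where "\<forall>n. tbound c n = poly p n" "\<forall>n. tbound d n = poly q n" by blast
  then have "\<forall>n. tbound (Seq c d) n = poly (p + q) n" by simp
  then show ?case by blast
next
  case (If r a c d)
  then obtain p q where "\<forall>n. tbound c n = poly p n" "\<forall>n. tbound d n = poly q n" by blast
  then have "\<forall>n. tbound (If r a c d) n = poly (p + q + [:2:]) n" by simp
  then show ?case by blast
qed (auto intro: exI[of _ "[:c:]" for c] simp del: One_nat_def)

text \<open>Registers in \<open>X\<close> are popped or swept but never pushed to. Since loops sweep
  only such registers, their initial lengths bound the iterations of all loops at any depth.\<close>

lemma bnd_length: "bnd X c \<Longrightarrow> r \<in> X \<Longrightarrow> length (exec c s r) \<le> length (s r)"
proof (induction c arbitrary: s)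
  case (Seq c d)
  then show ?case by simp (meson le_trans)
next
  case (For q c)
  have "length (((\<lambda>s. body q c s) ^^ n) s r) \<le> length (s r)" for n
  proof (induction n)
    case (Suc n)
    let ?s = "((\<lambda>s. body q c s) ^^ n) s"
    have "length (body q c ?s r) \<le> length (?s r)" using For by auto
    with Suc show ?case by (simp del: fun_upd_apply)
  qed simp
  then show ?case by simp
qed auto

lemma cost_tbound:
  assumes "bnd X c" "\<forall>r\<in>X. length (s r) \<le> n"
  shows "cost c s \<le> tbound c n"
  using assms
proof (induction c arbitrary: s)
  case (Seq c d)
  have "cost d (exec c s) \<le> tbound d n"
    using Seq.prems by (intro Seq.IH) (auto intro: order_trans[OF bnd_length])
  with Seq show ?case by (simp add: add_mono)
next
  case (If r a c d)
  then have "cost c s \<le> tbound c n" "cost d s \<le> tbound d n" by auto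
  then show ?case by simp
next
  case (For r c)
  have "\<forall>q\<in>X. length (((\<lambda>s. body r c s) ^^ i) s q) \<le> n" for i
  proof (induction i)
    case (Suc i)
    show ?case
    proof
      fix q assume q: "q \<in> X"
      let ?s = "((\<lambda>s. body r c s) ^^ i) s"
      have "length (exec c ?s q) \<le> length (?s q)" using For.prems q by (intro bnd_length[of X]) auto
      then have "length (body r c ?s q) \<le> length (?s q)" by auto
      also have "\<dots> \<le> n" using Suc q by blast
      finally show "length (((\<lambda>s. body r c s) ^^ Suc i) s q) \<le> n" by (simp del: fun_upd_apply)
    qed
  qed (use For in auto)
  then have "cost c (((\<lambda>s. body r c s) ^^ i) s) \<le> tbound c n" for i
    by (rule For.IH[rotated]) (use For.prems in simp)
  then have "(\<Sum>i<length (s r). cost c (((\<lambda>s. body r c s) ^^ i) s) + 4) \<le> (\<Sum>i<length (s r). tbound c n + 4)"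
    by (intro sum_mono add_right_mono)
  also have "\<dots> = length (s r) * (tbound c n + 4)" by simp
  also have "\<dots> \<le> n * (tbound c n + 4)" using For.prems by (intro mult_right_mono) auto
  finally have "cost (For r c) s \<le> n * (tbound c n + 4) + 2 * length (s r) + 2"
    by (simp del: fun_upd_apply)
  moreover have "length (s r) \<le> n" using For.prems by simp
  ultimately show ?case by simp
qed auto

text \<open>Every symbol added to a register costs at least one step.\<close>

lemma length_exec: "length (exec c s r) \<le> length (s r) + cost c s"
proof (induction c arbitrary: s)
  case (Seq c d)
  have "length (exec d (exec c s) r) \<le> length (exec c s r) + cost d (exec c s)" by (rule Seq)
  moreover have "length (exec c s r) \<le> length (s r) + cost c s" by (rule Seq)
  ultimately show ?case by simp
next
  case (If q a c d)
  from If[of s] show ?case by simp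
next
  case (For q c)
  have "length (((\<lambda>s. body q c s) ^^ n) s r) \<le> length (s r) + (\<Sum>i<n. cost c (((\<lambda>s. body q c s) ^^ i) s) + 4)" for n
  proof (induction n)
    case (Suc n)
    let ?s = "((\<lambda>s. body q c s) ^^ n) s"
    have "length (body q c ?s r) \<le> length (?s r) + cost c ?s" using For[of ?s] by auto
    with Suc show ?case by (simp del: fun_upd_apply)
  qed simp
  from this[of "length (s q)"] show ?case by simp
qed auto

text \<open>\<open>bnd\<close> fails for a sequence whose second phase sweeps a register filled by
  the first one. This semantic notion is closed under composition, because it bounds the cost by the
  lengths of all registers at the start of a phase.\<close>

definition good :: "com \<Rightarrow> bool" where
  "good c \<longleftrightarrow> (\<exists>p :: nat poly. \<forall>s n. (\<forall>r. length (s r) \<le> n) \<longrightarrow> cost c s \<le> poly p n)"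

lemma good_bnd: "bnd X c \<Longrightarrow> good c"
  unfolding good_def using tbound_poly[of c] cost_tbound[of X c] by metis

text \<open>After \<open>c\<close> no register is longer than \<open>n + poly p n\<close>, so the
  bound of \<open>d\<close> is composed with this polynomial.\<close>

lemma good_Seq:
  assumes "good c" "good d"
  shows "good (Seq c d)"
proof -
  obtain p q :: "nat poly" where p: "\<And>s n. (\<forall>r. length (s r) \<le> n) \<Longrightarrow> cost c s \<le> poly p n"
    and q: "\<And>s n. (\<forall>r. length (s r) \<le> n) \<Longrightarrow> cost d s \<le> poly q n"
    using assms unfolding good_def by metis
  have "cost (Seq c d) s \<le> poly (p + pcompose q ([:0,1:] + p)) n" if "\<forall>r. length (s r) \<le> n" for s n
  proof -
    have "length (exec c s r) \<le> n + poly p n" for r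
      using length_exec[of c s r] p[OF that] that by (meson add_mono le_trans)
    then have "cost d (exec c s) \<le> poly q (n + poly p n)" by (intro q) blast
    with p[OF that] show ?thesis by (simp add: poly_pcompose)
  qed
  then show ?thesis unfolding good_def by blast
qed

section \<open>From programs to Turing machines\<close>

definition bit :: "bool \<Rightarrow> nat" where
  "bit b = (if b then 2 else 1)"

definition start :: "bool list \<Rightarrow> store" where
  "start x = (\<lambda>r. if r = 0 then map bit x else [])"

definition result :: "com \<Rightarrow> bool list \<Rightarrow> bool list" where
  "result c x = map (\<lambda>a. a = 2) (exec c (start x) 1)"

text \<open>The maximum with 2 guarantees an input and an output tape even for a program that
  mentions neither.\<close>

definition machine :: "com \<Rightarrow> tm" where
  "machine c = (let R = max 2 (reglim c) in
     \<lparr>tapes = R + nest c, states = size c, symbols = symlim c,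
      delta = \<lambda>q v. case compile R c 0 0 ! q of (r, f) \<Rightarrow> case f (v ! r) of (w, m, q') \<Rightarrow>
        (q', (map (\<lambda>x. (x, Stay)) v)[r := (w, m)])\<rparr>)"

lemma wf_machine:
  assumes "wfc c"
  shows "wf_tm (machine c)"
proof -
  define R where "R = max 2 (reglim c)"
  have ok: "fst i < R + nest c \<and> (\<forall>x. (x < symlim c \<longrightarrow> fst (snd i x) < symlim c) \<and> snd (snd (snd i x)) \<le> size c)"
    if "i \<in> set (compile R c 0 0)" for i
    using instr_ok[OF assms _ _ _ _ that, of "symlim c" "nest c"] by (auto simp: R_def)
  show ?thesis unfolding wf_tm_def machine_def Let_def R_def[symmetric]
  proof (simp add: symlim_ge, intro conjI allI impI)
    show "2 \<le> R + nest c" by (simp add: R_def)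
    fix q v assume q: "q < size c" and v: "length v = R + nest c \<and> set v \<subseteq> {..<symlim c}"
    obtain r f where i: "compile R c 0 0 ! q = (r, f)" by force
    have "(r, f) \<in> set (compile R c 0 0)" using q i by (metis length_compile nth_mem)
    from ok[OF this] have rf: "r < R + nest c" "\<forall>x. (x < symlim c \<longrightarrow> fst (f x) < symlim c) \<and> snd (snd (f x)) \<le> size c" by auto
    obtain w m q' where w: "f (v ! r) = (w, m, q')" by (metis prod_cases3)
    have "v ! r \<in> set v" using v rf by simp
    with v have "v ! r < symlim c" by blast
    with rf w have "w < symlim c" "q' \<le> size c" by (metis fst_conv snd_conv)+
    with v show "case case compile R c 0 0 ! q of (r, f) \<Rightarrow> case f (v ! r) of (w, m, q') \<Rightarrow>
        (q', (map (\<lambda>x. (x, Stay)) v)[r := (w, m)]) of (q', as) \<Rightarrow>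
        q' \<le> size c \<and> length as = R + nest c \<and> fst ` set as \<subseteq> {..<symlim c}"
      by (auto simp: i w dest!: subsetD[OF set_update_subset_insert] split: prod.splits)
  qed
qed

text \<open>Past its end the code \<open>P\<close> loops in place, just as the machine stays put
  after halting; hence the two runs agree for any number of steps.\<close>

lemma machine_run:
  assumes wf: "wfc c" and R: "R = max 2 (reglim c)"
    and P: "P = (\<lambda>i. if i < size c then compile R c 0 0 ! i else (0, \<lambda>x. (x, Stay, i)))"
    and p: "p \<le> size c" and ts: "(mstep P ^^ t) (p, ts) = (q, ts')"
  shows "(Defs.step (machine c) ^^ t) (p, map ts [0..<R + nest c]) = (q, map ts' [0..<R + nest c])"
  using p ts
proof (induction t arbitrary: p ts)
  case (Suc t)
  let ?M = "machine c" and ?K = "R + nest c"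
  have M: "tapes ?M = ?K" "states ?M = size c" by (simp_all add: machine_def R Let_def)
  obtain p1 ts1 where 1: "mstep P (p, ts) = (p1, ts1)" by force
  have "p1 \<le> size c \<and> Defs.step ?M (p, map ts [0..<?K]) = (p1, map ts1 [0..<?K])"
  proof (cases "p < size c")
    case True
    obtain r f where i: "compile R c 0 0 ! p = (r, f)" by force
    have "(r, f) \<in> set (compile R c 0 0)" using True i by (metis length_compile nth_mem)
    from instr_ok[OF wf _ _ _ _ this, of "symlim c" "nest c"]
    have r: "r < ?K" "\<forall>x. snd (snd (f x)) \<le> size c" by (auto simp: R)
    obtain w m q where w: "f (tape_read (ts r)) = (w, m, q)" by (metis prod_cases3)
    have "map2 tape_act ((map (\<lambda>x. (x, Stay)) (map tape_read (map ts [0..<?K])))[r := (w, m)]) (map ts [0..<?K])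
       = map (ts(r := tape_act (w, m) (ts r))) [0..<?K]"
      by (rule nth_equalityI) (auto simp: nth_list_update act_keep simp del: upt_Suc)
    then have "Defs.step ?M (p, map ts [0..<?K]) = (q, map (ts(r := tape_act (w, m) (ts r))) [0..<?K])"
      using True r i w by (simp add: M) (simp add: machine_def Let_def R[symmetric] comp_def del: upt_Suc)
    moreover have "(p1, ts1) = (q, ts(r := tape_act (w, m) (ts r)))"
      using 1 True i w by (simp add: P)
    ultimately show ?thesis using r(2)[rule_format, of "tape_read (ts r)"] w by simp
  next
    case False
    with Suc.prems 1 show ?thesis by (simp add: P M act_keep)
  qed
  moreover have "(mstep P ^^ t) (p1, ts1) = (q, ts')"
    using Suc.prems(2) 1 by (simp only: funpow_Suc_right o_apply)
  ultimately show ?case using Suc.IH[of p1 ts1] by (simp only: funpow_Suc_right o_apply)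
qed simp

lemma start_rep: "1 < R \<Longrightarrow>
  rep R (start x) (\<lambda>j. (word_content (if j = 0 then x else []), 0)) \<and>
  counters R 0 (\<lambda>j. (word_content (if j = 0 then x else []), 0))"
  by (auto simp: rep_def counters_def holds_def written_def start_def word_content_def bit_def)

lemma set_result: "wfc c \<Longrightarrow> set (s 1) \<subseteq> {1, 2} \<Longrightarrow> set (exec c s 1) \<subseteq> {1, 2}"
proof (induction c arbitrary: s)
  case (For r c)
  have "set ((((\<lambda>s. body r c s) ^^ n) s) 1) \<subseteq> {1, 2}" for n
    by (induction n) (use For in auto)
  then show ?case using For.prems by auto
qed auto

theorem polytimeI:
  assumes wf: "wfc c" and good: "good c"
  shows "polytime (result c)"
proof -
  define R where "R = max 2 (reglim c)"
  define P where "P = (\<lambda>i. if i < size c then compile R c 0 0 ! i else (0, \<lambda>x. (x, Stay, i)))"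
  let ?M = "machine c" and ?K = "R + nest c"
  have M: "tapes ?M = ?K" "states ?M = size c" by (simp_all add: machine_def R_def Let_def)
  have R: "1 < R" "reglim c \<le> R" by (auto simp: R_def)
  have "code_at P 0 (compile R c 0 0)" by (simp add: code_at_def P_def)
  then have cor: "correct P R c 0 0" by (rule compile_correct[OF wf R(2) _ R(1)])
  obtain p :: "nat poly" where p: "\<And>s n. (\<forall>r. length (s r) \<le> n) \<Longrightarrow> cost c s \<le> poly p n"
    using good unfolding good_def by metis
  have "computes_in_time ?M (result c) (poly p)" unfolding computes_in_time_def
  proof
    fix x
    let ?ts = "\<lambda>j. (word_content (if j = 0 then x else []), 0)"
    from start_rep[OF R(1)] obtain ts' where r: "reach P (cost c (start x)) (0, ?ts) (size c, ts')"
      and rp: "rep R (exec c (start x)) ts'" using correctE[OF cor, of "start x" ?ts] by (metis add_0)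
    from machine_run[OF wf R_def P_def, of 0] r
    have "(Defs.step ?M ^^ cost c (start x)) (init_config ?M x) = (size c, map ts' [0..<?K])"
      by (simp add: reach_def init_config_def M)
    moreover have "cost c (start x) \<le> poly p (length x)" by (rule p) (simp add: start_def)
    moreover have "fst (map ts' [0..<?K] ! 1) = word_content (result c x)"
    proof
      fix i
      \<comment> \<open>Decoding to booleans and encoding again is the identity only on the symbols
        1 and 2.\<close>
      have "set (exec c (start x) 1) \<subseteq> {1, 2}" by (rule set_result[OF wf]) (simp add: start_def)
      then have "(if a = 2 then 2 else 1) = a" if "a \<in> set (exec c (start x) 1)" for a
        using that by auto
      then have "(if exec c (start x) 1 ! j = 2 then 2 else 1) = exec c (start x) 1 ! j"
        if "j < length (exec c (start x) 1)" for j
        using nth_mem[OF that] by blast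
      moreover have "fst (ts' 1) i = (if 0 \<le> i \<and> i < int (length (exec c (start x) 1)) then exec c (start x) 1 ! nat i else 0)"
        using rp by (simp add: rep_def written_def)
      moreover have "map ts' [0..<?K] ! 1 = ts' 1" using R by (simp del: upt_Suc)
      ultimately show "fst (map ts' [0..<?K] ! 1) i = word_content (result c x) i"
        by (simp add: word_content_def result_def nat_less_iff)
    qed
    ultimately show "\<exists>t\<le>poly p (length x). \<exists>ts. (Defs.step ?M ^^ t) (init_config ?M x) = (states ?M, ts) \<and>
        fst (ts ! 1) = word_content (result c x)" by (auto simp: M)
  qed
  with wf_machine[OF wf] show ?thesis unfolding polytime_def by blast
qed

section \<open>Derived commands\<close>

text \<open>Turns the top symbol into a value from which code can be constructed, so that finite
  tables and automata are built into a program.\<close>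

primrec branch :: "nat \<Rightarrow> nat \<Rightarrow> (nat \<Rightarrow> com) \<Rightarrow> com" where
  "branch r 0 f = f 0"
| "branch r (Suc n) f = If r (Suc n) (f (Suc n)) (branch r n f)"

lemma exec_branch: "top (s r) \<le> n \<Longrightarrow> exec (branch r n f) s = exec (f (top (s r))) s"
  by (induction n) (auto simp: le_Suc_eq)

lemma wfc_branch: "r \<noteq> 1 \<Longrightarrow> (\<And>a. a \<le> n \<Longrightarrow> wfc (f a)) \<Longrightarrow> wfc (branch r n f)"
  by (induction n) auto

lemma mods_branch: "mods (branch r n f) = (\<Union>a\<le>n. mods (f a))"
  by (induction n) (auto simp: le_Suc_eq)

lemma bnd_branch: "(\<And>a. a \<le> n \<Longrightarrow> bnd X (f a)) \<Longrightarrow> bnd X (branch r n f)"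
  by (induction n) auto

primrec seqs :: "com list \<Rightarrow> com" where
  "seqs [] = Skip"
| "seqs (c # cs) = Seq c (seqs cs)"

definition Put :: "nat \<Rightarrow> nat \<Rightarrow> com" where
  "Put r a = Seq (Pop r) (Push r a)"

lemma Put_simps [simp]:
  "exec (Put r a) s = s(r := a # tl (s r))" "mods (Put r a) = {r}"
  "wfc (Put r a) \<longleftrightarrow> r \<noteq> 1 \<and> 1 \<le> a" "bnd X (Put r a) \<longleftrightarrow> r \<notin> X"
  by (auto simp: Put_def)

lemma exec_unmod: "r \<notin> mods c \<Longrightarrow> exec c s r = s r"
proof (induction c arbitrary: s)
  case (For q c)
  have "(((\<lambda>s. body q c s) ^^ n) s) r = s r" if "r \<noteq> q" for n
    by (induction n) (use For that in auto)
  then show ?case by auto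
qed auto

text \<open>The state \<open>S zs\<close> after the sweep has passed \<open>zs\<close> is given except for the swept register.\<close>

lemma exec_For:
  assumes start: "(S [])(r := s r) = s"
    and step: "\<And>zs a ys. s r = zs @ a # ys \<Longrightarrow>
      exec c ((S zs)(r := a # ys)) = (S (zs @ [a]))(r := a # ys)"
  shows "exec (For r c) s = (S (s r))(r := s r)"
proof -
  have "n \<le> length (s r) \<Longrightarrow> ((\<lambda>s. body r c s) ^^ n) s = (S (take n (s r)))(r := drop n (s r))" for n
  proof (induction n)
    case (Suc n)
    define a where "a = s r ! n"
    have n: "drop n (s r) = a # drop (Suc n) (s r)" "take (Suc n) (s r) = take n (s r) @ [a]"
      using Suc.prems by (auto simp: Cons_nth_drop_Suc take_Suc_conv_app_nth a_def)
    have "s r = take n (s r) @ a # drop (Suc n) (s r)" by (metis append_take_drop_id n(1))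
    note st = step[OF this]
    have ih: "((\<lambda>s. body r c s) ^^ n) s = (S (take n (s r)))(r := a # drop (Suc n) (s r))"
      using Suc n by (simp del: fun_upd_apply)
    show ?case
      by (simp only: funpow.simps o_apply ih st n(2) fun_upd_same list.sel fun_upd_upd)
  qed (use start in simp)
  from this[of "length (s r)"] show ?thesis by simp
qed

section \<open>The verifier\<close>

text \<open>
  The first sweep splits \<open>enc_pair x u\<close> and parses \<open>x\<close>. Register 4 receives the letters of the
  alphabet and of the sequence, bit by bit, each closed by the marker 3 or 4; register 6
  receives the bits of the bound and register 5 the certificate.
\<close>

definition nx :: "nat \<Rightarrow> nat \<Rightarrow> nat" where
  "nx q c = (if c = 2
     then [14, 2, 3, 2, 5, 6, 5, 10, 9, 8, 11, 10, 14, 14, 14] ! q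
     else [14, 4, 1, 2, 7, 4, 5, 8, 12, 8, 13, 10, 14, 14, 14] ! q)"

text \<open>In states 1 to 3 the parser reads the alphabet, in 4 to 6 the sequence, in 7 the sign,
  in 8 and 9 the bits of a nonnegative bound, in 10 and 11 those of a negative one; in 3, 6, 9 and
  11 the next bit is payload. At the end of the input 12 and 13 mean success; 14 is the error
  state.\<close>

definition emitW :: "nat \<Rightarrow> nat \<Rightarrow> nat list" where
  "emitW q c = (if q = 3 \<or> q = 6 then [c] else if q = 2 \<and> c = 1 then [3] else if q = 5 \<and> c = 1 then [4] else [])"

definition emitL :: "nat \<Rightarrow> nat \<Rightarrow> nat list" where
  "emitL q c = (if q = 9 \<or> q = 11 then [c] else [])"

type_synonym pstate = "nat \<times> nat list \<times> nat list"

fun pstep :: "pstate \<Rightarrow> nat \<Rightarrow> pstate" where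
  "pstep (q, W, L) c = (nx q c, emitW q c @ W, emitL q c @ L)"

text \<open>The outer layer undoes \<open>enc_pair\<close>: in phase 1 a continuation bit is due, in
  phase 2 a bit of the instance, and phase 3 collects the certificate.\<close>

fun fstep :: "nat \<times> pstate \<times> nat list \<Rightarrow> nat \<Rightarrow> nat \<times> pstate \<times> nat list" where
  "fstep (p, v, U) c =
     (if p = 1 then (if c = 2 then 2 else 3, v, U)
      else if p = 2 then (1, pstep v c, U) else (p, v, c # U))"

definition pass1 :: com where
  "pass1 = For 0 (branch 2 3 (\<lambda>p. branch 0 2 (\<lambda>c.
     if c = 0 then Skip
     else if p = 1 then Put 2 (if c = 2 then 2 else 3)
     else if p = 2 then branch 3 14 (\<lambda>q. seqs
       [Put 3 (nx q c), seqs (map (Push 4) (emitW q c)), seqs (map (Push 6) (emitL q c)), Put 2 1])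
     else Push 5 c)))"

lemma exec_pushes: "exec (seqs (map (Push r) xs)) s = s(r := rev xs @ s r)"
  by (induction xs arbitrary: s) auto

lemma rev_emit [simp]: "rev (emitW q c) = emitW q c" "rev (emitL q c) = emitL q c"
  by (auto simp: emitW_def emitL_def)

lemma nx_bounds: "nx q c \<le> 14 \<and> 1 \<le> nx q c" if "q \<le> 14"
  using that by (auto simp: nx_def numeral_nat le_Suc_eq)

definition fstore :: "store \<Rightarrow> nat \<times> pstate \<times> nat list \<Rightarrow> store" where
  "fstore s = (\<lambda>(p, (q, W, L), U). s(2 := [p], 3 := [q], 4 := W, 6 := L, 5 := U))"

lemma fstore_simp: "fstore s (p, (q, W, L), U) = s(2 := [p], 3 := [q], 4 := W, 6 := L, 5 := U)"
  by (simp add: fstore_def)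

lemma foldl_fstep_ok:
  assumes "foldl fstep (1, (1, [], []), []) zs = (p, (q, W, L), U)"
  shows "p \<in> {1, 2, 3} \<and> q \<le> 14 \<and> 1 \<le> q"
  using assms
proof (induction zs arbitrary: p q W L U rule: rev_induct)
  case (snoc c zs)
  obtain p' q' W' L' U' where f: "foldl fstep (1, (1, [], []), []) zs = (p', (q', W', L'), U')"
    by (metis prod_cases3)
  from snoc.IH[OF f] snoc.prems f nx_bounds[of q' c] show ?case by (auto split: if_splits)
qed auto

lemma exec_pass1:
  assumes "set (s 0) \<subseteq> {1, 2}" "s 2 = [1]" "s 3 = [1]" "s 4 = []" "s 5 = []" "s 6 = []"
  shows "exec pass1 s = fstore s (foldl fstep (1, (1, [], []), []) (s 0))"
proof -
  let ?S = "\<lambda>zs. fstore s (foldl fstep (1, (1, [], []), []) zs)"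
  have "exec pass1 s = (?S (s 0))(0 := s 0)" unfolding pass1_def
  proof (rule exec_For)
    show "(?S [])(0 := s 0) = s" using assms by (auto simp: fstore_def)
    fix zs a ys assume e: "s 0 = zs @ a # ys"
    then have a: "a = 1 \<or> a = 2" using assms by auto
    obtain p q W L U where f: "foldl fstep (1, (1, [], []), []) zs = (p, (q, W, L), U)"
      by (metis prod_cases3)
    note ok = foldl_fstep_ok[OF f]
    from ok a show "exec (branch 2 3 (\<lambda>p. branch 0 2 (\<lambda>c.
       if c = 0 then Skip
       else if p = 1 then Put 2 (if c = 2 then 2 else 3)
       else if p = 2 then branch 3 14 (\<lambda>q. seqs
         [Put 3 (nx q c), seqs (map (Push 4) (emitW q c)), seqs (map (Push 6) (emitL q c)), Put 2 1])
       else Push 5 c))) ((?S zs)(0 := a # ys)) = (?S (zs @ [a]))(0 := a # ys)"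
      unfolding foldl_append f foldl.simps
      by (elim conjE insertE emptyE disjE) (simp_all add: fstore_simp exec_branch exec_pushes fun_eq_iff)
  qed
  also have "\<dots> = ?S (s 0)" by (auto simp: fstore_def split: prod.splits)
  finally show ?thesis .
qed

section \<open>Correctness of the parser\<close>

lemma bit_simps [simp]: "bit True = 2" "bit False = 1"
  by (simp_all add: bit_def)

lemma bit_eq [simp]: "bit a = bit b \<longleftrightarrow> a = b"
  by (simp add: bit_def)

lemma bit_range [simp]: "bit b \<noteq> 0" "bit b \<le> 2" "0 < bit b" "bit b \<noteq> 3" "bit b \<noteq> 4" "bit b \<noteq> 5"
  by (simp_all add: bit_def)

lemma enc_word_simps [simp]:
  "enc_word [] = [False]" "enc_word (b # w) = True # b # enc_word w"
  by (simp_all add: enc_word_def)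

lemma fold_pair:
  "foldl fstep (1, v, []) (map bit (enc_pair x u)) = (3, foldl pstep v (map bit x), rev (map bit u))"
proof -
  have u: "foldl fstep (3, v, U) (map bit u) = (3, v, rev (map bit u) @ U)" for v U
    by (induction u arbitrary: U) (auto simp: numeral_nat)
  show ?thesis
    by (induction x arbitrary: v) (auto simp: enc_pair_def u)
qed

definition toks :: "(letter \<times> nat) list \<Rightarrow> nat list" where
  "toks its = concat (map (\<lambda>(w, k). map bit w @ [k]) its)"

lemma toks_simps [simp]:
  "toks [] = []" "toks ((w, k) # its) = map bit w @ k # toks its" "toks (xs @ ys) = toks xs @ toks ys"
  by (simp_all add: toks_def)

abbreviation items :: "letter list \<Rightarrow> letter list \<Rightarrow> (letter \<times> nat) list" where
  "items A S \<equiv> map (\<lambda>w. (w, 3)) A @ map (\<lambda>w. (w, 4)) S"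

definition parse :: "bool list \<Rightarrow> pstate" where
  "parse x = foldl pstep (1, [], []) (map bit x)"

lemma parse_complete:
  "parse (enc_list enc_word A @ enc_list enc_word S @ b # enc_word bs) =
     (if b then 13 else 12, rev (toks (items A S)), rev (map bit bs))"
proof -
  have w: "foldl pstep (q, W, L) (map bit (enc_word w)) = (q', k # rev (map bit w) @ W, L)"
    if "(q, q', k) = (2, 1, 3) \<or> (q, q', k) = (5, 4, 4)" for q q' k W L w
    using that by (induction w arbitrary: W)
      (auto simp: nx_def emitW_def emitL_def numeral_nat bit_def split: if_splits)
  have l: "foldl pstep (q, W, L) (map bit (enc_list enc_word ws)) =
      (q', rev (toks (map (\<lambda>w. (w, k)) ws)) @ W, L)"
    if "(q, q', k) = (1, 4, 3) \<or> (q, q', k) = (4, 7, 4)" for q q' k W L ws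
    using that
  proof (induction ws arbitrary: W)
    case Nil
    then show ?case by (auto simp: nx_def emitW_def emitL_def numeral_nat)
  next
    case (Cons w ws)
    have "foldl pstep (q, W, L) (map bit (enc_list enc_word (w # ws))) =
        foldl pstep (foldl pstep (nx q 2, W, L) (map bit (enc_word w))) (map bit (enc_list enc_word ws))"
      using Cons.prems by (auto simp: emitW_def emitL_def)
    also have "foldl pstep (nx q 2, W, L) (map bit (enc_word w)) = (q, k # rev (map bit w) @ W, L)"
      using Cons.prems by (intro w) (auto simp: nx_def)
    finally show ?case using Cons by simp
  qed
  have i: "foldl pstep (q, W, L) (map bit (enc_word w)) = (q', W, rev (map bit w) @ L)"
    if "(q, q') = (8, 12) \<or> (q, q') = (10, 13)" for q q' W L w
    using that by (induction w arbitrary: L)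
      (auto simp: nx_def emitW_def emitL_def numeral_nat bit_def split: if_splits)
  note l1 = l[of 1 4 3, simplified] and l2 = l[of 4 7 4, simplified]
    and i1 = i[of 8 12, simplified] and i2 = i[of 10 13, simplified]
  have "parse (enc_list enc_word A @ enc_list enc_word S @ b # enc_word bs) =
     foldl pstep (foldl pstep (foldl pstep (foldl pstep (1, [], []) (map bit (enc_list enc_word A)))
       (map bit (enc_list enc_word S))) [bit b]) (map bit (enc_word bs))"
    by (simp add: parse_def)
  then show ?thesis
    by (cases b) (simp_all add: l1 l2 i1 i2 nx_def emitW_def emitL_def)
qed

definition ews :: "bool list \<Rightarrow> bool list" where
  "ews w = concat (map (\<lambda>b. [True, b]) w)"

definition ewl :: "letter list \<Rightarrow> bool list" where
  "ewl ws = concat (map (\<lambda>w. True # enc_word w) ws)"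

lemma enc_word_ews: "enc_word w = ews w @ [False]"
  by (induction w) (auto simp: ews_def)

lemma enc_list_ewl: "enc_list enc_word ws = ewl ws @ [False]"
  by (simp add: enc_list_def ewl_def)

lemma ews_snoc: "ews (w @ [b]) = ews w @ [True, b]"
  by (simp add: ews_def)

lemma ewl_snoc: "ewl (ws @ [w]) = ewl ws @ True # ews w @ [False]"
  by (simp add: ewl_def enc_word_ews)

text \<open>The invariant of the parser: for each state the bits read so far and the two outputs, in
  terms of the finished letters \<open>A\<close> and \<open>S\<close> and the word or bound
  \<open>w\<close> in progress. Markers follow their words, so in states 2, 3, 5 and 6 the bits of
  \<open>w\<close> still lack one.\<close>

definition parsed :: "nat \<Rightarrow> letter list \<Rightarrow> letter list \<Rightarrow> bool list \<Rightarrow> bool list \<times> nat list \<times> nat list" where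
  "parsed q A S w =
     ((if q \<le> 1 then ewl A else if q = 2 then ewl A @ True # ews w
       else if q = 3 then ewl A @ True # ews w @ [True] else ewl A @ False # ewl S @
        (if q = 4 then [] else if q = 5 then True # ews w else if q = 6 then True # ews w @ [True]
         else if q = 7 then [False]
         else False # (q = 10 \<or> q = 11 \<or> q = 13) # ews w @
           (if q = 8 \<or> q = 10 then [] else if q = 9 \<or> q = 11 then [True] else [False]))),
      rev (toks (items A (if q \<le> 3 then [] else S)) @ (if q \<in> {2, 3, 5, 6} then map bit w else [])),
      if q < 8 then [] else rev (map bit w))"

definition parse_inv :: "nat \<Rightarrow> bool list \<Rightarrow> nat list \<Rightarrow> nat list \<Rightarrow> bool" where
  "parse_inv q x W L \<longleftrightarrow> q = 14 \<or> (q \<in> {1..13} \<and> (\<exists>A S w. (x, W, L) = parsed q A S w))"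

lemma parse_inv_step:
  assumes "parse_inv q x W L"
  shows "parse_inv (nx q (bit b)) (x @ [b]) (emitW q (bit b) @ W) (emitL q (bit b) @ L)"
proof (cases "q = 14")
  case True
  then show ?thesis by (simp add: parse_inv_def nx_def)
next
  case False
  with assms obtain A S w where p: "(x, W, L) = parsed q A S w" and "q \<in> {1..13}"
    by (auto simp: parse_inv_def)
  then have "1 \<le> q" "q \<le> 13" by auto
  then have q: "q \<in> {1,2,3,4,5,6,7,8,9,10,11,12,13}"
    by (auto simp: numeral_eq_Suc le_Suc_eq)
  have e: "ews [] = []" "ewl [] = []" by (simp_all add: ews_def ewl_def)
  \<comment> \<open>The closing 0 of a word, read in state 2 or 5, turns \<open>w\<close> into a
    finished letter. That this happens for the bit 0 only is taken care of below by the case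
    distinction on \<open>b\<close>.\<close>
  define A' where "A' = (if q = 2 then A @ [w] else A)"
  define S' where "S' = (if q \<le> 3 then [] else if q = 5 then S @ [w] else S)"
  define w' where "w' = (if q \<in> {1, 4, 7} then [] else if q \<in> {3, 6, 9, 11} then w @ [b] else w)"
  have "nx q (bit b) = 14 \<or> (nx q (bit b) \<in> {1..13} \<and>
    (x @ [b], emitW q (bit b) @ W, emitL q (bit b) @ L) =
      parsed (nx q (bit b)) (if b then A else A') (if b \<and> 3 < q then S else S') w')"
    using q p
    by (cases b; elim insertE emptyE)
      (simp_all add: parsed_def nx_def emitW_def emitL_def A'_def S'_def w'_def e ews_snoc ewl_snoc)
  then show ?thesis unfolding parse_inv_def by blast
qed

lemma parse_invI: "parse x = (q, W, L) \<Longrightarrow> parse_inv q x W L"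
proof (induction x arbitrary: q W L rule: rev_induct)
  case Nil
  then show ?case
    by (auto simp: parse_def parse_inv_def ewl_def parsed_def intro!: exI[of _ "[]"])
next
  case (snoc b x)
  obtain q' W' L' where 1: "parse x = (q', W', L')" by (metis prod_cases3)
  with snoc.prems have "q = nx q' (bit b)" "W = emitW q' (bit b) @ W'" "L = emitL q' (bit b) @ L'"
    by (auto simp: parse_def)
  with parse_inv_step[OF snoc.IH[OF 1]] show ?case by simp
qed

text \<open>The converse of \<open>parse_complete\<close>. It is what lets the verifier reject words
  that encode no instance at all.\<close>

lemma parse_sound:
  assumes "parse x = (q, W, L)" "q = 12 \<or> q = 13"
  obtains A S bs where "x = enc_list enc_word A @ enc_list enc_word S @ (q = 13) # enc_word bs"
    "W = rev (toks (items A S))" "L = rev (map bit bs)"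
proof -
  obtain A S w where "(x, W, L) = parsed q A S w"
    using parse_invI[OF assms(1)] assms(2) by (auto simp: parse_inv_def)
  with assms(2) show ?thesis using that[of A S w]
    by (auto simp: parsed_def enc_list_ewl enc_word_ews)
qed

text \<open>
  The second sweep makes two copies of the item list, in registers 7 and 8, and changes the
  marker 4 into 5 for the letters selected by the certificate; these are counted in register 9.
\<close>

fun mst :: "nat list \<times> nat \<times> nat list \<Rightarrow> nat \<Rightarrow> nat list \<times> nat \<times> nat list" where
  "mst (W, n, U) c =
     (if c = 4 then if top U = 2 then (5 # W, Suc n, tl U) else (4 # W, n, tl U) else (c # W, n, U))"

definition mstore :: "store \<Rightarrow> nat list \<times> nat \<times> nat list \<Rightarrow> store" where
  "mstore s = (\<lambda>(W, n, U). s(7 := W, 8 := W, 9 := replicate n 1, 5 := U))"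

lemma mstore_simp: "mstore s (W, n, U) = s(7 := W, 8 := W, 9 := replicate n 1, 5 := U)"
  by (simp add: mstore_def)

definition pass2 :: com where
  "pass2 = For 4 (branch 4 4 (\<lambda>c. if c = 0 then Skip
     else if c = 4 then branch 5 2 (\<lambda>m. if m = 2 then seqs [Pop 5, Push 7 5, Push 8 5, Push 9 1]
        else seqs [Pop 5, Push 7 4, Push 8 4])
     else seqs [Push 7 c, Push 8 c]))"

lemma top_le: "set xs \<subseteq> {1..n} \<Longrightarrow> top xs \<le> n"
  by (cases xs) auto

lemma foldl_mst_set: "foldl mst (W, n, U) zs = (W', n', U') \<Longrightarrow> set U' \<subseteq> set U"
proof (induction zs arbitrary: W' n' U' rule: rev_induct)
  case (snoc c zs)
  obtain W1 n1 U1 where f: "foldl mst (W, n, U) zs = (W1, n1, U1)" by (metis prod_cases3)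
  have "set (tl U1) \<subseteq> set U1" by (cases U1) auto
  with snoc.IH[OF f] snoc.prems f show ?case by (auto split: if_splits)
qed auto

lemma exec_pass2:
  assumes "set (s 4) \<subseteq> {1..4}" "set (s 5) \<subseteq> {1..2}" "s 7 = []" "s 8 = []" "s 9 = []"
  shows "exec pass2 s = mstore s (foldl mst ([], 0, s 5) (s 4))"
proof -
  let ?S = "\<lambda>zs. mstore s (foldl mst ([], 0, s 5) zs)"
  have "exec pass2 s = (?S (s 4))(4 := s 4)" unfolding pass2_def
  proof (rule exec_For)
    show "(?S [])(4 := s 4) = s" using assms by (auto simp: mstore_def)
    fix zs a ys assume e: "s 4 = zs @ a # ys"
    then have a: "1 \<le> a" "a \<le> 4" using assms by auto
    obtain W n U where f: "foldl mst ([], 0, s 5) zs = (W, n, U)"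
      by (metis prod_cases3)
    have U: "top U \<le> 2" using foldl_mst_set[OF f] assms by (intro top_le) auto
    show "exec (branch 4 4 (\<lambda>c. if c = 0 then Skip
     else if c = 4 then branch 5 2 (\<lambda>m. if m = 2 then seqs [Pop 5, Push 7 5, Push 8 5, Push 9 1]
        else seqs [Pop 5, Push 7 4, Push 8 4])
     else seqs [Push 7 c, Push 8 c])) ((?S zs)(4 := a # ys)) = (?S (zs @ [a]))(4 := a # ys)"
      unfolding foldl_append f foldl.simps
      using a U by (simp add: mstore_simp exec_branch fun_eq_iff)
  qed
  also have "\<dots> = ?S (s 4)" by (auto simp: mstore_def split: prod.splits)
  finally show ?thesis .
qed

definition marked :: "letter list \<Rightarrow> bool list \<Rightarrow> (letter \<times> nat) list" where
  "marked S ms = map (\<lambda>(w, m). (w, if m then 5 else 4)) (zip S ms)"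

abbreviation mitems :: "letter list \<Rightarrow> letter list \<Rightarrow> bool list \<Rightarrow> (letter \<times> nat) list" where
  "mitems A S ms \<equiv> map (\<lambda>w. (w, 3)) A @ marked S ms"

lemma fold_mst_word: "foldl mst (W, n, U) (rev (map bit w)) = (map bit w @ W, n, U)"
  by (induction w arbitrary: W) auto

lemma fold_mst_A:
  "foldl mst (W, n, U) (rev (toks (map (\<lambda>w. (w, 3)) A))) = (toks (map (\<lambda>w. (w, 3)) A) @ W, n, U)"
  by (induction A arbitrary: W rule: rev_induct) (auto simp: fold_mst_word)

text \<open>A certificate that is too short leaves the first letters unselected, and one that is too
  long is read only in part; so every certificate acts as some mask.\<close>

lemma fold_mst_S:
  "\<exists>ms U'. length ms = length S \<and> (\<forall>ms'. length ms' = length S \<longrightarrow> U = rev (map bit ms') \<longrightarrow> ms = ms') \<and>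
     foldl mst (W, n, U) (rev (toks (map (\<lambda>w. (w, 4)) S))) =
       (toks (marked S ms) @ W, length (filter (\<lambda>m. m) ms) + n, U')"
proof (induction S arbitrary: W n U rule: rev_induct)
  case Nil
  then show ?case by (simp add: marked_def)
next
  case (snoc w S)
  \<comment> \<open>Register 4 holds the items in reverse, so the sweep meets the last letter first,
    and the top of \<open>U\<close> decides about it.\<close>
  define m where "m = (top U = 2)"
  from snoc[where W = "map bit w @ (if m then 5 else 4) # W" and n = "if m then Suc n else n" and U = "tl U"]
  obtain ms U' where ms: "length ms = length S"
    "\<forall>ms'. length ms' = length S \<longrightarrow> tl U = rev (map bit ms') \<longrightarrow> ms = ms'"
    "foldl mst (map bit w @ (if m then 5 else 4) # W, if m then Suc n else n, tl U) (rev (toks (map (\<lambda>w. (w, 4)) S))) =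
       (toks (marked S ms) @ map bit w @ (if m then 5 else 4) # W, length (filter (\<lambda>m. m) ms) + (if m then Suc n else n), U')"
    by blast
  have u: "ms @ [m] = ms'" if "length ms' = length (S @ [w])" "U = rev (map bit ms')" for ms'
    using that ms(2) by (cases ms' rule: rev_cases) (auto simp: m_def bit_def)
  have "foldl mst (W, n, U) (rev (toks (map (\<lambda>w. (w, 4)) (S @ [w])))) =
      foldl mst (map bit w @ (if m then 5 else 4) # W, if m then Suc n else n, tl U) (rev (toks (map (\<lambda>w. (w, 4)) S)))"
    by (simp add: fold_mst_word m_def)
  also note ms(3)
  finally have "foldl mst (W, n, U) (rev (toks (map (\<lambda>w. (w, 4)) (S @ [w])))) =
     (toks (marked (S @ [w]) (ms @ [m])) @ W, length (filter (\<lambda>m. m) (ms @ [m])) + n, U')"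
    using ms(1) by (simp add: marked_def)
  moreover have "length (ms @ [m]) = length (S @ [w])" using ms(1) by simp
  ultimately show ?case using u by blast
qed

text \<open>The state of the automaton that compares all items with one letter: membership in the
  alphabet, number of occurrences, length of the current run (capped at 2), whether the letter
  is selected, and whether it has been selected in a run of length 1.\<close>

type_synonym astate = "bool \<times> nat \<times> nat \<times> bool \<times> bool"

fun astep :: "nat \<Rightarrow> nat \<Rightarrow> bool \<Rightarrow> astate \<Rightarrow> astate" where
  "astep d k m (i, n, r, se, ba) =
     (i \<or> (k = 3 \<and> m), if (k = 4 \<or> k = 5) \<and> m then min (Suc d) (Suc n) else n,
      if k = 5 then if m then min 2 (Suc r) else 0 else r, se \<or> (k = 5 \<and> m), ba \<or> (k = 5 \<and> \<not> m \<and> r = 1))"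

fun acc :: "nat \<Rightarrow> astate \<Rightarrow> bool" where
  "acc d (i, n, r, se, ba) \<longleftrightarrow> i \<and> n \<le> d \<and> r \<noteq> 1 \<and> se \<and> \<not> ba"

fun occ :: "astate \<Rightarrow> nat" where
  "occ (i, n, r, se, ba) = n"

definition ainit :: astate where
  "ainit = (False, 0, 0, False, False)"

definition scan :: "nat \<Rightarrow> (letter \<times> nat) list \<Rightarrow> nat list \<Rightarrow> astate" where
  "scan d its w = foldl (\<lambda>st (v, k). astep d k (map bit v = w) st) ainit its"

definition astates :: "nat \<Rightarrow> astate set" where
  "astates d = UNIV \<times> {..Suc d} \<times> {..2} \<times> UNIV \<times> UNIV"

lemma astates: "ainit \<in> astates d" "st \<in> astates d \<Longrightarrow> astep d k m st \<in> astates d"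
  by (auto simp: astates_def ainit_def)

text \<open>A state is kept as a single stack symbol, so that \<open>branch\<close> acts as the
  transition table. Finitely many states occur because occurrences are capped at
  \<open>Suc d\<close> and run lengths at 2. \<open>Suc\<close> avoids the blank.\<close>

definition code :: "astate \<Rightarrow> nat" where
  "code st = Suc (to_nat st)"

definition decode :: "nat \<Rightarrow> astate" where
  "decode q = from_nat (q - 1)"

lemma decode_code [simp]: "decode (code st) = st" "code st \<noteq> 0" "0 < code st" "Suc 0 \<le> code st"
  by (simp_all add: decode_def code_def)

definition cmax :: "nat \<Rightarrow> nat" where
  "cmax d = Max (code ` astates d)"

lemma cmax: "st \<in> astates d \<Longrightarrow> code st \<le> cmax d"
  unfolding cmax_def by (rule Max_ge) (auto simp: astates_def)

text \<open>Register 0, the unchanged input, serves as a clock: it is at least as long as what has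
  to be moved, and surplus iterations find register 11 empty and do nothing.\<close>

definition restore :: com where
  "restore = For 0 (branch 11 2 (\<lambda>t. if t = 0 then Skip else seqs [Pop 11, Push 10 t]))"

lemma exec_restore:
  assumes "length (s 11) \<le> length (s 0)" "set (s 11) \<subseteq> {1..2}"
  shows "exec restore s = s(10 := rev (s 11) @ s 10, 11 := [])"
proof -
  let ?S = "\<lambda>zs. s(10 := rev (take (length zs) (s 11)) @ s 10, 11 := drop (length zs) (s 11))"
  have "exec restore s = (?S (s 0))(0 := s 0)" unfolding restore_def
  proof (rule exec_For)
    show "(?S [])(0 := s 0) = s" by auto
    fix zs a ys assume "s 0 = zs @ a # ys"
    have t: "top (drop (length zs) (s 11)) \<le> 2"
      by (rule top_le) (use assms(2) in \<open>meson order_trans set_drop_subset\<close>)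
    show "exec (branch 11 2 (\<lambda>t. if t = 0 then Skip else seqs [Pop 11, Push 10 t])) ((?S zs)(0 := a # ys))
        = (?S (zs @ [a]))(0 := a # ys)"
    proof (cases "length zs < length (s 11)")
      case True
      have d: "drop (length zs) (s 11) = s 11 ! length zs # drop (Suc (length zs)) (s 11)"
        using True by (simp add: Cons_nth_drop_Suc)
      have "s 11 ! length zs \<noteq> 0" using True assms(2) nth_mem[OF True] by fastforce
      with t show ?thesis using True
        by (simp add: exec_branch d take_Suc_conv_app_nth fun_eq_iff)
    next
      case False
      then show ?thesis by (simp add: exec_branch fun_eq_iff)
    qed
  qed
  also have "\<dots> = s(10 := rev (s 11) @ s 10, 11 := [])" using assms by (simp add: fun_eq_iff)
  finally show ?thesis .
qed

text \<open>The given letter is split into the part \<open>a\<close> still to be matched and the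
  reversed part \<open>b\<close> already matched; \<open>fl\<close> tells that no mismatch has
  occurred. Popping loses nothing, as a marker puts \<open>b\<close> back onto
  \<open>a\<close>.\<close>

fun cst :: "nat \<Rightarrow> nat list \<times> nat list \<times> bool \<times> astate \<Rightarrow> nat \<Rightarrow> nat list \<times> nat list \<times> bool \<times> astate" where
  "cst d (a, b, fl, st) c =
     (if c \<le> 2 then if fl then if top a = c then (tl a, c # b, True, st) else (a, b, False, st) else (a, b, False, st)
      else (rev b @ a, [], True, astep d c (fl \<and> a = []) st))"

definition cstore :: "store \<Rightarrow> nat list \<times> nat list \<times> bool \<times> astate \<Rightarrow> store" where
  "cstore s = (\<lambda>(a, b, fl, st). s(10 := a, 11 := b, 12 := [if fl then 1 else 2], 13 := [code st]))"

lemma cstore_simp: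
  "cstore s (a, b, fl, st) = s(10 := a, 11 := b, 12 := [if fl then 1 else 2], 13 := [code st])"
  by (simp add: cstore_def)

definition inner :: "nat \<Rightarrow> com" where
  "inner d = For 8 (branch 8 5 (\<lambda>c. if c = 0 then Skip else if c \<le> 2 then
      branch 12 2 (\<lambda>f. if f = 1 then
        branch 10 2 (\<lambda>t. if t = c then seqs [Pop 10, Push 11 c] else Put 12 2) else Skip)
    else branch 12 2 (\<lambda>f. branch 10 2 (\<lambda>t. seqs
      [branch 13 (cmax d) (\<lambda>q. Put 13 (code (astep d c (f = 1 \<and> t = 0) (decode q)))), restore, Put 12 1]))))"

lemma cst_inv:
  assumes "foldl (cst d) (w, [], True, st) zs = (a, b, fl, st')" "set zs \<subseteq> {1..5}" "st \<in> astates d"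
  shows "rev b @ a = w \<and> st' \<in> astates d"
  using assms
proof (induction zs arbitrary: a b fl st' rule: rev_induct)
  case (snoc c zs)
  obtain a1 b1 fl1 st1 where f: "foldl (cst d) (w, [], True, st) zs = (a1, b1, fl1, st1)"
    by (metis prod_cases4)
  with snoc have "rev b1 @ a1 = w \<and> st1 \<in> astates d" by auto
  with snoc.prems f show ?case
    by (cases a1) (auto split: if_splits intro: astates simp del: astep.simps)
qed auto

lemma exec_inner:
  assumes "set (s 8) \<subseteq> {1..5}" "length (s 10) \<le> length (s 0)" "set (s 10) \<subseteq> {1..2}"
    "s 11 = []" "s 12 = [1]" "s 13 = [code st]" "st \<in> astates d"
  shows "exec (inner d) s = cstore s (foldl (cst d) (s 10, [], True, st) (s 8))"
proof -
  let ?S = "\<lambda>zs. cstore s (foldl (cst d) (s 10, [], True, st) zs)"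
  have "exec (inner d) s = (?S (s 8))(8 := s 8)" unfolding inner_def
  proof (rule exec_For)
    show "(?S [])(8 := s 8) = s" using assms by (auto simp: cstore_def)
    fix zs c ys assume e: "s 8 = zs @ c # ys"
    then have c: "1 \<le> c" "c \<le> 5" using assms(1) by auto
    obtain a b fl st' where f: "foldl (cst d) (s 10, [], True, st) zs = (a, b, fl, st')"
      by (metis prod_cases4)
    have inv: "rev b @ a = s 10" "st' \<in> astates d" using cst_inv[OF f _ assms(7)] assms(1) e by auto
    have "set a \<subseteq> set (s 10)" "set b \<subseteq> set (s 10)" by (simp_all add: inv(1)[symmetric])
    then have ab: "top a \<le> 2" "set b \<subseteq> {1..2}" and a0: "top a = 0 \<longleftrightarrow> a = []"
      using assms(3) by (auto intro!: top_le) (cases a; auto)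
    have lb: "length b \<le> length (s 0)" using assms(2) inv(1)[symmetric] by simp
    show "exec (branch 8 5 (\<lambda>c. if c = 0 then Skip else if c \<le> 2 then
      branch 12 2 (\<lambda>f. if f = 1 then
        branch 10 2 (\<lambda>t. if t = c then seqs [Pop 10, Push 11 c] else Put 12 2) else Skip)
    else branch 12 2 (\<lambda>f. branch 10 2 (\<lambda>t. seqs
      [branch 13 (cmax d) (\<lambda>q. Put 13 (code (astep d c (f = 1 \<and> t = 0) (decode q)))), restore, Put 12 1]))))
      ((?S zs)(8 := c # ys)) = (?S (zs @ [c]))(8 := c # ys)"
      unfolding foldl_append f foldl.simps
    proof (cases "c \<le> 2")
      case True
      then show "exec (branch 8 5 (\<lambda>c. if c = 0 then Skip else if c \<le> 2 then
      branch 12 2 (\<lambda>f. if f = 1 then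
        branch 10 2 (\<lambda>t. if t = c then seqs [Pop 10, Push 11 c] else Put 12 2) else Skip)
    else branch 12 2 (\<lambda>f. branch 10 2 (\<lambda>t. seqs
      [branch 13 (cmax d) (\<lambda>q. Put 13 (code (astep d c (f = 1 \<and> t = 0) (decode q)))), restore, Put 12 1]))))
      ((cstore s (a, b, fl, st'))(8 := c # ys)) = (cstore s (cst d (a, b, fl, st') c))(8 := c # ys)"
        using c ab by (auto simp: cstore_simp exec_branch fun_eq_iff)
    next
      case False
      then show "exec (branch 8 5 (\<lambda>c. if c = 0 then Skip else if c \<le> 2 then
      branch 12 2 (\<lambda>f. if f = 1 then
        branch 10 2 (\<lambda>t. if t = c then seqs [Pop 10, Push 11 c] else Put 12 2) else Skip)
    else branch 12 2 (\<lambda>f. branch 10 2 (\<lambda>t. seqs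
      [branch 13 (cmax d) (\<lambda>q. Put 13 (code (astep d c (f = 1 \<and> t = 0) (decode q)))), restore, Put 12 1]))))
      ((cstore s (a, b, fl, st'))(8 := c # ys)) = (cstore s (cst d (a, b, fl, st') c))(8 := c # ys)"
        using c ab lb cmax[OF inv(2)] a0 
        by (simp add: cstore_simp exec_branch exec_restore fun_eq_iff del: astep.simps)
    qed
  qed
  also have "\<dots> = ?S (s 8)" by (auto simp: cstore_def split: prod.splits)
  finally show ?thesis .
qed

text \<open>After a mismatch \<open>a\<close> and \<open>b\<close> are frozen until the marker;
  there the words count as equal iff no mismatch occurred and nothing is left over.\<close>

lemma cst_item:
  assumes "3 \<le> k"
  shows "foldl (cst d) (a, b, True, st) (map bit v @ [k]) = (rev b @ a, [], True, astep d k (a = map bit v) st)"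
proof (induction v arbitrary: a b)
  case Nil
  then show ?case using assms by (simp del: astep.simps)
next
  case (Cons c v)
  have no: "foldl (cst d) (a, b, False, st) (map bit v) = (a, b, False, st)" for a b
    by (induction v) (simp_all del: astep.simps)
  show ?case
  proof (cases "top a = bit c")
    case True
    then obtain a' where a: "a = bit c # a'" by (cases a) (simp_all add: bit_def split: if_splits)
    with Cons[of a' "bit c # b"] show ?thesis by (simp del: astep.simps)
  next
    case False
    then have "a \<noteq> map bit (c # v)" by auto
    with False no assms show ?thesis by (simp del: astep.simps)
  qed
qed

lemma cst_items:
  assumes "\<forall>(v, k)\<in>set its. 3 \<le> k"
  shows "foldl (cst d) (w, [], True, st) (toks its) =
    (w, [], True, foldl (\<lambda>st (v, k). astep d k (map bit v = w) st) st its)"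
  using assms
proof (induction its arbitrary: st)
  case (Cons i its)
  obtain v k where i: "i = (v, k)" by force
  have "toks (i # its) = (map bit v @ [k]) @ toks its" by (simp add: i)
  then have "foldl (cst d) (w, [], True, st) (toks (i # its)) =
      foldl (cst d) (w, [], True, astep d k (w = map bit v) st) (toks its)"
    using Cons.prems cst_item[of k d w "[]" st v] by (simp only: foldl_append) (simp add: i)
  also have "(w = map bit v) = (map bit v = w)" by blast
  finally show ?case using Cons by (simp add: i del: astep.simps)
qed simp

lemma exec_clear: "exec (For 0 (Pop 10)) s = s(10 := drop (length (s 0)) (s 10))"
proof -
  let ?S = "\<lambda>zs. s(10 := drop (length zs) (s 10))"
  have "exec (For 0 (Pop 10)) s = (?S (s 0))(0 := s 0)"
    by (rule exec_For) (simp_all add: fun_eq_iff drop_Suc tl_drop)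
  then show ?thesis by (simp add: fun_eq_iff)
qed

section \<open>The sweep over all letters to be tested\<close>

fun ost :: "nat \<Rightarrow> (letter \<times> nat) list \<Rightarrow> nat list \<times> bool \<times> bool \<Rightarrow> nat \<Rightarrow> nat list \<times> bool \<times> bool" where
  "ost d its (b, fo, ba) c =
     (if c \<le> 2 then (c # b, fo, ba)
      else ([], fo \<or> occ (scan d its (rev b)) = d, ba \<or> \<not> acc d (scan d its (rev b))))"

definition ostore :: "store \<Rightarrow> nat list \<times> bool \<times> bool \<Rightarrow> store" where
  "ostore s = (\<lambda>(b, fo, ba). s(11 := b, 14 := [if fo then 2 else 1], 15 := [if ba then 2 else 1]))"

lemma ostore_simp:
  "ostore s (b, fo, ba) = s(11 := b, 14 := [if fo then 2 else 1], 15 := [if ba then 2 else 1])"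
  by (simp add: ostore_def)

definition verdict :: "nat \<Rightarrow> com" where
  "verdict d = branch 13 (cmax d) (\<lambda>q. seqs [if acc d (decode q) then Skip else Put 15 2,
     if occ (decode q) = d then Put 14 2 else Skip, Put 13 (code ainit)])"

definition check_body :: "nat \<Rightarrow> com" where
  "check_body d = branch 7 5 (\<lambda>c. if c = 0 then Skip else if c \<le> 2 then Push 11 c
     else seqs [restore, inner d, verdict d, For 0 (Pop 10)])"

text \<open>The outer sweep has its own copy of the items: an inner loop over register 7 would see
  only the items not yet swept.\<close>

definition check :: "nat \<Rightarrow> com" where
  "check d = For 7 (check_body d)"

lemma scan_astates: "scan d its w \<in> astates d"
proof -
  have "st \<in> astates d \<Longrightarrow> foldl (\<lambda>st (v, k). astep d k (map bit v = w) st) st its \<in> astates d" for st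
  proof (induction its arbitrary: st)
    case (Cons i its)
    obtain v k where "i = (v, k)" by force
    with Cons.IH[OF astates(2)[OF Cons.prems]] show ?case by (simp del: astep.simps)
  qed simp
  then show ?thesis unfolding scan_def using astates(1) .
qed

lemma set_toks: "set (toks its) \<subseteq> {1..5}" if "\<forall>(v, k)\<in>set its. 3 \<le> k \<and> k \<le> 5"
  using that by (auto simp: toks_def bit_def)

lemma foldl_ost:
  assumes "foldl (ost d its) ([], fo, ba) zs = (b, fo', ba')" "set zs \<subseteq> {1..5}"
  shows "length b \<le> length zs \<and> set b \<subseteq> {1..2}"
  using assms
proof (induction zs arbitrary: b fo' ba' rule: rev_induct)
  case (snoc c zs)
  obtain b1 fo1 ba1 where f: "foldl (ost d its) ([], fo, ba) zs = (b1, fo1, ba1)"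
    by (metis prod_cases3)
  with snoc.IH[OF f] snoc.prems show ?case by (auto split: if_splits)
qed auto

lemma exec_check:
  assumes its: "\<forall>(v, k)\<in>set its. 3 \<le> k \<and> k \<le> 5"
    and s: "s 7 = toks its" "s 8 = toks its" "length (s 7) \<le> length (s 0)" "s 10 = []" "s 11 = []"
      "s 12 = [1]" "s 13 = [code ainit]" "s 14 = [1]" "s 15 = [1]"
  shows "exec (check d) s = ostore s (foldl (ost d its) ([], False, False) (toks its))"
proof -
  let ?S = "\<lambda>zs. ostore s (foldl (ost d its) ([], False, False) zs)"
  have "exec (check d) s = (?S (s 7))(7 := s 7)" unfolding check_def
  proof (rule exec_For)
    show "(?S [])(7 := s 7) = s" using s by (auto simp: ostore_def)
    fix zs c ys assume e: "s 7 = zs @ c # ys"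
    have m: "set (zs @ c # ys) \<subseteq> {1..5}" using set_toks[OF its] s(1) unfolding e by simp
    then have c: "1 \<le> c" "c \<le> 5" by auto
    have "length zs \<le> length (s 0)" using s(3) unfolding e by simp
    note m = m this
    obtain b fo ba where f: "foldl (ost d its) ([], False, False) zs = (b, fo, ba)"
      by (metis prod_cases3)
    have b: "length b \<le> length (s 0)" "set b \<subseteq> {1..2}"
      using foldl_ost[OF f] m by auto
    let ?s = "(ostore s (b, fo, ba))(7 := c # ys)"
    let ?st = "scan d its (rev b)"
    show "exec (check_body d) ((?S zs)(7 := c # ys)) = (?S (zs @ [c]))(7 := c # ys)"
      unfolding foldl_append f foldl.simps
    proof (cases "c \<le> 2")
      case True
      with c show "exec (check_body d) ?s = (ostore s (ost d its (b, fo, ba) c))(7 := c # ys)"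
        by (simp add: check_body_def exec_branch ostore_simp fun_eq_iff)
    next
      case False
      have 1: "exec restore ?s = ?s(10 := rev b, 11 := [])"
        using b s by (subst exec_restore) (auto simp: ostore_simp)
      let ?t = "?s(10 := rev b, 11 := [])"
      have "exec (inner d) ?t = cstore ?t (foldl (cst d) (?t 10, [], True, ainit) (?t 8))"
        by (rule exec_inner) (use b s set_toks[OF its] astates(1) in \<open>auto simp: ostore_simp\<close>)
      also have "foldl (cst d) (?t 10, [], True, ainit) (?t 8) = (rev b, [], True, ?st)"
        using s its by (simp add: ostore_simp scan_def) (subst cst_items; auto)
      also have "cstore ?t (rev b, [], True, ?st) = ?t(13 := [code ?st])"
        using s by (simp add: cstore_simp ostore_simp fun_eq_iff)
      finally have 2: "exec (inner d) ?t = ?t(13 := [code ?st])" .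
      have 3: "exec (verdict d) (?t(13 := [code ?st])) = (ostore s ([], fo \<or> occ ?st = d, ba \<or> \<not> acc d ?st))(7 := c # ys, 10 := rev b)"
        using s cmax[OF scan_astates] by (simp add: verdict_def exec_branch ostore_simp fun_eq_iff)
      have "exec (check_body d) ?s = exec (For 0 (Pop 10)) (exec (verdict d) (exec (inner d) (exec restore ?s)))"
        using c False by (simp add: check_body_def exec_branch)
      also have "\<dots> = (ostore s (ost d its (b, fo, ba) c))(7 := c # ys)"
        unfolding 1 2 3 exec_clear using b s False by (simp add: ostore_simp fun_eq_iff)
      finally show "exec (check_body d) ?s = (ostore s (ost d its (b, fo, ba) c))(7 := c # ys)" .
    qed
  qed
  also have "\<dots> = ?S (toks its)" using s by (auto simp: ostore_def split: prod.splits)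
  finally show ?thesis .
qed

lemma ost_items:
  assumes "\<forall>(v, k)\<in>set its'. 3 \<le> k"
  shows "foldl (ost d its) ([], fo, ba) (toks its') =
    ([], fo \<or> (\<exists>(v, k)\<in>set its'. occ (scan d its (map bit v)) = d),
     ba \<or> (\<exists>(v, k)\<in>set its'. \<not> acc d (scan d its (map bit v))))"
  using assms
proof (induction its' arbitrary: fo ba)
  case (Cons i its')
  obtain v k where i: "i = (v, k)" by force
  have "foldl (ost d its) (b, fo, ba) (map bit v) = (rev (map bit v) @ b, fo, ba)" for b
    by (induction v arbitrary: b) auto
  with Cons show ?case by (simp add: i)
qed simp

definition rev_copy :: "nat \<Rightarrow> nat \<Rightarrow> com" where
  "rev_copy q r = For q (branch q 2 (\<lambda>c. if c = 0 then Skip else Push r c))"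

lemma exec_rev_copy:
  assumes "set (s q) \<subseteq> {1..2}" "q \<noteq> r"
  shows "exec (rev_copy q r) s = s(r := rev (s q) @ s r)"
proof -
  let ?S = "\<lambda>zs. s(r := rev zs @ s r)"
  have "exec (rev_copy q r) s = (?S (s q))(q := s q)" unfolding rev_copy_def
  proof (rule exec_For)
    fix zs a ys assume "s q = zs @ a # ys"
    with assms have "1 \<le> a" "a \<le> 2" by auto
    then show "exec (branch q 2 (\<lambda>c. if c = 0 then Skip else Push r c)) ((?S zs)(q := a # ys)) =
      (?S (zs @ [a]))(q := a # ys)" using assms(2) by (simp add: exec_branch fun_eq_iff)
  qed simp
  then show ?thesis using assms(2) by (simp add: fun_eq_iff)
qed

text \<open>The bound is compared with the number of selected letters by halving, bit by bit.\<close>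

definition copy_bits :: com where
  "copy_bits = rev_copy 6 16"

text \<open>Halving in unary, with register 0 as the clock. A single symbol left over is dropped,
  which rounds down.\<close>

definition halve1 :: com where
  "halve1 = For 0 (branch 9 1 (\<lambda>t. if t = 0 then Skip else Seq (Pop 9)
     (branch 9 1 (\<lambda>t. if t = 0 then Skip else seqs [Pop 9, Push 17 1]))))"

lemma top_ones: "top (replicate n a) = (if n = 0 then 0 else a)"
  by (cases n) auto

lemma tl_ones: "tl (replicate n a) = replicate (n - 1) a"
  by (cases n) auto

lemma exec_halve1:
  assumes "s 9 = replicate m 1" "s 17 = []" "m \<le> length (s 0)"
  shows "exec halve1 s = s(9 := [], 17 := replicate (m div 2) 1)"
proof -
  let ?S = "\<lambda>zs. s(9 := replicate (m - 2 * length zs) 1, 17 := replicate (min (length zs) (m div 2)) (1 :: nat))"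
  have "exec halve1 s = (?S (s 0))(0 := s 0)" unfolding halve1_def
  proof (rule exec_For)
    show "(?S [])(0 := s 0) = s" using assms by auto
    fix zs a ys assume "s 0 = zs @ a # ys"
    consider "m \<le> 2 * length zs" | "m = Suc (2 * length zs)" | k where "m = Suc (Suc (k + 2 * length zs))"
      by (metis add.commute le_Suc_ex not_less_eq_eq Suc_leI add_Suc le_antisym)
    then show "exec (branch 9 1 (\<lambda>t. if t = 0 then Skip else Seq (Pop 9)
     (branch 9 1 (\<lambda>t. if t = 0 then Skip else seqs [Pop 9, Push 17 1])))) ((?S zs)(0 := a # ys)) =
      (?S (zs @ [a]))(0 := a # ys)"
      by cases (simp add: exec_branch fun_eq_iff min_def; presburger?)+
  qed
  also have "\<dots> = s(9 := [], 17 := replicate (m div 2) 1)"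
    using assms by (simp add: fun_eq_iff min.absorb2[OF order_trans[OF div_le_dividend]])
  finally show ?thesis .
qed

definition halve2 :: com where
  "halve2 = For 0 (branch 17 1 (\<lambda>t. if t = 0 then Skip else seqs [Pop 17, Push 9 1]))"

lemma exec_halve2:
  assumes "s 9 = []" "s 17 = replicate m 1" "m \<le> length (s 0)"
  shows "exec halve2 s = s(9 := replicate m 1, 17 := [])"
proof -
  let ?S = "\<lambda>zs. s(17 := replicate (m - length zs) 1, 9 := replicate (min (length zs) m) (1 :: nat))"
  have "exec halve2 s = (?S (s 0))(0 := s 0)" unfolding halve2_def
  proof (rule exec_For)
    show "(?S [])(0 := s 0) = s" using assms by auto
    fix zs a ys assume "s 0 = zs @ a # ys"
    consider "m \<le> length zs" | k where "m = Suc (k + length zs)"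
      by (metis add.commute add_Suc less_imp_Suc_add not_le)
    then show "exec (branch 17 1 (\<lambda>t. if t = 0 then Skip else seqs [Pop 17, Push 9 1])) ((?S zs)(0 := a # ys)) =
      (?S (zs @ [a]))(0 := a # ys)"
      by cases (simp add: exec_branch fun_eq_iff min_def; presburger?)+
  qed
  then show ?thesis using assms by (simp add: fun_eq_iff)
qed

fun lst :: "nat \<times> bool \<Rightarrow> nat \<Rightarrow> nat \<times> bool" where
  "lst (m, ok) c = ((if c = 2 then m - 1 else m) div 2, ok \<and> \<not> (c = 2 \<and> m = 0))"

definition lstore :: "store \<Rightarrow> nat \<times> bool \<Rightarrow> store" where
  "lstore s = (\<lambda>(m, ok). s(9 := replicate m 1, 18 := [if ok then 1 else 2]))"

lemma lstore_simp: "lstore s (m, ok) = s(9 := replicate m 1, 18 := [if ok then 1 else 2])"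
  by (simp add: lstore_def)

definition compare :: com where
  "compare = For 16 (Seq (branch 16 2 (\<lambda>c. if c = 2 then branch 9 1 (\<lambda>t. if t = 0 then Put 18 2 else Pop 9) else Skip))
     (Seq halve1 halve2))"

lemma foldl_lst_le: "fst (foldl lst (m, ok) zs) \<le> m"
proof (induction zs arbitrary: m ok)
  case (Cons c zs)
  have "fst (foldl lst (lst (m, ok) c) zs) \<le> fst (lst (m, ok) c)" by (metis Cons lst.simps prod.collapse)
  then show ?case by (simp split: if_splits) 
qed simp

lemma exec_compare:
  assumes "set (s 16) \<subseteq> {1..2}" "s 9 = replicate m 1" "s 17 = []" "s 18 = [1]" "m \<le> length (s 0)"
  shows "exec compare s = lstore s (foldl lst (m, True) (s 16))"
proof -
  let ?S = "\<lambda>zs. lstore s (foldl lst (m, True) zs)"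
  have "exec compare s = (?S (s 16))(16 := s 16)" unfolding compare_def
  proof (rule exec_For)
    show "(?S [])(16 := s 16) = s" using assms by (auto simp: lstore_def)
    fix zs c ys assume "s 16 = zs @ c # ys"
    then have c: "1 \<le> c" "c \<le> 2" using assms(1) by auto
    obtain n ok where f: "foldl lst (m, True) zs = (n, ok)" by force
    then have n: "n \<le> length (s 0)" using foldl_lst_le[of m True zs] assms by simp
    let ?s = "(lstore s (n, ok))(16 := c # ys)"
    define n' where "n' = (if c = 2 then n - 1 else n)"
    have 1: "exec (branch 16 2 (\<lambda>c. if c = 2 then branch 9 1 (\<lambda>t. if t = 0 then Put 18 2 else Pop 9) else Skip)) ?s =
      (lstore s (n', ok \<and> \<not> (c = 2 \<and> n = 0)))(16 := c # ys)"
      using c by (auto simp: exec_branch lstore_simp top_ones tl_ones n'_def fun_eq_iff)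
    have n': "n' \<le> length (s 0)" using n by (auto simp: n'_def)
    have 2: "exec halve1 ((lstore s (n', ok \<and> \<not> (c = 2 \<and> n = 0)))(16 := c # ys)) =
       (lstore s (n', ok \<and> \<not> (c = 2 \<and> n = 0)))(16 := c # ys, 9 := [], 17 := replicate (n' div 2) 1)"
      by (rule exec_halve1) (use assms n' in \<open>simp_all add: lstore_simp\<close>)
    have 3: "exec halve2 ((lstore s (n', ok \<and> \<not> (c = 2 \<and> n = 0)))(16 := c # ys, 9 := [], 17 := replicate (n' div 2) 1)) =
       (lstore s (n', ok \<and> \<not> (c = 2 \<and> n = 0)))(16 := c # ys, 9 := [], 17 := replicate (n' div 2) 1,
          9 := replicate (n' div 2) 1, 17 := [])"
      by (rule exec_halve2) (use assms n' in \<open>simp_all add: lstore_simp\<close>)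
    show "exec (Seq (branch 16 2 (\<lambda>c. if c = 2 then branch 9 1 (\<lambda>t. if t = 0 then Put 18 2 else Pop 9) else Skip))
     (Seq halve1 halve2)) ((?S zs)(16 := c # ys)) = (?S (zs @ [c]))(16 := c # ys)"
      unfolding foldl_append f foldl.simps exec.simps 1 2 3
      using assms by (simp add: lstore_simp n'_def fun_eq_iff)
  qed
  also have "\<dots> = ?S (s 16)" by (auto simp: lstore_def split: prod.splits)
  finally show ?thesis .
qed

primrec val :: "bool list \<Rightarrow> nat" where
  "val [] = 0"
| "val (b # bs) = of_bool b + 2 * val bs"

text \<open>\<open>b + 2 * v \<le> m\<close> iff \<open>b \<le> m\<close> and
  \<open>v \<le> (m - b) div 2\<close>. The bound is written in binary and may be exponentially
  large, so the number of letters is halved instead of the bound being counted out.\<close>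

lemma lst_val: "snd (foldl lst (m, ok) (map bit bs)) \<longleftrightarrow> ok \<and> val bs \<le> m"
proof (induction bs arbitrary: m ok)
  case (Cons b bs)
  have h: "v \<le> m div 2 \<longleftrightarrow> 2 * v \<le> m" "v \<le> (m - Suc 0) div 2 \<and> 0 < m \<longleftrightarrow> Suc (2 * v) \<le> m" for v
    by presburger+
  show ?case using Cons h[of "val bs"] by (cases b) (simp_all, blast)
qed simp

section \<open>The complete verifier\<close>

definition prepare :: com where
  "prepare = seqs [Push 2 1, Push 3 1, Push 12 1, Push 13 (code ainit), Push 14 1, Push 15 1, Push 18 1]"

definition answer :: com where
  "answer = branch 3 14 (\<lambda>q. branch 6 2 (\<lambda>t. branch 14 2 (\<lambda>fo. branch 15 2 (\<lambda>ba. branch 18 2 (\<lambda>lo.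
     if fo = 2 \<and> ba = 1 \<and> (q = 12 \<and> t \<noteq> 1 \<and> lo = 1 \<or> q = 13 \<and> t = 2) then Out 2 else Skip)))))"

definition verifier :: "nat \<Rightarrow> com" where
  "verifier d = seqs [prepare, pass1, pass2, check d, copy_bits, compare, answer]"

lemma wfc_seqs [simp]: "wfc (seqs cs) \<longleftrightarrow> (\<forall>c\<in>set cs. wfc c)"
  by (induction cs) auto

lemma bnd_seqs [simp]: "bnd X (seqs cs) \<longleftrightarrow> (\<forall>c\<in>set cs. bnd X c)"
  by (induction cs) auto

lemma mods_seqs [simp]: "mods (seqs cs) = (\<Union>c\<in>set cs. mods c)"
  by (induction cs) auto

lemma good_seqs: "\<forall>c\<in>set cs. good c \<Longrightarrow> good (seqs cs)"
  by (induction cs) (auto intro: good_Seq good_bnd[of "{}"])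

lemma wfc_verifier: "wfc (verifier d)"
proof -
  have r: "wfc restore" "mods restore \<subseteq> {10, 11}"
    by (auto simp: restore_def mods_branch intro!: wfc_branch split: if_splits)
  have i: "wfc (inner d)" "mods (inner d) \<subseteq> {10, 11, 12, 13}"
    using r by (auto simp: inner_def mods_branch intro!: wfc_branch split: if_splits)
  have v: "wfc (verdict d)" "mods (verdict d) \<subseteq> {13, 14, 15}"
    by (auto simp: verdict_def mods_branch intro!: wfc_branch split: if_splits)
  have c: "wfc (check d)"
    using r i v by (auto simp: check_def check_body_def mods_branch intro!: wfc_branch split: if_splits)
  have n: "Suc 0 \<le> nx q c" if "q \<le> 14" for q c using nx_bounds[OF that] by simp
  have p1: "wfc pass1"
    by (auto simp: n pass1_def mods_branch emitW_def emitL_def intro!: wfc_branch split: if_splits)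
  have p2: "wfc pass2"
    by (auto simp: pass2_def mods_branch intro!: wfc_branch split: if_splits)
  have "wfc copy_bits"
    by (auto simp: copy_bits_def rev_copy_def mods_branch intro!: wfc_branch split: if_splits)
  moreover have h: "wfc halve1" "wfc halve2" "mods halve1 \<subseteq> {9, 17}" "mods halve2 \<subseteq> {9, 17}"
    by (auto simp: halve1_def halve2_def mods_branch intro!: wfc_branch split: if_splits)
  then have "wfc compare"
    by (auto simp: compare_def mods_branch intro!: wfc_branch split: if_splits)
  moreover have "wfc answer" by (auto simp: answer_def intro!: wfc_branch)
  ultimately show ?thesis using c p1 p2 by (simp add: verifier_def prepare_def)
qed

lemma good_verifier: "good (verifier d)"
proof -
  have r: "bnd {0, 7, 8} restore" by (auto simp: restore_def intro!: bnd_branch)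
  then have i: "bnd {0, 7, 8} (inner d)" by (auto simp: inner_def intro!: bnd_branch)
  have "bnd {0, 7, 8} (verdict d)" by (auto simp: verdict_def intro!: bnd_branch)
  with r i have c: "bnd {0, 7, 8} (check d)" by (auto simp: check_def check_body_def intro!: bnd_branch)
  have "bnd {0} pass1" by (auto simp: pass1_def emitW_def emitL_def intro!: bnd_branch)
  moreover have "bnd {4} pass2" by (auto simp: pass2_def intro!: bnd_branch)
  moreover have "bnd {6} copy_bits" by (auto simp: copy_bits_def rev_copy_def intro!: bnd_branch)
  moreover have "bnd {0, 16} compare"
    by (auto simp: compare_def halve1_def halve2_def intro!: bnd_branch)
  moreover have "bnd {} answer" by (auto simp: answer_def intro!: bnd_branch)
  moreover have "bnd {} prepare" by (simp add: prepare_def)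
  ultimately show ?thesis unfolding verifier_def using c
    by (intro good_seqs) (auto intro: good_bnd)
qed

theorem polytime_verifier: "polytime (result (verifier d))"
  using polytimeI wfc_verifier good_verifier .

text \<open>\<open>enc_int\<close> produces neither leading zeros nor a negative zero. With the
  least significant bit first, this is a condition on the last bit, which is on top of register 6
  after parsing.\<close>

definition canon :: "bool \<Rightarrow> bool list \<Rightarrow> bool" where
  "canon sg bs \<longleftrightarrow> (if sg then bs \<noteq> [] \<and> last bs else bs = [] \<or> last bs)"

definition chk :: "nat \<Rightarrow> letter list \<Rightarrow> letter list \<Rightarrow> bool list \<Rightarrow> bool \<Rightarrow> bool list \<Rightarrow> bool" where
  "chk d A S ms sg bs \<longleftrightarrow> (let its = mitems A S ms in
     (\<forall>(v, k)\<in>set its. acc d (scan d its (map bit v))) \<and>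
     (\<exists>(v, k)\<in>set its. occ (scan d its (map bit v)) = d) \<and>
     (sg \<or> val bs \<le> length (filter (\<lambda>m. m) ms)))"

lemma top_rev: "top (rev (map bit bs)) = (if bs = [] then 0 else bit (last bs))"
  by (cases bs rule: rev_cases) auto

lemma set_map_bit: "set (map bit w) \<subseteq> {1..2}"
  by (auto simp: bit_def)

lemma length_toks_items: "length (toks (items A S)) \<le> length (enc_list enc_word A) + length (enc_list enc_word S)"
proof -
  have w: "length w < length (enc_word w)" for w by (induction w) auto
  have "length (toks (map (\<lambda>w. (w, k)) ws)) \<le> length (enc_list enc_word ws)" for k ws
  proof (induction ws)
    case (Cons a ws)
    then show ?case using w[of a] by simp
  qed simp
  then show ?thesis by (simp add: add_mono)
qed

lemma length_toks_mitems: "length ms = length S \<Longrightarrow> length (toks (mitems A S ms)) = length (toks (items A S))"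
proof -
  assume "length ms = length S"
  then have "length S = length ms" by simp
  then have "length (toks (marked S ms)) = length (toks (map (\<lambda>w. (w, 4)) S))"
    by (induction S ms rule: list_induct2) (auto simp: marked_def)
  then show ?thesis by simp
qed

lemma length_enc_list: "length S \<le> length (enc_list e S)"
  by (induction S) auto

lemma mark_kinds: "\<forall>(v, k)\<in>set (mitems A S ms). 3 \<le> k \<and> k \<le> 5"
  by (auto simp: marked_def)

lemma exec_prepare:
  "exec prepare (start y) = (start y)(2 := [1], 3 := [1], 12 := [1], 13 := [code ainit], 14 := [1], 15 := [1], 18 := [1])"
  by (simp add: prepare_def start_def fun_eq_iff)

lemma start_simps: "start y 0 = map bit y" "r \<noteq> 0 \<Longrightarrow> start y r = []"
  by (simp_all add: start_def)

lemma exec_first: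
  assumes "parse x = (q, W, L)"
  shows "exec pass1 (exec prepare (start (enc_pair x u))) =
    fstore (exec prepare (start (enc_pair x u))) (3, (q, W, L), rev (map bit u))"
proof -
  have "exec pass1 (exec prepare (start (enc_pair x u))) =
    fstore (exec prepare (start (enc_pair x u))) (foldl fstep (1, (1, [], []), []) (exec prepare (start (enc_pair x u)) 0))"
    by (rule exec_pass1) (auto simp: exec_prepare start_simps bit_def)
  also have "exec prepare (start (enc_pair x u)) 0 = map bit (enc_pair x u)"
    by (simp add: exec_prepare start_simps)
  finally show ?thesis unfolding fold_pair assms[unfolded parse_def] .
qed

text \<open>On malformed input the later phases may compute anything: they modify neither the parser
  state in register 3 nor the output, and \<open>answer\<close> looks at that state.\<close>

lemma verifier_parses:
  assumes "result (verifier d) (enc_pair x u) = [True]" "parse x = (q, W, L)"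
  shows "q = 12 \<or> q = 13"
proof (rule ccontr)
  assume q: "\<not> (q = 12 \<or> q = 13)"
  let ?s = "exec pass1 (exec prepare (start (enc_pair x u)))"
  have s: "?s 3 = [q]" "?s 1 = []" unfolding exec_first[OF assms(2)]
    by (simp_all add: fstore_simp exec_prepare start_simps)
  have q14: "q \<le> 14" using parse_invI[OF assms(2)] by (auto simp: parse_inv_def)
  let ?c = "seqs [pass2, check d, copy_bits, compare]"
  let ?t = "exec ?c ?s"
  have r: "mods restore \<subseteq> {10, 11}" by (auto simp: restore_def mods_branch split: if_splits)
  have i: "mods (inner d) \<subseteq> {10, 11, 12, 13}"
    using r by (auto simp: inner_def mods_branch split: if_splits)
  have v: "mods (verdict d) \<subseteq> {13, 14, 15}"
    by (auto simp: verdict_def mods_branch split: if_splits)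
  have m: "1 \<notin> mods ?c" "3 \<notin> mods ?c"
    using r i v by (auto simp: pass2_def check_def check_body_def copy_bits_def rev_copy_def compare_def halve1_def halve2_def
        mods_branch split: if_splits)
  have t: "?t 3 = [q]" "?t 1 = []" using exec_unmod[OF m(1)] exec_unmod[OF m(2)] s by simp_all
  let ?b = "branch 6 2 (\<lambda>t. branch 14 2 (\<lambda>fo. branch 15 2 (\<lambda>ba. branch 18 2 (\<lambda>lo.
     if fo = 2 \<and> ba = 1 \<and> (q = 12 \<and> t \<noteq> 1 \<and> lo = 1 \<or> q = 13 \<and> t = 2) then Out 2 else Skip))))"
  have "exec answer ?t = exec ?b ?t" unfolding answer_def using t q14 by (subst exec_branch) simp_all
  moreover have "1 \<notin> mods ?b" using q by (simp add: mods_branch)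
  ultimately have "exec answer ?t 1 = []" using exec_unmod[of 1 ?b ?t] t by simp
  with assms(1) show False by (simp add: result_def verifier_def)
qed

text \<open>Soundness requires that every certificate act as some mask \<open>ms\<close>,
  completeness that a mask be its own certificate; the statement serves both.\<close>

lemma verifier_core:
  assumes x: "x = enc_list enc_word A @ enc_list enc_word S @ sg # enc_word bs"
  shows "\<exists>ms. length ms = length S \<and> (length u = length S \<longrightarrow> ms = u) \<and>
    (result (verifier d) (enc_pair x u) = [True] \<longleftrightarrow> canon sg bs \<and> chk d A S ms sg bs)"
proof -
  have parse: "parse x = (if sg then 13 else 12, rev (toks (items A S)), rev (map bit bs))"
    unfolding x by (rule parse_complete)
  let ?q = "if sg then 13 else 12 :: nat"
  let ?y = "enc_pair x u"
  let ?N = "length ?y"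
  define s1 where "s1 = exec prepare (start ?y)"
  define s2 where "s2 = fstore s1 (3, (?q, rev (toks (items A S)), rev (map bit bs)), rev (map bit u))"
  have 2: "exec pass1 s1 = s2" using exec_first[OF parse] by (simp add: s1_def s2_def)
  from fold_mst_S[where W = "[]" and n = 0 and U = "rev (map bit u)" and S = S] obtain ms U' where
    ms: "length ms = length S" "\<forall>ms'. length ms' = length S \<longrightarrow> rev (map bit u) = rev (map bit ms') \<longrightarrow> ms = ms'"
    "foldl mst ([], 0, rev (map bit u)) (rev (toks (map (\<lambda>w. (w, 4)) S))) =
       (toks (marked S ms), length (filter (\<lambda>m. m) ms), U')" by auto
  let ?I = "mitems A S ms" and ?n = "length (filter (\<lambda>m. m) ms)"
  define s3 where "s3 = mstore s2 (toks ?I, ?n, U')"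
  have s10: "s1 0 = map bit ?y" by (simp add: s1_def exec_prepare start_simps)
  have s1r: "s1 r = (if r \<in> {2, 3, 12, 14, 15, 18} then [1] else if r = 13 then [code ainit] else [])"
    if "r \<noteq> 0" for r using that by (auto simp: s1_def exec_prepare start_simps)
  note s1v = s10 s1r
  have "set (toks (items A S)) \<subseteq> {1..4}" by (auto simp: toks_def bit_def)
  then have "exec pass2 s2 = mstore s2 (foldl mst ([], 0, s2 5) (s2 4))"
    by (intro exec_pass2) (auto simp: s2_def fstore_simp s1v bit_def)
  also have "foldl mst ([], 0, s2 5) (s2 4) = (toks ?I, ?n, U')"
    by (simp add: s2_def fstore_simp ms fold_mst_A)
  finally have 3: "exec pass2 s2 = s3" by (simp add: s3_def)
  have N: "length (toks ?I) \<le> ?N" "?n \<le> ?N"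
  proof -
    have y: "length x \<le> ?N"
    proof -
      have "length x \<le> length (enc_word x)" for x by (induction x) auto
      then show ?thesis by (simp add: enc_pair_def trans_le_add1)
    qed
    have "length (toks ?I) \<le> length x"
      using length_toks_items[of A S] length_toks_mitems[OF ms(1), of A] by (simp add: x)
    with y show "length (toks ?I) \<le> ?N" by simp
    have "?n \<le> length S" using ms(1) by (metis length_filter_le)
    also have "\<dots> \<le> length x" using length_enc_list[of S enc_word] by (simp add: x)
    finally show "?n \<le> ?N" using y by simp
  qed
  define fo where "fo \<longleftrightarrow> (\<exists>(v, k)\<in>set ?I. occ (scan d ?I (map bit v)) = d)"
  define ba where "ba \<longleftrightarrow> (\<exists>(v, k)\<in>set ?I. \<not> acc d (scan d ?I (map bit v)))"
  define s4 where "s4 = ostore s3 ([], fo, ba)"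
  have "exec (check d) s3 = ostore s3 (foldl (ost d ?I) ([], False, False) (toks ?I))"
    by (rule exec_check[OF mark_kinds]) (use N in \<open>simp_all add: s3_def s2_def mstore_simp fstore_simp s1v\<close>)
  also have "foldl (ost d ?I) ([], False, False) (toks ?I) = ([], fo, ba)"
    using ost_items[of ?I d ?I False False] mark_kinds[of A S ms] by (auto simp: fo_def ba_def)
  finally have 4: "exec (check d) s3 = s4" by (simp add: s4_def)
  define s5 where "s5 = s4(16 := map bit bs)"
  have "exec copy_bits s4 = s4(16 := rev (s4 6) @ s4 16)"
    unfolding copy_bits_def by (rule exec_rev_copy) (auto simp: s4_def s3_def s2_def ostore_simp mstore_simp fstore_simp bit_def)
  then have 5: "exec copy_bits s4 = s5"
    by (simp add: s5_def s4_def s3_def s2_def ostore_simp mstore_simp fstore_simp s1v)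
  obtain m' lo where lo: "foldl lst (?n, True) (map bit bs) = (m', lo)" by force
  have lo_val: "lo \<longleftrightarrow> val bs \<le> ?n" using lst_val[of ?n True bs] lo by simp
  have "exec compare s5 = lstore s5 (foldl lst (?n, True) (s5 16))"
    by (rule exec_compare) (use N set_map_bit in \<open>simp_all add: s5_def s4_def s3_def s2_def ostore_simp mstore_simp fstore_simp s1v\<close>)
  then have 6: "exec compare s5 = lstore s5 (m', lo)" by (simp add: s5_def lo)
  define s6 where "s6 = lstore s5 (m', lo)"
  have v6: "s6 3 = [?q]" "s6 6 = rev (map bit bs)" "s6 14 = [if fo then 2 else 1]"
    "s6 15 = [if ba then 2 else 1]" "s6 18 = [if lo then 1 else 2]" "s6 1 = []"
    by (simp_all add: s6_def lstore_simp s5_def s4_def s3_def s2_def ostore_simp mstore_simp fstore_simp s1v)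
  have t: "top (rev (map bit bs)) \<le> 2" by (simp add: top_rev)
  have "exec (verifier d) (start ?y) 1 = exec answer s6 1"
    by (simp add: verifier_def s1_def[symmetric] 2 3 4 5 6 s6_def[symmetric])
  also have "exec answer s6 1 = (if fo \<and> \<not> ba \<and> (if sg then top (rev (map bit bs)) = 2 else top (rev (map bit bs)) \<noteq> 1 \<and> lo)
      then [2] else [])"
    unfolding answer_def using t by (simp add: exec_branch v6 v6(6)[unfolded One_nat_def])
  finally have "exec (verifier d) (start ?y) 1 = (if fo \<and> \<not> ba \<and> (if sg then top (rev (map bit bs)) = 2 else top (rev (map bit bs)) \<noteq> 1 \<and> lo)
      then [2] else [])" .
  then have "result (verifier d) ?y = [True] \<longleftrightarrow> canon sg bs \<and> chk d A S ms sg bs"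
    unfolding result_def canon_def chk_def Let_def fo_def[symmetric] lo_val top_rev
    by (auto simp: ba_def bit_def)
  moreover have "length u = length S \<longrightarrow> ms = u" using ms(2) by simp
  ultimately show ?thesis using ms(1) by blast
qed

lemma verifier_iff:
  "(\<exists>u. length u \<le> length x \<and> result (verifier d) (enc_pair x u) = [True]) \<longleftrightarrow>
   (\<exists>A S sg bs ms. x = enc_list enc_word A @ enc_list enc_word S @ sg # enc_word bs \<and>
      length ms = length S \<and> canon sg bs \<and> chk d A S ms sg bs)" (is "?L \<longleftrightarrow> ?R")
proof
  assume ?L
  then obtain u where u: "result (verifier d) (enc_pair x u) = [True]" by blast
  obtain q W L where p: "parse x = (q, W, L)" by (metis prod_cases3)
  from parse_sound[OF p verifier_parses[OF u p]] obtain A S bs where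
    x: "x = enc_list enc_word A @ enc_list enc_word S @ (q = 13) # enc_word bs" by metis
  from verifier_core[OF x, of u d] u x show ?R by blast
next
  assume ?R
  then obtain A S sg bs ms where x: "x = enc_list enc_word A @ enc_list enc_word S @ sg # enc_word bs"
    and m: "length ms = length S" and c: "canon sg bs" "chk d A S ms sg bs" by blast
  from verifier_core[OF x, of ms d] m c have "result (verifier d) (enc_pair x ms) = [True]" by auto
  moreover have "length ms \<le> length x" using length_enc_list[of S enc_word] m by (simp add: x)
  ultimately show ?L by blast
qed

section \<open>Membership in NP\<close>

lemma val_nat_bits: "val (nat_bits n) = n"
  by (induction n rule: nat_bits.induct) (auto simp: nat_bits.simps[of n for n] of_bool_odd_eq_mod_2)

lemma nat_bits_val: "bs = [] \<or> last bs \<Longrightarrow> nat_bits (val bs) = bs"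
proof (induction bs)
  case Nil
  then show ?case by (simp add: nat_bits.simps)
next
  case (Cons b bs)
  have "val (b # bs) \<noteq> 0"
    using Cons.prems
  proof (induction bs arbitrary: b)
    case (Cons c bs)
    then show ?case by (auto split: if_splits)
  qed simp
  moreover have "bs = [] \<or> last bs" using Cons.prems by (auto split: if_splits)
  ultimately show ?case using Cons.IH by (subst nat_bits.simps) (auto simp: of_bool_def)
qed

lemma last_nat_bits: "n \<noteq> 0 \<Longrightarrow> nat_bits n \<noteq> [] \<and> last (nat_bits n)"
proof (induction n rule: nat_bits.induct)
  case (1 n)
  show ?case
  proof (cases "n div 2 = 0")
    case True
    with 1(2) have "n = 1" by simp
    then show ?thesis by (simp add: nat_bits.simps)
  next
    case False
    with 1 show ?thesis by (subst (1 2) nat_bits.simps) simp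
  qed
qed

lemma enc_int_canon: "canon (l < 0) (nat_bits (nat \<bar>l\<bar>))"
  using last_nat_bits[of "nat \<bar>l\<bar>"] by (cases "l = 0") (auto simp: canon_def nat_bits.simps[of 0])

lemma canon_enc_int:
  assumes "canon sg bs"
  obtains l where "sg # enc_word bs = enc_int l" "sg = (l < 0)" "val bs = nat \<bar>l\<bar>"
proof
  let ?l = "if sg then - int (val bs) else int (val bs)"
  have b: "nat_bits (val bs) = bs" using assms by (intro nat_bits_val) (auto simp: canon_def split: if_splits)
  have "nat_bits 0 = []" by (simp add: nat_bits.simps)
  then have "val bs \<noteq> 0" if sg using b assms that by (metis canon_def)
  then show "sg = (?l < 0)" "val bs = nat \<bar>?l\<bar>" by auto
  then show "sg # enc_word bs = enc_int ?l" using b by (simp add: enc_int_def)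
qed

section \<open>Selections by masks, and runs of letters\<close>

definition sel :: "'a list \<Rightarrow> bool list \<Rightarrow> 'a list" where
  "sel S ms = map fst (filter snd (zip S ms))"

lemma sel_simps [simp]: "sel [] ms = []" "sel (x # S) (m # ms) = (if m then x # sel S ms else sel S ms)"
  by (simp_all add: sel_def)

lemma length_sel: "length ms = length S \<Longrightarrow> length (sel S ms) = length (filter (\<lambda>m. m) ms)"
proof -
  assume "length ms = length S"
  then have "length S = length ms" by simp
  then show ?thesis by (induction S ms rule: list_induct2) auto
qed

lemma subseq_set: "subseq T S \<Longrightarrow> set T \<subseteq> set S"
  by (induction rule: list_emb.induct) auto

lemma subseq_sel: "subseq T S \<longleftrightarrow> (\<exists>ms. length ms = length S \<and> T = sel S ms)"
proof
  assume "subseq T S"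
  then show "\<exists>ms. length ms = length S \<and> T = sel S ms"
  proof (induction rule: list_emb.induct)
    case (list_emb_Nil S)
    have "sel S (replicate (length S) False) = []" by (induction S) auto
    then show ?case by (metis length_replicate)
  next
    case (list_emb_Cons T S x)
    then obtain ms where "length ms = length S" "T = sel S ms" by blast
    then show ?case by (intro exI[of _ "False # ms"]) simp
  next
    case (list_emb_Cons2 x y T S)
    then obtain ms where "length ms = length S" "T = sel S ms" by blast
    with list_emb_Cons2 show ?case by (intro exI[of _ "True # ms"]) simp
  qed
next
  assume "\<exists>ms. length ms = length S \<and> T = sel S ms"
  then obtain ms where "length ms = length S" "T = sel S ms" by blast
  then have "length S = length ms" "T = sel S ms" by auto
  then show "subseq T S" by (induction S ms arbitrary: T rule: list_induct2) (auto simp: subseq_Cons')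
qed

text \<open>All runs of \<open>a\<close> have length at least 2, given that \<open>r\<close> copies (capped at 2) precede.\<close>

primrec rok :: "'a \<Rightarrow> nat \<Rightarrow> 'a list \<Rightarrow> bool" where
  "rok a r [] = (r \<noteq> 1)"
| "rok a r (x # xs) = (if x = a then rok a (min 2 (Suc r)) xs else r \<noteq> 1 \<and> rok a 0 xs)"

text \<open>The run length in the automaton changes at selected letters only, so it follows
  \<open>rok\<close> on the selected subsequence. The final test \<open>r' \<noteq> 1\<close>
  catches a run of length 1 at the very end.\<close>

lemma scan_marked:
  assumes "length ms = length S" "n \<le> Suc d"
  shows "\<exists>r' ba'. foldl (\<lambda>st (v, k). astep d k (map bit v = map bit a) st) (i, n, r, se, ba) (marked S ms) =
      (i, if S = [] then n else min (Suc d) (n + count_list S a), r', se \<or> a \<in> set (sel S ms), ba') \<and>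
    (r' \<noteq> 1 \<and> \<not> ba' \<longleftrightarrow> \<not> ba \<and> rok a r (sel S ms))"
  using assms(1)[symmetric] assms(2)
proof (induction S ms arbitrary: n r se ba rule: list_induct2)
  case Nil
  then show ?case by (auto simp: marked_def)
next
  case (Cons v S m ms)
  have eq: "map bit v = map bit a \<longleftrightarrow> v = a" by (simp add: inj_map_eq_map inj_def)
  define n' where "n' = (if v = a then min (Suc d) (Suc n) else n)"
  define r' where "r' = (if m then if v = a then min 2 (Suc r) else 0 else r)"
  define se' where "se' = (se \<or> m \<and> v = a)"
  define ba' where "ba' = (ba \<or> m \<and> v \<noteq> a \<and> r = 1)"
  have st: "astep d (if m then 5 else 4) (v = a) (i, n, r, se, ba) = (i, n', r', se', ba')"
    by (cases m; cases "v = a") (simp_all add: n'_def r'_def se'_def ba'_def)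
  have n': "n' \<le> Suc d" using Cons.prems by (simp add: n'_def)
  from Cons.IH[where n = n' and r = r' and se = se' and ba = ba', OF this] obtain r2 ba2 where
    f: "foldl (\<lambda>st (v, k). astep d k (map bit v = map bit a) st) (i, n', r', se', ba') (marked S ms) =
      (i, if S = [] then n' else min (Suc d) (n' + count_list S a), r2, se' \<or> a \<in> set (sel S ms), ba2)"
    "r2 \<noteq> 1 \<and> \<not> ba2 \<longleftrightarrow> \<not> ba' \<and> rok a r' (sel S ms)" by blast
  have "foldl (\<lambda>st (v, k). astep d k (map bit v = map bit a) st) (i, n, r, se, ba) (marked (v # S) (m # ms)) =
     foldl (\<lambda>st (v, k). astep d k (map bit v = map bit a) st) (i, n', r', se', ba') (marked S ms)"
    unfolding st[symmetric] by (simp add: marked_def eq del: astep.simps)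
  also have "\<dots> = (i, min (Suc d) (n + count_list (v # S) a), r2, se \<or> a \<in> set (sel (v # S) (m # ms)), ba2)"
  proof -
    have "(if S = [] then n' else min (Suc d) (n' + count_list S a)) = min (Suc d) (n + count_list (v # S) a)"
      using n' Cons.prems by (cases "v = a"; cases "S = []") (simp_all add: n'_def min_def)
    moreover have "(se' \<or> a \<in> set (sel S ms)) = (se \<or> a \<in> set (sel (v # S) (m # ms)))"
      by (cases m; cases "v = a") (simp_all add: se'_def)
    ultimately show ?thesis unfolding f(1) by (simp only:)
  qed
  finally have 1: "foldl (\<lambda>st (v, k). astep d k (map bit v = map bit a) st) (i, n, r, se, ba) (marked (v # S) (m # ms)) =
     (i, min (Suc d) (n + count_list (v # S) a), r2, se \<or> a \<in> set (sel (v # S) (m # ms)), ba2)" .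
  have "\<not> ba' \<and> rok a r' (sel S ms) \<longleftrightarrow> \<not> ba \<and> rok a r (sel (v # S) (m # ms))"
    by (cases m; cases "v = a"; cases "r = 1") (simp_all add: ba'_def r'_def)
  with f(2) have 2: "r2 \<noteq> 1 \<and> \<not> ba2 \<longleftrightarrow> \<not> ba \<and> rok a r (sel (v # S) (m # ms))" by blast
  show ?case by (rule exI[of _ r2], rule exI[of _ ba2]) (use 1 2 in \<open>simp only: list.distinct if_False simp_thms\<close>)
qed

lemma scan_mitems:
  assumes "length ms = length S"
  shows "acc d (scan d (mitems A S ms) (map bit a)) \<longleftrightarrow>
      a \<in> set A \<and> count_list S a \<le> d \<and> a \<in> set (sel S ms) \<and> rok a 0 (sel S ms)"
    and "occ (scan d (mitems A S ms) (map bit a)) = d \<longleftrightarrow> count_list S a = d"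
proof -
  have eq: "map bit v = map bit a \<longleftrightarrow> v = a" for v by (simp add: inj_map_eq_map inj_def)
  have A: "foldl (\<lambda>st (v, k). astep d k (map bit v = map bit a) st) (i, 0, 0, False, False) (map (\<lambda>w. (w, 3)) A) =
      (i \<or> a \<in> set A, 0, 0, False, False)" for i
    by (induction A arbitrary: i) (auto simp: eq)
  from scan_marked[OF assms, where n = 0 and d = d and a = a and i = "a \<in> set A" and r = 0 and se = False and ba = False]
  obtain r' ba' where
    f: "foldl (\<lambda>st (v, k). astep d k (map bit v = map bit a) st) (a \<in> set A, 0, 0, False, False) (marked S ms) =
      (a \<in> set A, if S = [] then 0 else min (Suc d) (0 + count_list S a), r', False \<or> a \<in> set (sel S ms), ba')" and
    s2: "r' \<noteq> 1 \<and> \<not> ba' \<longleftrightarrow> \<not> False \<and> rok a 0 (sel S ms)"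
    by blast
  have s1: "scan d (mitems A S ms) (map bit a) =
      (a \<in> set A, if S = [] then 0 else min (Suc d) (count_list S a), r', a \<in> set (sel S ms), ba')"
    unfolding scan_def ainit_def foldl_append A using f by simp
  show "acc d (scan d (mitems A S ms) (map bit a)) \<longleftrightarrow>
      a \<in> set A \<and> count_list S a \<le> d \<and> a \<in> set (sel S ms) \<and> rok a 0 (sel S ms)"
    unfolding s1 using s2 by (auto simp: min_def)
  show "occ (scan d (mitems A S ms) (map bit a)) = d \<longleftrightarrow> count_list S a = d"
    unfolding s1 by (auto simp: min_def)
qed

lemma rok_reset: "T = [] \<or> hd T \<noteq> a \<Longrightarrow> rok a r T \<longleftrightarrow> r \<noteq> 1 \<and> rok a 0 T"
  by (cases T) auto

lemma rok_replicate_same: "r \<le> 2 \<Longrightarrow> rok a r (replicate e a @ T) = rok a (min 2 (r + e)) T"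
  by (induction e arbitrary: r) (auto simp: min_def)

lemma rok_replicate_other: "x \<noteq> a \<Longrightarrow> rok a 0 (replicate e x @ T) = rok a 0 T"
  by (induction e) simp_all

text \<open>As neighbouring blocks have different letters, the LD-blocks are the maximal runs of
  \<open>T\<close>, and their lengths can be checked for each letter separately. In the converse
  direction the first maximal run is split off and the rest is shorter.\<close>

lemma letter_duplicated_rok:
  "letter_duplicated \<Sigma> T \<longleftrightarrow> set T \<subseteq> \<Sigma> \<and> (\<forall>a\<in>set T. rok a 0 T)"
proof
  assume "letter_duplicated \<Sigma> T"
  then obtain bs where T: "T = concat (map (\<lambda>(x, e). replicate e x) bs)"
    and bs: "\<forall>(x, e)\<in>set bs. x \<in> \<Sigma> \<and> 2 \<le> e" "successively (\<noteq>) (map fst bs)"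
    unfolding letter_duplicated_def by blast
  have "rok a 0 T" for a using bs unfolding T
  proof (induction bs)
    case (Cons b bs)
    obtain x e where b: "b = (x, e)" by force
    let ?T = "concat (map (\<lambda>(x, e). replicate e x) bs)"
    have ih: "rok a 0 ?T" using Cons by (cases bs) auto
    have e: "2 \<le> e" using Cons.prems b by auto
    show ?case
    proof (cases "a = x")
      case True
      have "?T = [] \<or> hd ?T \<noteq> x"
      proof (cases bs)
        case (Cons c bs')
        obtain y f where c: "c = (y, f)" by force
        have "2 \<le> f" "x \<noteq> y" using Cons.prems b c Cons by auto
        then show ?thesis by (cases f) (auto simp: Cons c)
      qed simp
      then have "rok x 2 ?T" using rok_reset[of ?T x 2] ih True by simp
      then have "rok x (min 2 (0 + e)) ?T" using e by simp
      then show ?thesis using rok_replicate_same[of 0 x e ?T] by (simp only: b True list.map concat.simps prod.case)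
    next
      case False
      then show ?thesis using ih rok_replicate_other[of x a e ?T] by (simp add: b)
    qed
  qed simp
  moreover have "set T \<subseteq> \<Sigma>" using bs by (auto simp: T)
  ultimately show "set T \<subseteq> \<Sigma> \<and> (\<forall>a\<in>set T. rok a 0 T)" by blast
next
  assume "set T \<subseteq> \<Sigma> \<and> (\<forall>a\<in>set T. rok a 0 T)"
  then have "set T \<subseteq> \<Sigma>" "\<forall>a\<in>set T. rok a 0 T" by auto
  then show "letter_duplicated \<Sigma> T"
  proof (induction "length T" arbitrary: T rule: less_induct)
    case less
    show ?case
    proof (cases T)
      case Nil
      then show ?thesis by (auto simp: letter_duplicated_def intro: exI[of _ "[]"])
    next
      case (Cons x xs)
      define e where "e = length (takeWhile (\<lambda>y. y = x) T)"
      define T' where "T' = dropWhile (\<lambda>y. y = x) T"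
      have "takeWhile (\<lambda>y. y = x) T = replicate e x"
        unfolding e_def by (rule replicate_length_same[symmetric]) (meson set_takeWhileD)
      then have T: "T = replicate e x @ T'" unfolding T'_def by (metis takeWhile_dropWhile_id)
      have e0: "0 < e" using Cons by (simp add: e_def)
      have hd: "T' = [] \<or> hd T' \<noteq> x" unfolding T'_def using hd_dropWhile[of "\<lambda>y. y = x" T] by blast
      \<comment> \<open>The first run brings the counter to \<open>min 2 e\<close>, and
        \<open>T'\<close> is empty or goes on with another letter; so the run is rejected exactly if
        \<open>e = 1\<close>.\<close>
      have "rok x (min 2 e) T'" using less.prems(2) Cons rok_replicate_same[of 0 x e T'] T by simp
      then have m: "min 2 e \<noteq> 1" and rx: "rok x 0 T'" using rok_reset[OF hd, of "min 2 e"] by blast+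
      have e: "2 \<le> e"
      proof (rule ccontr)
        assume "\<not> 2 \<le> e"
        with e0 have "e = 1" by simp
        with m show False by simp
      qed
      have "rok a 0 T'" if "a \<in> set T'" for a
      proof (cases "a = x")
        case False
        have "rok a 0 T" using less.prems(2) that T by simp
        with rok_replicate_other[of x a e T'] False show ?thesis unfolding T by simp
      qed (use rx in simp)
      moreover have "length T' < length T" "set T' \<subseteq> \<Sigma>" using T e0 less.prems(1) by auto
      ultimately have "letter_duplicated \<Sigma> T'" using less.hyps by blast
      then obtain bs where T2: "T' = concat (map (\<lambda>(x, e). replicate e x) bs)"
        and bs: "\<forall>(x, e)\<in>set bs. x \<in> \<Sigma> \<and> 2 \<le> e" "successively (\<noteq>) (map fst bs)"
        unfolding letter_duplicated_def by blast
      have "successively (\<noteq>) (map fst ((x, e) # bs))"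
      proof (cases bs)
        case (Cons b bs')
        obtain y f where b: "b = (y, f)" by force
        have "2 \<le> f" using bs Cons b by auto
        then have "T' \<noteq> [] \<and> hd T' = y" using T2 by (cases f) (auto simp: Cons b)
        with hd have "x \<noteq> y" by auto
        with bs(2) show ?thesis by (simp add: Cons b)
      qed simp
      moreover have "T = concat (map (\<lambda>(x, e). replicate e x) ((x, e) # bs))" using T T2 by simp
      moreover have "\<forall>(x, e)\<in>set ((x, e) # bs). x \<in> \<Sigma> \<and> 2 \<le> e" using bs e Cons less.prems(1) by auto
      ultimately show ?thesis unfolding letter_duplicated_def by blast
    qed
  qed
qed

text \<open>The letters of the sequence are tested along with those of the alphabet, so the
  membership test within \<open>acc\<close> yields \<open>set S \<subseteq> set A\<close>.\<close>

lemma chk_iff: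
  assumes "length ms = length S"
  shows "chk d A S ms sg bs \<longleftrightarrow> set S \<subseteq> set A \<and> max_occurrences (set A) S d \<and>
    is_LDS (set A) S (sel S ms) \<and> (\<forall>a\<in>set A. a \<in> set (sel S ms)) \<and> (sg \<or> val bs \<le> length (sel S ms))"
proof -
  have "map fst (marked S ms) = map fst (zip S ms)" by (simp add: marked_def case_prod_unfold)
  then have "map fst (mitems A S ms) = A @ S" using assms by (simp add: comp_def)
  then have I: "fst ` set (mitems A S ms) = set A \<union> set S" by (metis set_map set_append)
  have sub: "subseq (sel S ms) S" unfolding subseq_sel using assms by (intro exI[of _ ms]) simp
  then have T: "set (sel S ms) \<subseteq> set S" by (rule subseq_set)
  let ?T = "sel S ms"
  have "chk d A S ms sg bs \<longleftrightarrow>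
     (\<forall>v\<in>set A \<union> set S. acc d (scan d (mitems A S ms) (map bit v))) \<and>
     (\<exists>v\<in>set A \<union> set S. occ (scan d (mitems A S ms) (map bit v)) = d) \<and> (sg \<or> val bs \<le> length ?T)"
    unfolding chk_def Let_def I[symmetric] length_sel[OF assms] ball_simps bex_simps case_prod_unfold ..
  also have "\<dots> \<longleftrightarrow> (\<forall>v\<in>set A \<union> set S. v \<in> set A \<and> count_list S v \<le> d \<and> v \<in> set ?T \<and> rok v 0 ?T) \<and>
     (\<exists>v\<in>set A \<union> set S. count_list S v = d) \<and> (sg \<or> val bs \<le> length ?T)"
    unfolding scan_mitems[OF assms] ..
  also have "\<dots> \<longleftrightarrow> set S \<subseteq> set A \<and> (\<forall>v\<in>set A. count_list S v \<le> d \<and> v \<in> set ?T \<and> rok v 0 ?T) \<and>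
     (\<exists>v\<in>set A. count_list S v = d) \<and> (sg \<or> val bs \<le> length ?T)"
    by blast
  also have "\<dots> \<longleftrightarrow> set S \<subseteq> set A \<and> max_occurrences (set A) S d \<and>
    is_LDS (set A) S ?T \<and> (\<forall>a\<in>set A. a \<in> set ?T) \<and> (sg \<or> val bs \<le> length ?T)"
    unfolding max_occurrences_def is_LDS_def letter_duplicated_rok using sub T by blast
  finally show ?thesis .
qed

lemma LLDS_plus_iff: "LLDS_plus \<Sigma> S l \<longleftrightarrow> (\<exists>ms. length ms = length S \<and> is_LDS \<Sigma> S (sel S ms) \<and>
    l \<le> int (length (sel S ms)) \<and> (\<forall>a\<in>\<Sigma>. a \<in> set (sel S ms)))"
  unfolding LLDS_plus_def is_LDS_def subseq_sel by blast

theorem LLDS_plus_NP: "LLDS_plus_lang d \<in> NP"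
proof -
  have "x \<in> LLDS_plus_lang d \<longleftrightarrow> (\<exists>u. length u \<le> poly [:0, 1:] (length x) \<and> result (verifier d) (enc_pair x u) = [True])" for x
  proof -
    have "x \<in> LLDS_plus_lang d \<longleftrightarrow> (\<exists>A S sg bs ms. x = enc_list enc_word A @ enc_list enc_word S @ sg # enc_word bs \<and>
      length ms = length S \<and> canon sg bs \<and> chk d A S ms sg bs)" (is "?L \<longleftrightarrow> ?R")
    proof
      assume ?L
      then obtain A S l ms where 1: "x = enc_instance A S l" "set S \<subseteq> set A" "max_occurrences (set A) S d"
        and 2: "length ms = length S" "is_LDS (set A) S (sel S ms)" "l \<le> int (length (sel S ms))"
          "\<forall>a\<in>set A. a \<in> set (sel S ms)"
        unfolding LLDS_plus_lang_def LLDS_plus_iff by blast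
      have "x = enc_list enc_word A @ enc_list enc_word S @ (l < 0) # enc_word (nat_bits (nat \<bar>l\<bar>))"
        using 1(1) by (simp add: enc_instance_def enc_int_def)
      moreover have "chk d A S ms (l < 0) (nat_bits (nat \<bar>l\<bar>))"
        unfolding chk_iff[OF 2(1)] using 1 2 by (auto simp: val_nat_bits)
      ultimately show ?R using 2(1) enc_int_canon by blast
    next
      assume ?R
      then obtain A S sg bs ms where x: "x = enc_list enc_word A @ enc_list enc_word S @ sg # enc_word bs"
        and m: "length ms = length S" and c: "canon sg bs" "chk d A S ms sg bs" by blast
      from canon_enc_int[OF c(1)] obtain l where l: "sg # enc_word bs = enc_int l" "sg = (l < 0)" "val bs = nat \<bar>l\<bar>" .
      have "x = enc_instance A S l" unfolding x enc_instance_def l(1) by simp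
      moreover have "l \<le> int (length (sel S ms))" using c(2)[unfolded chk_iff[OF m]] l by auto
      ultimately show ?L using c(2)[unfolded chk_iff[OF m]] m
        unfolding LLDS_plus_lang_def LLDS_plus_iff by blast
    qed
    then show ?thesis using verifier_iff[of x d] by simp
  qed
  then show ?thesis unfolding NP_def using polytime_verifier by blast
qed

section \<open>From satisfiability to letter-duplicated subsequences\<close>

definition dbl :: "'a list \<Rightarrow> 'a list" where
  "dbl cs = concat (map (\<lambda>c. [c, c]) cs)"

lemma dbl_simps [simp]: "dbl [] = []" "dbl (c # cs) = c # c # dbl cs" "dbl (xs @ ys) = dbl xs @ dbl ys"
  by (simp_all add: dbl_def)

lemma set_dbl [simp]: "set (dbl cs) = set cs"
  by (induction cs) auto

text \<open>
  The letter \<open>v\<close> of a variable encloses the clauses in which it occurs positively and those in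
  which it occurs negatively. As \<open>v\<close> must be selected in a run, it blocks one of the two groups.
  Without \<open>v\<close> all the literals count as true.
\<close>

type_synonym 'a item = "'a option \<times> 'a list \<times> 'a list"

fun seg :: "'a item \<Rightarrow> 'a list" where
  "seg (None, P, N) = dbl P @ dbl N"
| "seg (Some v, P, N) = v # dbl P @ v # dbl N @ [v]"

fun var :: "'a item \<Rightarrow> 'a list" where
  "var (o', P, N) = (case o' of None \<Rightarrow> [] | Some v \<Rightarrow> [v])"

fun clauses :: "'a item \<Rightarrow> 'a set" where
  "clauses (o', P, N) = set P \<union> set N"

fun holds_in :: "('a \<Rightarrow> bool) \<Rightarrow> 'a item \<Rightarrow> 'a set" where
  "holds_in \<sigma> (None, P, N) = set P \<union> set N"
| "holds_in \<sigma> (Some v, P, N) = (if \<sigma> v then set P else set N)"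

definition satisfies :: "('a \<Rightarrow> bool) \<Rightarrow> 'a item list \<Rightarrow> bool" where
  "satisfies \<sigma> its \<longleftrightarrow> (\<Union>i\<in>set its. clauses i) \<subseteq> (\<Union>i\<in>set its. holds_in \<sigma> i)"

text \<open>All runs of a doubled list have even length, whether or not equal letters meet.\<close>

lemma letter_duplicated_dbl: "set cs \<subseteq> \<Sigma> \<Longrightarrow> letter_duplicated \<Sigma> (dbl cs)"
proof (induction cs)
  case Nil
  then show ?case by (simp add: letter_duplicated_rok)
next
  case (Cons c cs)
  then have "rok a 0 (dbl cs)" if "a \<in> set cs" for a using that by (simp add: letter_duplicated_rok)
  then have r: "rok a 0 (dbl cs)" for a
  proof (cases "a \<in> set cs")
    case False
    then show ?thesis by (induction cs) auto
  qed
  have "rok a 2 (dbl cs)" for a using r[of a]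
  proof (induction cs)
    case (Cons c cs)
    then show ?case by (auto simp: numeral_2_eq_2 split: if_splits)
  qed simp
  with r Cons.prems show ?case by (simp add: letter_duplicated_rok numeral_2_eq_2)
qed

text \<open>A true variable is selected at the last two of its three places, with the positive group
  in front of them; a false one at the first two, with the negative group behind them.\<close>

fun pick :: "('a \<Rightarrow> bool) \<Rightarrow> 'a item \<Rightarrow> 'a list" where
  "pick \<sigma> (None, P, N) = P @ N"
| "pick \<sigma> (Some v, P, N) = (if \<sigma> v then P @ [v] else v # N)"

lemma subseq_pick: "subseq (dbl (pick \<sigma> i)) (seg i)"
proof (cases "(\<sigma>, i)" rule: pick.cases)
  case (2 \<sigma>' v P N)
  have "subseq (dbl P @ [v, v]) (v # dbl P @ v # dbl N @ [v])"
    using list_emb_append_mono[of "(=)" "dbl P" "v # dbl P" "[v, v]" "v # dbl N @ [v]"]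
    by (simp add: list_emb_Cons subseq_singleton_left)
  moreover have "subseq (v # dbl N) ((v # dbl N) @ [v])"
    using list_emb_append_mono[of "(=)" "v # dbl N" "v # dbl N" "[]" "[v]"] by simp
  then have "subseq ([v] @ v # dbl N) ((v # dbl P) @ (v # dbl N) @ [v])"
    by (rule list_emb_append_mono[rotated]) (simp add: subseq_singleton_left)
  ultimately show ?thesis using 2 by simp
qed simp

lemma set_pick: "set (pick \<sigma> i) = holds_in \<sigma> i \<union> set (var i)"
  by (cases "(\<sigma>, i)" rule: pick.cases) auto

lemma set_seg: "set (seg i) = clauses i \<union> set (var i)"
  by (cases i rule: seg.cases) auto

lemma satisfies_imp_LLDS:
  assumes sat: "satisfies \<sigma> its" and d: "2 \<le> d"
  shows "LLDS_plus (set (concat (map seg its) @ replicate d z)) (concat (map seg its) @ replicate d z) 0"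
proof -
  let ?S = "concat (map seg its) @ replicate d z"
  let ?T = "dbl (concat (map (pick \<sigma>) its) @ [z])"
  have "subseq (dbl (concat (map (pick \<sigma>) its))) (concat (map seg its))"
    by (induction its) (auto intro: list_emb_append_mono subseq_pick)
  moreover have "subseq [z, z] (replicate d z)"
    using d by (auto simp: numeral_2_eq_2 dest!: le_Suc_ex)
  ultimately have sub: "subseq ?T ?S" by (simp add: list_emb_append_mono)
  then have "set ?T \<subseteq> set ?S" by (rule subseq_set)
  then have "letter_duplicated (set ?S) ?T" by (intro letter_duplicated_dbl) simp
  moreover have "set ?S \<subseteq> set ?T"
    using sat d by (auto simp: satisfies_def set_seg set_pick)
  moreover have "0 \<le> int (length ?T)" by simp
  ultimately show ?thesis using sub unfolding LLDS_plus_def is_LDS_def by blast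
qed

section \<open>From a letter-duplicated subsequence back to an assignment\<close>

definition adj :: "'a \<Rightarrow> 'a list \<Rightarrow> bool" where
  "adj v T \<longleftrightarrow> (\<exists>X Y. T = X @ [v, v] @ Y)"

lemma adj_Cons: "adj v (x # T) \<longleftrightarrow> (x = v \<and> T \<noteq> [] \<and> hd T = v) \<or> adj v T"
proof
  assume "adj v (x # T)"
  then obtain X Y where "x # T = X @ [v, v] @ Y" by (auto simp: adj_def)
  then show "(x = v \<and> T \<noteq> [] \<and> hd T = v) \<or> adj v T" by (cases X) (auto simp: adj_def)
next
  assume "(x = v \<and> T \<noteq> [] \<and> hd T = v) \<or> adj v T"
  then show "adj v (x # T)"
  proof
    assume "x = v \<and> T \<noteq> [] \<and> hd T = v"
    then have "x # T = [] @ [v, v] @ tl T" by (cases T) auto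
    then show ?thesis unfolding adj_def by blast
  next
    assume "adj v T"
    then obtain X Y where "T = X @ [v, v] @ Y" by (auto simp: adj_def)
    then have "x # T = (x # X) @ [v, v] @ Y" by simp
    then show ?thesis unfolding adj_def by blast
  qed
qed

lemma adj_append: "adj v (A @ B) \<Longrightarrow> v \<notin> set A \<Longrightarrow> adj v B"
  by (induction A) (auto simp: adj_Cons)

lemma adj_append2: "adj v (A @ B) \<Longrightarrow> v \<notin> set B \<Longrightarrow> adj v A"
proof (induction A)
  case Nil
  then show ?case by (auto simp: adj_def)
next
  case (Cons x A)
  then show ?case by (cases A) (auto simp: adj_Cons)
qed

lemma letter_duplicated_adj:
  assumes "letter_duplicated \<Sigma> T" "v \<in> set T"
  shows "adj v T"
proof -
  have "rok v 0 T" using assms by (simp add: letter_duplicated_rok)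
  moreover have "v \<in> set T \<Longrightarrow> rok v 0 T \<Longrightarrow> adj v T" for T
  proof (induction T)
    case (Cons x T)
    show ?case
    proof (cases "x = v")
      case True
      with Cons.prems have "rok v 1 T" by simp
      then have "T \<noteq> [] \<and> hd T = v" by (cases T) (auto split: if_splits)
      with True show ?thesis by (simp add: adj_Cons)
    next
      case False
      with Cons show ?thesis by (simp add: adj_Cons)
    qed
  qed simp
  ultimately show ?thesis using assms by blast
qed

text \<open>Two adjacent copies of \<open>v\<close> come from two of its three places, and nothing
  between these two can be selected. If both groups were used, the three places would be separated
  from each other.\<close>

lemma blocks_side:
  assumes "subseq T (seg (Some v, P, N))" "adj v T" "v \<notin> set P" "v \<notin> set N"
  shows "set T - {v} \<subseteq> set P \<or> set T - {v} \<subseteq> set N"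
proof -
  have "subseq T ([v] @ dbl P @ [v] @ dbl N @ [v])" using assms by simp
  then obtain a p b n c where T: "T = a @ p @ b @ n @ c" and
    s: "subseq a [v]" "subseq p (dbl P)" "subseq b [v]" "subseq n (dbl N)" "subseq c [v]"
    unfolding subseq_append_iff by blast
  have "set p \<subseteq> set P" "set n \<subseteq> set N" "set a \<subseteq> {v}" "set b \<subseteq> {v}" "set c \<subseteq> {v}"
    using s[THEN subseq_set] by auto
  moreover have "p = [] \<or> n = []"
  proof (rule ccontr)
    assume pn: "\<not> (p = [] \<or> n = [])"
    have x1: "\<not> adj v a'" if "subseq a' [v]" for a'
      using that by (auto simp: adj_def dest: list_emb_length)
    have vp: "v \<notin> set p" "v \<notin> set n" using calculation assms by auto
    \<comment> \<open>A single letter followed by something that does not begin with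
      \<open>v\<close> contributes no adjacent pair, so the pair lies in the rest.\<close>
    have sep: "adj v R" if "adj v (A @ R)" "subseq A [v]" "R \<noteq> []" "hd R \<noteq> v" for A R
    proof (cases A)
      case (Cons x A')
      then have "A' = []" using that(2) by (metis list_emb_length length_Cons list.size(3) length_0_conv le_zero_eq Suc_le_mono One_nat_def)
      with Cons that show ?thesis by (auto simp: adj_Cons)
    qed (use that in simp)
    have hp: "hd (p @ b @ n @ c) \<noteq> v" "hd (n @ c) \<noteq> v" using pn vp
      by (metis hd_append2 hd_in_set)+
    have "adj v (a @ p @ b @ n @ c)" using assms(2) T by simp
    then have "adj v (p @ b @ n @ c)" using sep s(1) pn hp by blast
    then have "adj v (b @ n @ c)" using vp adj_append by metis
    then have "adj v (n @ c)" using sep s(3) pn hp by blast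
    then have "adj v c" using vp adj_append by metis
    with x1[OF s(5)] show False by simp
  qed
  ultimately show ?thesis unfolding T by auto
qed

lemma subseq_concat:
  "subseq T (concat xs) \<Longrightarrow> \<exists>ts. T = concat ts \<and> list_all2 subseq ts xs"
proof (induction xs arbitrary: T)
  case Nil
  then show ?case by (intro exI[of _ "[]"]) simp
next
  case (Cons x xs)
  then obtain T1 T2 where "T = T1 @ T2" "subseq T1 x" "subseq T2 (concat xs)"
    by (auto simp: subseq_append_iff)
  with Cons.IH[of T2] obtain ts where "T2 = concat ts" "list_all2 subseq ts xs" by blast
  with \<open>T = T1 @ T2\<close> \<open>subseq T1 x\<close> show ?case by (intro exI[of _ "T1 # ts"]) simp
qed

lemma distinct_concat_nth:
  assumes "distinct (concat xs)" "i < length xs" "j < length xs" "i \<noteq> j" "v \<in> set (xs ! i)"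
  shows "v \<notin> set (xs ! j)"
  using assms
proof (induction xs arbitrary: i j)
  case (Cons a xs)
  have d: "set a \<inter> set (concat xs) = {}" using Cons.prems(1) by simp
  have c: "set (xs ! k) \<subseteq> set (concat xs)" if "k < length xs" for k using nth_mem[OF that] by auto
  show ?case
  proof (cases i)
    case 0
    then obtain j' where "j = Suc j'" using Cons.prems(4) by (cases j) auto
    with 0 d c[of j'] Cons.prems show ?thesis by auto
  next
    case (Suc i')
    show ?thesis
    proof (cases j)
      case 0
      with Suc d c[of i'] Cons.prems show ?thesis by auto
    next
      case (Suc j')
      with \<open>i = Suc i'\<close> Cons.IH[of i' j'] Cons.prems show ?thesis by simp
    qed
  qed
qed simp

text \<open>The letter of a variable occurs in its own segment only, so its adjacent pair lies there
  and the segment contributes clause letters of one group. As every clause letter must appear, some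
  segment contributes it, and the corresponding literal is true.\<close>

lemma LLDS_imp_satisfies:
  assumes L: "LLDS_plus (set (concat (map seg its) @ replicate d z)) (concat (map seg its) @ replicate d z) l"
    and dist: "distinct (concat (map var its))"
    and disj: "\<And>i j v. i \<in> set its \<Longrightarrow> j \<in> set its \<Longrightarrow> v \<in> set (var i) \<Longrightarrow> v \<notin> clauses j"
    and z: "\<And>i. i \<in> set its \<Longrightarrow> z \<notin> set (var i) \<union> clauses i"
  shows "\<exists>\<sigma>. satisfies \<sigma> its"
proof -
  let ?S = "concat (map seg its) @ replicate d z"
  obtain T where sub: "subseq T ?S" and ld: "letter_duplicated (set ?S) T" and all: "set ?S \<subseteq> set T"
    using L unfolding LLDS_plus_def is_LDS_def by blast
  obtain T0 Tz where T: "T = T0 @ Tz" "subseq T0 (concat (map seg its))" "subseq Tz (replicate d z)"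
    using sub unfolding subseq_append_iff by blast
  obtain ts where ts: "T0 = concat ts" "list_all2 subseq ts (map seg its)"
    using subseq_concat[OF T(2)] by blast
  have len: "length ts = length its" using ts(2) by (simp add: list_all2_lengthD)
  have tsi: "subseq (ts ! i) (seg (its ! i))" if "i < length its" for i
    using list_all2_nthD2[OF ts(2), of i] that by simp
  have Tz: "set Tz \<subseteq> {z}" using subseq_set[OF T(3)] by auto
  have seti: "set (ts ! i) \<subseteq> clauses (its ! i) \<union> set (var (its ! i))" if "i < length its" for i
    using subseq_set[OF tsi[OF that]] by (simp add: set_seg)
  have vdist: "v \<notin> set (var (its ! j))" if "i < length its" "j < length its" "i \<noteq> j" "v \<in> set (var (its ! i))" for i j v
    using distinct_concat_nth[OF dist, of i j v] that by simp
  \<comment> \<open>The value of a variable is read off the group that its segment uses; a segment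
    that uses neither group counts as true.\<close>
  define \<sigma> where "\<sigma> v \<longleftrightarrow> (\<exists>i<length its. v \<in> set (var (its ! i)) \<and> set (ts ! i) - {v} \<subseteq> set (fst (snd (its ! i))))" for v
  have "satisfies \<sigma> its" unfolding satisfies_def
  proof
    fix c assume c: "c \<in> (\<Union>i\<in>set its. clauses i)"
    then have cz: "c \<noteq> z" and cS: "c \<in> set ?S" using z by (auto simp: set_seg)
    have "c \<in> set T" using all cS by blast
    then have "c \<in> set (concat ts)" using T Tz cz ts(1) by auto
    then obtain t where "t \<in> set ts" "c \<in> set t" by auto
    then obtain i where i: "i < length its" "c \<in> set (ts ! i)" by (metis in_set_conv_nth len)
    have ii: "its ! i \<in> set its" using i by simp
    have "c \<in> holds_in \<sigma> (its ! i)"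
    proof (cases "its ! i" rule: seg.cases)
      case (1 P N)
      then show ?thesis using seti[OF i(1)] i(2) by auto
    next
      case (2 v P N)
      have v: "v \<in> set (var (its ! i))" by (simp add: 2)
      have vn: "v \<notin> set P" "v \<notin> set N" using disj[OF ii ii v] by (simp_all add: 2)
      have "v \<in> set T" using all v ii by (auto simp: set_seg)
      with letter_duplicated_adj[OF ld] have "adj v T" by blast
      moreover have "v \<notin> set Tz" using Tz z[OF ii] v by auto
      ultimately have "adj v (concat ts)" using adj_append2 T(1) ts(1) by metis
      moreover have "concat ts = concat (take i ts) @ ts ! i @ concat (drop (Suc i) ts)"
        using arg_cong[OF id_take_nth_drop[of i ts], of concat] i(1) len by simp
      moreover have o: "v \<notin> set (ts ! j)" if "j < length its" "j \<noteq> i" for j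
        using seti[OF that(1)] disj[OF ii _ v, of "its ! j"] vdist[OF i(1) that(1)] that v by auto
      have "v \<notin> set t" if "t \<in> set (take i ts) \<union> set (drop (Suc i) ts)" for t
      proof -
        from that obtain j where "j < length its" "j \<noteq> i" "t = ts ! j"
        proof
          assume "t \<in> set (take i ts)"
          then obtain j where "j < length (take i ts)" "take i ts ! j = t" unfolding in_set_conv_nth by blast
          then show thesis using that[of j] i(1) len by simp
        next
          assume "t \<in> set (drop (Suc i) ts)"
          then obtain j where "j < length (drop (Suc i) ts)" "drop (Suc i) ts ! j = t" unfolding in_set_conv_nth by blast
          then show thesis using that[of "Suc i + j"] i(1) len by simp
        qed
        with o show ?thesis by blast
      qed
      then have "v \<notin> set (concat (take i ts))" "v \<notin> set (concat (drop (Suc i) ts))" by auto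
      ultimately have "adj v (ts ! i)" using adj_append adj_append2 by metis
      from blocks_side[OF tsi[OF i(1), unfolded 2] this vn]
      have side: "set (ts ! i) - {v} \<subseteq> set P \<or> set (ts ! i) - {v} \<subseteq> set N" .
      have "c \<noteq> v" using disj[OF ii _ v] c by auto
      have "\<sigma> v \<longleftrightarrow> set (ts ! i) - {v} \<subseteq> set P"
      proof
        assume "\<sigma> v"
        then obtain j where j: "j < length its" "v \<in> set (var (its ! j))"
          "set (ts ! j) - {v} \<subseteq> set (fst (snd (its ! j)))" unfolding \<sigma>_def by blast
        have "j = i" using vdist[OF i(1) j(1) _ v] j(2) by blast
        with j(3) show "set (ts ! i) - {v} \<subseteq> set P" by (simp add: 2)
      next
        assume "set (ts ! i) - {v} \<subseteq> set P"
        then show "\<sigma> v" unfolding \<sigma>_def using i(1) v by (intro exI[of _ i]) (simp add: 2)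
      qed
      with side i(2) \<open>c \<noteq> v\<close> show ?thesis by (auto simp: 2)
    qed
    with ii show "c \<in> (\<Union>i\<in>set its. holds_in \<sigma> i)" by blast
  qed
  then show ?thesis by blast
qed

section \<open>Computations as constraint systems\<close>

text \<open>
  Tape contents are described relative to the head position. An additional tape marks the
  origin of the output tape and moves along with it.
\<close>

definition nxt :: "tm \<Rightarrow> nat \<Rightarrow> nat list \<Rightarrow> nat" where
  "nxt M q v = (if q < states M then fst (delta M q (take (tapes M) v)) else q)"

text \<open>The additional tape moves as tape 1 does. A halted machine rewrites what it reads and
  stays, so that a late row shows the final output however early the machine halts.\<close>

definition act :: "tm \<Rightarrow> nat \<Rightarrow> nat list \<Rightarrow> nat \<Rightarrow> nat \<times> move" where
  "act M q v j =
     (if q < states M then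
        if j < tapes M then snd (delta M q (take (tapes M) v)) ! j
        else (v ! j, snd (snd (delta M q (take (tapes M) v)) ! 1))
      else (v ! j, Stay))"

definition cell :: "tm \<Rightarrow> config \<Rightarrow> nat \<Rightarrow> int \<Rightarrow> nat" where
  "cell M c j i =
     (if j < tapes M then fst (snd c ! j) (snd (snd c ! j) + i) else if snd (snd c ! 1) + i = 0 then 1 else 0)"

definition vec :: "tm \<Rightarrow> config \<Rightarrow> nat list" where
  "vec M c = map (\<lambda>j. cell M c j 0) [0..<Suc (tapes M)]"

definition wf_config :: "tm \<Rightarrow> config \<Rightarrow> bool" where
  "wf_config M c \<longleftrightarrow> fst c \<le> states M \<and> length (snd c) = tapes M \<and> (\<forall>j<tapes M. \<forall>i. fst (snd c ! j) i < symbols M)"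

section \<open>One step in coordinates relative to the heads\<close>

lemma tape_read_eq: "tape_read T = fst T (snd T)"
  by (cases T) simp

lemma take_vec: "wf_config M c \<Longrightarrow> take (tapes M) (vec M c) = map tape_read (snd c)"
  by (rule nth_equalityI)
    (simp_all add: vec_def cell_def wf_config_def tape_read_eq del: upt_Suc)

lemma step_unfold:
  "q < states M \<Longrightarrow> Defs.step M (q, ts) =
     (fst (delta M q (map tape_read ts)), map2 tape_act (snd (delta M q (map tape_read ts))) ts)"
  by (simp add: case_prod_unfold)

lemma tape_act_fst: "fst (tape_act a T) = (fst T)(snd T := fst a)" "snd (tape_act a T) = snd T + offset (snd a)"
  by (cases a; cases T; simp)+

lemma map_tape_read_syms: "wf_config M c \<Longrightarrow> set (map tape_read (snd c)) \<subseteq> {..<symbols M}"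
proof
  fix a assume c: "wf_config M c" and "a \<in> set (map tape_read (snd c))"
  then obtain T where T: "T \<in> set (snd c)" "a = tape_read T" by auto
  then obtain j where "j < length (snd c)" "snd c ! j = T" by (metis in_set_conv_nth)
  with c T(2) show "a \<in> {..<symbols M}" by (auto simp: wf_config_def tape_read_eq)
qed

lemma wf_tm_delta:
  assumes "wf_tm M" "q < states M" "length v = tapes M" "set v \<subseteq> {..<symbols M}"
  shows "fst (delta M q v) \<le> states M" "length (snd (delta M q v)) = tapes M"
    "fst ` set (snd (delta M q v)) \<subseteq> {..<symbols M}"
proof -
  obtain q' as where d: "delta M q v = (q', as)" by force
  have "\<forall>q < states M. \<forall>v. length v = tapes M \<and> set v \<subseteq> {..<symbols M} \<longrightarrow>
        (case delta M q v of (q', as) \<Rightarrow>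
           q' \<le> states M \<and> length as = tapes M \<and> fst ` set as \<subseteq> {..<symbols M})"
    using assms(1) unfolding wf_tm_def by (elim conjE)
  from this[rule_format, OF assms(2) conjI[OF assms(3,4)]]
  have "q' \<le> states M \<and> length as = tapes M \<and> fst ` set as \<subseteq> {..<symbols M}" by (simp only: d prod.case)
  then show "fst (delta M q v) \<le> states M" "length (snd (delta M q v)) = tapes M"
    "fst ` set (snd (delta M q v)) \<subseteq> {..<symbols M}" unfolding d by simp_all
qed

lemma delta_wf:
  assumes "wf_tm M" "wf_config M c" "fst c < states M"
  shows "fst (delta M (fst c) (map tape_read (snd c))) \<le> states M"
    "length (snd (delta M (fst c) (map tape_read (snd c)))) = tapes M"
    "fst ` set (snd (delta M (fst c) (map tape_read (snd c)))) \<subseteq> {..<symbols M}"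
proof -
  have "length (map tape_read (snd c)) = tapes M" using assms by (simp add: wf_config_def)
  from wf_tm_delta[OF assms(1,3) this map_tape_read_syms[OF assms(2)]]
  show "fst (delta M (fst c) (map tape_read (snd c))) \<le> states M"
    "length (snd (delta M (fst c) (map tape_read (snd c)))) = tapes M"
    "fst ` set (snd (delta M (fst c) (map tape_read (snd c)))) \<subseteq> {..<symbols M}" .
qed

lemma step_halt: "\<not> fst c < states M \<Longrightarrow> Defs.step M c = c"
  by (cases c) simp

lemma step_nth:
  assumes "wf_tm M" "wf_config M c" "fst c < states M" "j < tapes M"
  shows "snd (Defs.step M c) ! j = tape_act (snd (delta M (fst c) (map tape_read (snd c))) ! j) (snd c ! j)"
  using assms delta_wf[OF assms(1-3)]
  by (cases c) (auto simp: step_unfold wf_config_def simp del: step.simps)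

lemma wf_step:
  assumes "wf_tm M" "wf_config M c"
  shows "wf_config M (Defs.step M c)"
proof (cases "fst c < states M")
  case True
  note d = delta_wf[OF assms True]
  have l: "length (snd (Defs.step M c)) = tapes M" "fst (Defs.step M c) \<le> states M"
    using d True assms(2) by (cases c; auto simp: step_unfold wf_config_def simp del: step.simps)+
  have "fst (snd (Defs.step M c) ! j) i < symbols M" if "j < tapes M" for i j
  proof -
    have "snd (delta M (fst c) (map tape_read (snd c))) ! j \<in> set (snd (delta M (fst c) (map tape_read (snd c))))"
      using d(2) that by simp
    then have "fst (snd (delta M (fst c) (map tape_read (snd c))) ! j) < symbols M"
      using d(3) by blast
    then show ?thesis using assms(2) that
      by (simp add: step_nth[OF assms True that] tape_act_fst wf_config_def)
  qed
  with l show ?thesis by (simp add: wf_config_def)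
qed (use assms in \<open>simp add: step_halt\<close>)

lemma step_fst: "wf_config M c \<Longrightarrow> fst (Defs.step M c) = nxt M (fst c) (vec M c)"
  by (cases c) (auto simp: nxt_def step_unfold take_vec simp del: step.simps simp: step_halt)

text \<open>After the move the relative position \<open>i\<close> denotes the cell that was at
  \<open>i + offset m\<close> before, where \<open>m\<close> is the move; the cell just written was
  at 0.\<close>

lemma step_cell:
  assumes M: "wf_tm M" and c: "wf_config M c" and j: "j \<le> tapes M"
  shows "cell M (Defs.step M c) j i =
    (if i + offset (snd (act M (fst c) (vec M c) j)) = 0 then fst (act M (fst c) (vec M c) j)
     else cell M c j (i + offset (snd (act M (fst c) (vec M c) j))))"
proof (cases "fst c < states M")
  case True
  have k: "1 < tapes M" using M by (simp add: wf_tm_def)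
  let ?as = "snd (delta M (fst c) (map tape_read (snd c)))"
  have v: "vec M c ! tapes M = (if snd (snd c ! 1) = 0 then 1 else 0)"
    by (simp add: vec_def cell_def del: upt_Suc)
  show ?thesis
  proof (cases "j < tapes M")
    case j: True
    then have a: "act M (fst c) (vec M c) j = ?as ! j" using True c by (simp add: act_def take_vec)
    show ?thesis using j unfolding a
      by (simp add: cell_def step_nth[OF M c True j] tape_act_fst algebra_simps)
  next
    case False
    with j have jt: "j = tapes M" by simp
    have a: "act M (fst c) (vec M c) (tapes M) = (vec M c ! tapes M, snd (?as ! 1))"
      using True c by (simp add: act_def take_vec)
    have h: "snd (snd (Defs.step M c) ! 1) = snd (snd c ! 1) + offset (snd (?as ! 1))"
      unfolding step_nth[OF M c True k] tape_act_fst ..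
    have c': "cell M d (tapes M) i = (if snd (snd d ! 1) + i = 0 then 1 else 0)" for d i
      by (simp add: cell_def)
    show ?thesis unfolding jt a v fst_conv snd_conv c' h by (simp add: algebra_simps)
  qed
next
  case False
  have "vec M c ! j = cell M c j 0" using j by (simp add: vec_def del: upt_Suc)
  with False show ?thesis by (simp add: step_halt act_def)
qed

lemma length_vec [simp]: "length (vec M c) = Suc (tapes M)"
  by (simp add: vec_def)

lemma nth_vec: "j \<le> tapes M \<Longrightarrow> vec M c ! j = cell M c j 0"
  by (simp add: vec_def del: upt_Suc)

lemma cell_sym: "wf_tm M \<Longrightarrow> wf_config M c \<Longrightarrow> cell M c j i < symbols M"
  by (auto simp: cell_def wf_config_def wf_tm_def)

lemma set_vec: "wf_tm M \<Longrightarrow> wf_config M c \<Longrightarrow> set (vec M c) \<subseteq> {..<symbols M}"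
  by (auto simp: vec_def cell_sym simp del: upt_Suc)

text \<open>\<open>Ctl q v\<close> says, at the column of the heads, that the state is
  \<open>q\<close> and that the first tapes read \<open>v\<close>; it grows by one tape at a time.
  \<open>Sh b q v\<close> broadcasts the complete transition to the right or, if \<open>b\<close> is
  false, to the left, where contents have to be shifted accordingly.\<close>

datatype tag = Cell nat nat | Ctl nat "nat list" | Sh bool nat "nat list"

text \<open>\<open>RScan\<close> reads the heads tape by tape, \<open>RWrite\<close> fills the cell
  that was under a head, and \<open>RMove\<close> carries the other cells to the next row.
  \<open>RGuess\<close> and \<open>RMono\<close> make the certificate a word followed by blanks.
  \<open>RFin1\<close> and \<open>RFin2\<close> forbid wrong symbols in the last row at the marked
  origin of the output and next to it.\<close>

datatype rule =
    RScan nat "nat list" nat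
  | RNext nat "nat list"
  | RWrite nat "nat list" nat
  | RSh bool nat "nat list"
  | RProp bool nat "nat list"
  | RMove bool nat "nat list" nat nat
  | RInit tag
  | RGuess
  | RMono
  | RFin1 nat
  | RFin2 nat

text \<open>
  Codes of rows: 1 outside, 2 first, 3 inner, 4 last. Codes of columns: 1 outside, 2 blank, 3
  and 4 input bit, 5 certificate bit or blank, 6 and 7 input bit at the initial head position.
\<close>

fun initially :: "tm \<Rightarrow> tag \<Rightarrow> nat \<Rightarrow> bool" where
  "initially M (Cell j s) c \<longleftrightarrow>
     (if j = 0 then c = 2 \<and> s = 0 \<or> (c = 3 \<or> c = 6) \<and> s = 1 \<or> (c = 4 \<or> c = 7) \<and> s = 2
      else if j < tapes M then s = 0 else s = (if c = 6 \<or> c = 7 then 1 else 0))"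
| "initially M (Ctl q v) c \<longleftrightarrow> q = 0 \<and> v = [] \<and> (c = 6 \<or> c = 7)"
| "initially M (Sh b q v) c \<longleftrightarrow> False"

text \<open>
  A literal \<open>(sg, v, a, b, g)\<close> of a clause at row \<open>t\<close> and column \<open>i\<close> refers to row \<open>t + a\<close> and
  column \<open>i + b - 1\<close>; it is present if \<open>g\<close> holds of the codes of this row and this column.
\<close>

type_synonym lit = "bool \<times> tag \<times> nat \<times> nat \<times> (nat \<Rightarrow> nat \<Rightarrow> bool)"

abbreviation always :: "nat \<Rightarrow> nat \<Rightarrow> bool" where
  "always \<equiv> \<lambda>_ _. True"

text \<open>Contents move against the head: what is at column \<open>i\<close> reappears at
  \<open>i - offset m\<close>. The value is shifted by 1 as the column component of a literal
  is.\<close>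

fun pull :: "move \<Rightarrow> nat" where
  "pull MoveLeft = 2"
| "pull Stay = 1"
| "pull MoveRight = 0"

lemma pull_offset: "int (pull m) = 1 - offset m"
  by (cases m) auto

definition away :: "bool \<Rightarrow> nat" where
  "away b = (if b then 2 else 0)"

fun lits :: "tm \<Rightarrow> rule \<Rightarrow> lit list" where
  "lits M (RScan q v s) =
     [(False, Ctl q v, 0, 1, always), (False, Cell (length v) s, 0, 1, always), (True, Ctl q (v @ [s]), 0, 1, always)]"
| "lits M (RNext q v) = [(False, Ctl q v, 0, 1, always), (True, Ctl (nxt M q v) [], 1, 1, always)]"
| "lits M (RWrite q v j) =
     [(False, Ctl q v, 0, 1, always), (True, Cell j (fst (act M q v j)), 1, pull (snd (act M q v j)), always)]"
| "lits M (RSh b q v) = [(False, Ctl q v, 0, 1, always), (True, Sh b q v, 0, away b, always)]"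
| "lits M (RProp b q v) = [(False, Sh b q v, 0, 1, always), (True, Sh b q v, 0, away b, always)]"
| "lits M (RMove b q v j s) =
     [(False, Sh b q v, 0, 1, always), (False, Cell j s, 0, 1, always),
      (True, Cell j s, 1, pull (snd (act M q v j)), always)]"
| "lits M (RInit g) = [(True, g, 0, 1, \<lambda>r c. r = 2 \<and> initially M g c)]"
| "lits M RGuess =
     [(True, Cell 0 0, 0, 1, \<lambda>r c. r = 2 \<and> c = 5), (True, Cell 0 1, 0, 1, \<lambda>r c. r = 2 \<and> c = 5),
      (True, Cell 0 2, 0, 1, \<lambda>r c. r = 2 \<and> c = 5)]"
| "lits M RMono =
     [(False, Cell 0 0, 0, 1, \<lambda>r c. r = 2 \<and> 3 \<le> c), (True, Cell 0 0, 0, 2, \<lambda>r c. r = 2 \<and> (c = 2 \<or> c = 5))]"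
| "lits M (RFin1 s) =
     [(False, Cell (tapes M) 1, 0, 1, \<lambda>r c. r = 4), (False, Cell 1 s, 0, 1, \<lambda>r c. r = 4)]"
| "lits M (RFin2 s) =
     [(False, Cell (tapes M) 1, 0, 1, \<lambda>r c. r = 4), (False, Cell 1 s, 0, 2, \<lambda>r c. r = 4)]"

section \<open>Finiteness of the set of constraints\<close>

definition vecs :: "tm \<Rightarrow> nat list set" where
  "vecs M = {v. set v \<subseteq> {..<symbols M} \<and> length v \<le> Suc (tapes M)}"

definition fullvecs :: "tm \<Rightarrow> nat list set" where
  "fullvecs M = {v. set v \<subseteq> {..<symbols M} \<and> length v = Suc (tapes M)}"

definition tags :: "tm \<Rightarrow> tag set" where
  "tags M = case_prod Cell ` ({..tapes M} \<times> {..<symbols M}) \<union> case_prod Ctl ` ({..states M} \<times> vecs M) \<union>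
     (\<lambda>(b, q, v). Sh b q v) ` (UNIV \<times> {..states M} \<times> fullvecs M)"

definition rules :: "tm \<Rightarrow> rule set" where
  "rules M =
     (\<lambda>(q, v, s). RScan q v s) ` ({..states M} \<times> {v \<in> vecs M. length v \<le> tapes M} \<times> {..<symbols M}) \<union>
     case_prod RNext ` ({..states M} \<times> fullvecs M) \<union>
     (\<lambda>(q, v, j). RWrite q v j) ` ({..states M} \<times> fullvecs M \<times> {..tapes M}) \<union>
     (\<lambda>(b, q, v). RSh b q v) ` (UNIV \<times> {..states M} \<times> fullvecs M) \<union>
     (\<lambda>(b, q, v). RProp b q v) ` (UNIV \<times> {..states M} \<times> fullvecs M) \<union>
     (\<lambda>(b, q, v, j, s). RMove b q v j s) ` (UNIV \<times> {..states M} \<times> fullvecs M \<times> {..tapes M} \<times> {..<symbols M}) \<union>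
     RInit ` tags M \<union> {RGuess, RMono} \<union> RFin1 ` ({..<symbols M} - {2}) \<union> RFin2 ` ({..<symbols M} - {0})"

lemma finite_vecs: "finite (vecs M)" "finite (fullvecs M)"
  unfolding vecs_def fullvecs_def by (rule finite_lists_length_le, simp) (rule finite_lists_length_eq, simp)

lemma finite_tags: "finite (tags M)"
  by (simp add: tags_def finite_vecs)

lemma finite_rules: "finite (rules M)"
  by (simp add: rules_def finite_vecs finite_tags)

lemma nxt_le: "wf_tm M \<Longrightarrow> q \<le> states M \<Longrightarrow> v \<in> fullvecs M \<Longrightarrow> nxt M q v \<le> states M"
  and act_sym: "wf_tm M \<Longrightarrow> q \<le> states M \<Longrightarrow> v \<in> fullvecs M \<Longrightarrow> j \<le> tapes M \<Longrightarrow> fst (act M q v j) < symbols M"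
proof -
  assume M: "wf_tm M" and q: "q \<le> states M" and v: "v \<in> fullvecs M"
  let ?v = "take (tapes M) v"
  have tv: "length ?v = tapes M" "set ?v \<subseteq> {..<symbols M}"
    using v set_take_subset[of "tapes M" v] unfolding fullvecs_def by auto
  note d = wf_tm_delta[OF M _ tv]
  show "nxt M q v \<le> states M" using d(1) q by (simp add: nxt_def)
  assume j: "j \<le> tapes M"
  then have "v ! j \<in> set v" using v by (simp add: fullvecs_def)
  then have vj: "v ! j < symbols M" using v by (auto simp: fullvecs_def)
  have "fst (snd (delta M q ?v) ! j) < symbols M" if "q < states M" "j < tapes M"
  proof -
    have "snd (delta M q ?v) ! j \<in> set (snd (delta M q ?v))" using d(2)[OF that(1)] that(2) by simp
    then show ?thesis using d(3)[OF that(1)] by blast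
  qed
  with vj show "fst (act M q v j) < symbols M" by (simp add: act_def)
qed

lemma lits_ok:
  assumes M: "wf_tm M" and r: "r \<in> rules M" and l: "(sg, v, a, b, g) \<in> set (lits M r)"
  shows "v \<in> tags M \<and> a \<le> 1 \<and> b \<le> 2"
proof -
  have M3: "3 \<le> symbols M" "2 \<le> tapes M" using M by (auto simp: wf_tm_def)
  have fv: "v \<in> vecs M" if "v \<in> fullvecs M" for v using that by (auto simp: vecs_def fullvecs_def)
  have e: "[] \<in> vecs M" by (simp add: vecs_def)
  have C: "Cell j s \<in> tags M \<longleftrightarrow> j \<le> tapes M \<and> s < symbols M" for j s
    by (auto simp: tags_def image_iff)
  have D: "Ctl q v \<in> tags M \<longleftrightarrow> q \<le> states M \<and> v \<in> vecs M" for q v by (auto simp: tags_def image_iff)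
  have E: "Sh b q v \<in> tags M \<longleftrightarrow> q \<le> states M \<and> v \<in> fullvecs M" for b q v by (auto simp: tags_def image_iff)
  have bk2: "pull m \<le> 2" for m by (cases m) auto
  have ap: "v @ [s] \<in> vecs M" if "v \<in> vecs M" "length v \<le> tapes M" "s < symbols M" for v s
    using that by (auto simp: vecs_def)
  show ?thesis
  proof (cases r)
    case (RScan q w s)
    then have "q \<le> states M" "w \<in> vecs M" "length w \<le> tapes M" "s < symbols M" using r by (auto simp: rules_def)
    then show ?thesis using l ap by (auto simp: RScan C D)
  next
    case (RNext q w)
    then have "q \<le> states M" "w \<in> fullvecs M" using r by (auto simp: rules_def)
    then show ?thesis using l nxt_le[OF M] fv e by (auto simp: RNext D)
  next
    case (RWrite q w j)
    then have "q \<le> states M" "w \<in> fullvecs M" "j \<le> tapes M" using r by (auto simp: rules_def)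
    then show ?thesis using l act_sym[OF M] fv bk2 by (auto simp: RWrite C D)
  next
    case (RSh b q w)
    then have "q \<le> states M" "w \<in> fullvecs M" using r by (auto simp: rules_def)
    then show ?thesis using l fv by (auto simp: RSh D E away_def)
  next
    case (RProp b q w)
    then have "q \<le> states M" "w \<in> fullvecs M" using r by (auto simp: rules_def)
    then show ?thesis using l fv by (auto simp: RProp D E away_def)
  next
    case (RMove b q w j s)
    then have "q \<le> states M" "w \<in> fullvecs M" "j \<le> tapes M" "s < symbols M" using r by (auto simp: rules_def)
    then show ?thesis using l bk2 by (auto simp: RMove C E)
  next
    case (RInit g)
    then have "g \<in> tags M" using r by (auto simp: rules_def)
    then show ?thesis using l by (auto simp: RInit)
  next
    case RGuess
    then show ?thesis using l M3 by (auto simp: C)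
  next
    case RMono
    then show ?thesis using l M3 by (auto simp: C)
  next
    case (RFin1 s)
    then have "s < symbols M" using r by (auto simp: rules_def)
    then show ?thesis using l M3 by (auto simp: C RFin1)
  next
    case (RFin2 s)
    then have "s < symbols M" using r by (auto simp: rules_def)
    then show ?thesis using l M3 by (auto simp: C RFin2)
  qed
qed

lemma length_lits: "length (lits M r) \<le> 3"
  by (cases r) auto

text \<open>\<open>q\<close> bounds the length of the certificate, \<open>T\<close> is the last row
  and \<open>B\<close> the width of the blank margin. By row \<open>T\<close> the region of known
  contents has shrunk to radius \<open>B - T\<close>. It must still contain the first two output
  cells, whose distance from the head is at most \<open>T + 1\<close>.\<close>

locale tableau =
  fixes M :: tm and x :: "bool list" and q B T :: nat
  assumes M: "wf_tm M" and B: "2 * T + 1 \<le> B"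
begin

abbreviation "m \<equiv> length (enc_word x)"

definition rcode :: "int \<Rightarrow> nat" where
  "rcode t = (if t < 0 \<or> int T < t then 1 else if t = 0 then 2 else if t = int T then 4 else 3)"

definition ccode :: "int \<Rightarrow> nat" where
  "ccode i =
     (if i < - int B \<or> int (m + q + B) \<le> i then 1 else if i < 0 \<or> int (m + q) \<le> i then 2
      else if int m \<le> i then 5 else if i = 0 then if enc_word x ! 0 then 7 else 6
      else if enc_word x ! nat i then 4 else 3)"

text \<open>Two literals of a clause are at most one row and two columns apart. If one of them lies
  in the interior, they all lie in this range.\<close>

definition inrange :: "int \<Rightarrow> int \<Rightarrow> bool" where
  "inrange t i \<longleftrightarrow> -1 \<le> t \<and> t \<le> int T + 1 \<and> - int B - 2 \<le> i \<and> i < int (m + q + B) + 2"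

definition inner :: "int \<Rightarrow> int \<Rightarrow> bool" where
  "inner t i \<longleftrightarrow> 0 \<le> t \<and> t \<le> int T \<and> - int B \<le> i \<and> i < int (m + q + B)"

lemma inner_code: "rcode t = 1 \<or> ccode i = 1 \<longleftrightarrow> \<not> inner t i"
  by (auto simp: rcode_def ccode_def inner_def)

lemma inner_inrange: "inner t i \<Longrightarrow> inrange t i"
  by (auto simp: inner_def inrange_def)

definition lit_at :: "rule \<Rightarrow> int \<Rightarrow> int \<Rightarrow> lit \<Rightarrow> bool" where
  "lit_at r t i = (\<lambda>(sg, v, a, b, g). (sg, v, a, b, g) \<in> set (lits M r) \<and>
     inrange (t + int a) (i + (int b - 1)) \<and> g (rcode (t + int a)) (ccode (i + (int b - 1))))"

definition lit_true :: "(tag \<Rightarrow> int \<Rightarrow> int \<Rightarrow> bool) \<Rightarrow> int \<Rightarrow> int \<Rightarrow> lit \<Rightarrow> bool" where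
  "lit_true s t i = (\<lambda>(sg, v, a, b, g).
     inner (t + int a) (i + (int b - 1)) \<longrightarrow> s v (t + int a) (i + (int b - 1)) = sg)"

definition consistent :: "(tag \<Rightarrow> int \<Rightarrow> int \<Rightarrow> bool) \<Rightarrow> bool" where
  "consistent s \<longleftrightarrow> (\<forall>r\<in>rules M. \<forall>t i. (\<exists>l. lit_at r t i l) \<longrightarrow> (\<exists>l. lit_at r t i l \<and> lit_true s t i l))"

text \<open>A present literal outside the interior makes its clause true for nothing. Clauses that
  lie entirely in the interior are the ones from which something can be derived.\<close>

lemma consistentD:
  assumes "consistent s" "r \<in> rules M"
    and i: "list_all (\<lambda>(sg, v, a, b, g). inner (t + int a) (i + (int b - 1))) (lits M r)"
    and g: "list_ex (\<lambda>(sg, v, a, b, g). g (rcode (t + int a)) (ccode (i + (int b - 1)))) (lits M r)"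
  shows "list_ex (\<lambda>(sg, v, a, b, g). g (rcode (t + int a)) (ccode (i + (int b - 1))) \<and>
    s v (t + int a) (i + (int b - 1)) = sg) (lits M r)"
proof -
  have i': "inner (t + int a) (i + (int b - 1))" if "(sg, v, a, b, g) \<in> set (lits M r)" for sg v a b g
    using i that unfolding list_all_iff by blast
  obtain sg v a b g where l: "(sg, v, a, b, g) \<in> set (lits M r)" "g (rcode (t + int a)) (ccode (i + (int b - 1)))"
    using g unfolding list_ex_iff by blast
  have "lit_at r t i (sg, v, a, b, g)"
    using i'[OF l(1)] l inner_inrange by (simp add: lit_at_def)
  then obtain l where l: "lit_at r t i l" "lit_true s t i l" using assms(1,2) unfolding consistent_def by blast
  obtain sg' v' a' b' g' where ll: "l = (sg', v', a', b', g')" by (metis prod_cases5)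
  with l have 1: "(sg', v', a', b', g') \<in> set (lits M r)" "g' (rcode (t + int a')) (ccode (i + (int b' - 1)))"
    by (auto simp: lit_at_def)
  with i'[OF 1(1)] l(2) ll have "s v' (t + int a') (i + (int b' - 1)) = sg'" by (simp add: lit_true_def)
  with 1 show ?thesis unfolding list_ex_iff by blast
qed

section \<open>The computation to be described\<close>

definition conf :: "bool list \<Rightarrow> nat \<Rightarrow> config" where
  "conf y t = (Defs.step M ^^ t) (init_config M y)"

lemma conf_Suc: "conf y (Suc t) = Defs.step M (conf y t)"
  by (simp add: conf_def del: step.simps)

lemma k2: "2 \<le> tapes M" "3 \<le> symbols M"
  using M by (auto simp: wf_tm_def)

lemma wf_conf: "wf_config M (conf y t)"
proof (induction t)
  case 0
  have "word_content w i < 3" for w i by (simp add: word_content_def)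
  then have "word_content w i < symbols M" for w i using k2 less_le_trans by blast
  then show ?case by (simp add: conf_def init_config_def wf_config_def del: upt_Suc)
qed (simp add: conf_Suc wf_step[OF M] del: step.simps)

definition state :: "bool list \<Rightarrow> nat \<Rightarrow> nat" where
  "state y t = fst (conf y t)"

definition reads :: "bool list \<Rightarrow> nat \<Rightarrow> nat list" where
  "reads y t = vec M (conf y t)"

definition content :: "bool list \<Rightarrow> nat \<Rightarrow> nat \<Rightarrow> int \<Rightarrow> nat" where
  "content y t j i = cell M (conf y t) j i"

lemma state_le: "state y t \<le> states M"
  using wf_conf[of y t] by (simp add: state_def wf_config_def)

lemma reads_full: "reads y t \<in> fullvecs M"
  using set_vec[OF M wf_conf] by (simp add: reads_def fullvecs_def)

lemma reads_nth: "j \<le> tapes M \<Longrightarrow> reads y t ! j = content y t j 0"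
  by (simp add: reads_def content_def nth_vec)

lemma content_sym: "content y t j i < symbols M"
  unfolding content_def by (rule cell_sym[OF M wf_conf])

lemma state_Suc: "state y (Suc t) = nxt M (state y t) (reads y t)"
  by (simp add: state_def conf_Suc step_fst[OF wf_conf] reads_def del: step.simps)

lemma content_Suc:
  "j \<le> tapes M \<Longrightarrow> content y (Suc t) j i =
    (if i + offset (snd (act M (state y t) (reads y t) j)) = 0 then fst (act M (state y t) (reads y t) j)
     else content y t j (i + offset (snd (act M (state y t) (reads y t) j))))"
  unfolding content_def conf_Suc state_def reads_def by (rule step_cell[OF M wf_conf])

lemma content_0:
  "content y 0 j i = (if j = 0 then word_content y i else if j < tapes M then 0 else if i = 0 then 1 else 0)"
  "state y 0 = 0"
  using k2 by (auto simp: content_def state_def conf_def cell_def init_config_def word_content_def simp del: upt_Suc)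

text \<open>The origin of the output tape is at the relative position
  \<open>- hpos y t\<close>.\<close>

definition hpos :: "bool list \<Rightarrow> nat \<Rightarrow> int" where
  "hpos y t = snd (snd (conf y t) ! 1)"

lemma hpos: "\<bar>hpos y t\<bar> \<le> int t"
proof (induction t)
  case 0
  then show ?case using k2 by (simp add: hpos_def conf_def init_config_def del: upt_Suc)
next
  case (Suc t)
  have "\<bar>hpos y (Suc t) - hpos y t\<bar> \<le> 1"
  proof (cases "fst (conf y t) < states M")
    case True
    have o: "\<bar>offset d\<bar> \<le> 1" for d by (cases d) auto
    have "1 < tapes M" using k2 by simp
    from step_nth[OF M wf_conf True this] show ?thesis
      unfolding hpos_def conf_Suc using o by (simp add: tape_act_fst del: step.simps)
  next
    case False
    then show ?thesis by (simp add: hpos_def conf_Suc step_halt del: step.simps)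
  qed
  with Suc show ?case by linarith
qed

lemma content_out: "content y t 1 i = fst (snd (conf y t) ! 1) (hpos y t + i)"
  "content y t (tapes M) i = (if hpos y t + i = 0 then 1 else 0)"
  using k2 by (auto simp: content_def cell_def hpos_def)

lemma rule_mem:
  "RScan q' v s \<in> rules M \<longleftrightarrow> q' \<le> states M \<and> v \<in> vecs M \<and> length v \<le> tapes M \<and> s < symbols M"
  "RNext q' v \<in> rules M \<longleftrightarrow> q' \<le> states M \<and> v \<in> fullvecs M"
  "RWrite q' v j \<in> rules M \<longleftrightarrow> q' \<le> states M \<and> v \<in> fullvecs M \<and> j \<le> tapes M"
  "RSh b q' v \<in> rules M \<longleftrightarrow> q' \<le> states M \<and> v \<in> fullvecs M"
  "RProp b q' v \<in> rules M \<longleftrightarrow> q' \<le> states M \<and> v \<in> fullvecs M"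
  "RMove b q' v j s \<in> rules M \<longleftrightarrow> q' \<le> states M \<and> v \<in> fullvecs M \<and> j \<le> tapes M \<and> s < symbols M"
  "RInit g \<in> rules M \<longleftrightarrow> g \<in> tags M"
  "RGuess \<in> rules M" "RMono \<in> rules M"
  "RFin1 s \<in> rules M \<longleftrightarrow> s < symbols M \<and> s \<noteq> 2"
  "RFin2 s \<in> rules M \<longleftrightarrow> s < symbols M \<and> s \<noteq> 0"
  by (auto simp: rules_def image_iff)

lemma tag_mem:
  "Cell j s \<in> tags M \<longleftrightarrow> j \<le> tapes M \<and> s < symbols M"
  "Ctl q' v \<in> tags M \<longleftrightarrow> q' \<le> states M \<and> v \<in> vecs M"
  by (auto simp: tags_def image_iff)

section \<open>Soundness of the constraint system\<close>

context
  fixes s assumes con: "consistent s"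
begin

lemma scanD:
  assumes "q' \<le> states M" "v \<in> vecs M" "length v \<le> tapes M" "a < symbols M" "inner t i"
    "s (Ctl q' v) t i" "s (Cell (length v) a) t i"
  shows "s (Ctl q' (v @ [a])) t i"
  using consistentD[OF con, of "RScan q' v a" t i] assms
  by (auto simp: rule_mem)

lemma nextD:
  assumes "q' \<le> states M" "v \<in> fullvecs M" "inner t i" "inner (t + 1) i" "s (Ctl q' v) t i"
  shows "s (Ctl (nxt M q' v) []) (t + 1) i"
  using consistentD[OF con, of "RNext q' v" t i] assms
  by (auto simp: rule_mem)

lemma writeD:
  assumes "q' \<le> states M" "v \<in> fullvecs M" "j \<le> tapes M" "inner t i" "inner (t + 1) (i - offset (snd (act M q' v j)))"
    "s (Ctl q' v) t i"
  shows "s (Cell j (fst (act M q' v j))) (t + 1) (i - offset (snd (act M q' v j)))"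
  using consistentD[OF con, of "RWrite q' v j" t i] assms
  by (auto simp: rule_mem pull_offset)

lemma shD:
  assumes "q' \<le> states M" "v \<in> fullvecs M" "inner t i" "inner t (i + (if b then 1 else -1))" "s (Ctl q' v) t i"
  shows "s (Sh b q' v) t (i + (if b then 1 else -1))"
  using consistentD[OF con, of "RSh b q' v" t i] assms
  by (cases b) (auto simp: rule_mem away_def)

lemma propD:
  assumes "q' \<le> states M" "v \<in> fullvecs M" "inner t i" "inner t (i + (if b then 1 else -1))" "s (Sh b q' v) t i"
  shows "s (Sh b q' v) t (i + (if b then 1 else -1))"
  using consistentD[OF con, of "RProp b q' v" t i] assms
  by (cases b) (auto simp: rule_mem away_def)

lemma moveD:
  assumes "q' \<le> states M" "v \<in> fullvecs M" "j \<le> tapes M" "a < symbols M"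
    "inner t i" "inner (t + 1) (i - offset (snd (act M q' v j)))"
    "s (Sh b q' v) t i" "s (Cell j a) t i"
  shows "s (Cell j a) (t + 1) (i - offset (snd (act M q' v j)))"
  using consistentD[OF con, of "RMove b q' v j a" t i] assms
  by (auto simp: rule_mem pull_offset)

lemma initD:
  assumes "g \<in> tags M" "inner 0 i" "initially M g (ccode i)"
  shows "s g 0 i"
  using consistentD[OF con, of "RInit g" 0 i] assms
  by (auto simp: rule_mem rcode_def)

lemma guessD:
  assumes "inner 0 i" "ccode i = 5"
  shows "s (Cell 0 0) 0 i \<or> s (Cell 0 1) 0 i \<or> s (Cell 0 2) 0 i"
  using consistentD[OF con, of RGuess 0 i] assms
  by (auto simp: rule_mem rcode_def)

lemma monoD:
  assumes "inner 0 i" "inner 0 (i + 1)" "ccode i = 5" "ccode (i + 1) = 5" "s (Cell 0 0) 0 i"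
  shows "s (Cell 0 0) 0 (i + 1)"
  using consistentD[OF con, of RMono 0 i] assms
  by (auto simp: rule_mem rcode_def)

lemma fin1D:
  assumes "0 < T" "inner (int T) i" "s (Cell (tapes M) 1) (int T) i" "s (Cell 1 a) (int T) i" "a < symbols M"
  shows "a = 2"
proof (rule ccontr)
  assume "a \<noteq> 2"
  with consistentD[OF con, of "RFin1 a" "int T" i] assms show False
    by (auto simp: rule_mem rcode_def)
qed

lemma fin2D:
  assumes "0 < T" "inner (int T) i" "inner (int T) (i + 1)" "s (Cell (tapes M) 1) (int T) i"
    "s (Cell 1 a) (int T) (i + 1)" "a < symbols M"
  shows "a = 0"
proof (rule ccontr)
  assume "a \<noteq> 0"
  with consistentD[OF con, of "RFin2 a" "int T" i] assms show False
    by (auto simp: rule_mem rcode_def)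
qed

lemma m0: "0 < m"
  by (cases x) auto

text \<open>An assignment may put several symbols into one certificate cell. Before the first blank
  a cell is read as 2 if it carries a 2 and otherwise carries a 1 by \<open>RGuess\<close>; from the
  first blank on, \<open>RMono\<close> makes all cells blank.\<close>

lemma guessed:
  "\<exists>u. length u \<le> q \<and> (\<forall>i. inner 0 i \<longrightarrow> s (Cell 0 (word_content (enc_word x @ u) i)) 0 i)"
proof -
  define bl where "bl g \<longleftrightarrow> s (Cell 0 0) 0 (int m + int g)" for g
  \<comment> \<open>The length of the certificate: the number of cells before the first blank, or
    \<open>q\<close> if there is none.\<close>
  define n where "n = (LEAST g. g = q \<or> bl g)"
  have n: "n \<le> q" "n = q \<or> bl n" unfolding n_def by (rule Least_le, simp) (rule LeastI[of "\<lambda>g. g = q \<or> bl g" q], simp)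
  have nl: "\<not> bl g" if "g < n" for g using not_less_Least[of g "\<lambda>g. g = q \<or> bl g"] that unfolding n_def by blast
  define u where "u = map (\<lambda>g. s (Cell 0 2) 0 (int m + int g)) [0..<n]"
  have lu: "length u = n" by (simp add: u_def)
  have in0: "inner 0 (int m + int g)" if "g < q" for g using that by (simp add: inner_def)
  have c5: "ccode (int m + int g) = 5" if "g < q" for g using that by (auto simp: ccode_def)
  have after: "bl g" if "n \<le> g" "g < q" for g
    using that
  proof (induction g rule: dec_induct)
    case base
    then show ?case using n(2) by auto
  next
    case (step g)
    then have "bl g" by simp
    then show ?case unfolding bl_def
      using monoD[of "int m + int g"] step.prems in0[of g] in0[of "Suc g"] c5[of g] c5[of "Suc g"] by (simp add: add.assoc add.commute)
  qed
  have "s (Cell 0 (word_content (enc_word x @ u) i)) 0 i" if i: "inner 0 i" for i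
  proof (cases "int m \<le> i \<and> i < int (m + q)")
    case True
    then obtain g where g: "i = int m + int g" "g < q" by (metis add_less_cancel_left of_nat_add of_nat_less_iff zle_iff_zadd)
    show ?thesis
    proof (cases "g < n")
      case gn: True
      have "nat i = m + g" using g by simp
      then have "(enc_word x @ u) ! nat i = u ! g" by (simp add: nth_append)
      also have "u ! g = s (Cell 0 2) 0 i" using gn g by (simp add: u_def)
      finally have w: "word_content (enc_word x @ u) i = (if s (Cell 0 2) 0 i then 2 else 1)"
        using g gn lu by (simp add: word_content_def)
      have "\<not> s (Cell 0 0) 0 i" using nl[OF gn] g by (simp add: bl_def)
      with guessD[OF i] c5[OF g(2)] g w show ?thesis by auto
    next
      case False
      then have "word_content (enc_word x @ u) i = 0" using g lu by (simp add: word_content_def)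
      with after[of g] False g show ?thesis by (simp add: bl_def)
    qed
  next
    case False
    have "initially M (Cell 0 (word_content (enc_word x @ u) i)) (ccode i)"
    proof (cases "i < 0 \<or> int (m + q) \<le> i")
      case True
      then have "word_content (enc_word x @ u) i = 0" using lu n(1) by (auto simp: word_content_def)
      moreover have "ccode i = 2" using True i by (auto simp: ccode_def inner_def)
      ultimately show ?thesis by simp
    next
      case ni: False
      then have im: "0 \<le> i" "i < int m" using False by auto
      then have "nat i < m" by simp
      then have "(enc_word x @ u) ! nat i = enc_word x ! nat i" by (simp add: nth_append)
      with im have w: "word_content (enc_word x @ u) i = (if enc_word x ! nat i then 2 else 1)"
        by (simp add: word_content_def)
      have "ccode i = (if i = 0 then if enc_word x ! nat i then 7 else 6 else if enc_word x ! nat i then 4 else 3)"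
        using im by (auto simp: ccode_def)
      with w show ?thesis by (cases "i = 0"; cases "enc_word x ! nat i") simp_all
    qed
    moreover have "word_content (enc_word x @ u) i < symbols M" using k2 by (simp add: word_content_def)
    ultimately show ?thesis using i by (intro initD) (simp_all add: tag_mem)
  qed
  with lu n(1) show ?thesis by blast
qed

text \<open>Per step the region of certain contents loses one cell on either side, because a head
  move may shift in a cell from beyond it.\<close>

lemma follows:
  assumes y: "\<And>i. inner 0 i \<Longrightarrow> s (Cell 0 (word_content y i)) 0 i"
  shows "t \<le> T \<Longrightarrow> s (Ctl (state y t) []) (int t) 0 \<and>
    (\<forall>j\<le>tapes M. \<forall>i. \<bar>i\<bar> \<le> int B - int t \<longrightarrow> s (Cell j (content y t j i)) (int t) i)"
proof (induction t)
  case 0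
  have c0: "ccode 0 = 6 \<or> ccode 0 = 7" using m0 by (auto simp: ccode_def simp del: length_greater_0_conv)
  have in0: "inner 0 0" unfolding inner_def using m0 by linarith
  have "s (Ctl 0 []) 0 0" by (rule initD[OF _ in0]) (use c0 in \<open>auto simp: tag_mem vecs_def\<close>)
  moreover have "s (Cell j (content y 0 j i)) 0 i" if "j \<le> tapes M" "\<bar>i\<bar> \<le> int B" for i j
  proof (cases "j = 0")
    case True
    have "inner 0 i" unfolding inner_def using that m0 by linarith
    with y True show ?thesis by (simp add: content_0)
  next
    case False
    have i: "inner 0 i" unfolding inner_def using that m0 by linarith
    have c: "ccode i = 6 \<or> ccode i = 7 \<longleftrightarrow> i = 0" using m0 by (auto simp: ccode_def simp del: length_greater_0_conv)
    show ?thesis by (rule initD[OF _ i]) (use False that c content_sym[of y 0 j i] in \<open>auto simp: tag_mem content_0\<close>)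
  qed
  ultimately show ?case by (simp add: content_0)
next
  case (Suc t)
  let ?q = "state y t" and ?v = "reads y t" and ?t = "int t"
  have st: "s (Ctl ?q []) ?t 0" and ce: "\<And>j i. j \<le> tapes M \<Longrightarrow> \<bar>i\<bar> \<le> int B - ?t \<Longrightarrow> s (Cell j (content y t j i)) ?t i"
    using Suc by auto
  have tB: "int t + 1 \<le> int B" using Suc.prems B by linarith
  have in1: "inner ?t i" if "\<bar>i\<bar> \<le> int B" for i unfolding inner_def using that Suc.prems m0 by linarith
  have in2: "inner (?t + 1) i" if "\<bar>i\<bar> \<le> int B" for i unfolding inner_def using that Suc.prems m0 by linarith
  have lv: "length ?v = Suc (tapes M)" using reads_full[of y t] by (simp add: fullvecs_def)
  have tv: "take n ?v \<in> vecs M" for n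
    using reads_full[of y t] set_take_subset[of n ?v] by (auto simp: vecs_def fullvecs_def)
  \<comment> \<open>The symbols under the heads are collected one tape at a time, as
    \<open>RScan\<close> handles a single one.\<close>
  have "n \<le> Suc (tapes M) \<Longrightarrow> s (Ctl ?q (take n ?v)) ?t 0" for n
  proof (induction n)
    case (Suc n)
    have "s (Cell n (content y t n 0)) ?t 0" using Suc.prems tB by (intro ce) auto
    then have "s (Ctl ?q (take n ?v @ [content y t n 0])) ?t 0"
      using Suc in1[of 0] lv tv[of n] content_sym[of y t n 0] state_le[of y t] by (intro scanD) auto
    moreover have "take (Suc n) ?v = take n ?v @ [content y t n 0]"
      using Suc.prems lv by (simp add: take_Suc_conv_app_nth reads_nth)
    ultimately show ?case by simp
  qed (use st in simp)
  from this[of "Suc (tapes M)"] have full: "s (Ctl ?q ?v) ?t 0" using lv by simp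
  note qv = state_le[of y t] reads_full[of y t]
  \<comment> \<open>The transition spreads over the row by induction on the distance from the heads:
    \<open>RSh\<close> makes the first step, \<open>RProp\<close> the others.\<close>
  have sh: "s (Sh b ?q ?v) ?t (if b then int n else - int n)" if "1 \<le> n" "n \<le> B" for b n
    using that
  proof (induction n rule: dec_induct)
    case base
    then show ?case using shD[OF qv in1[of 0] _ full, of b] in1[of "if b then 1 else -1"] by (cases b) auto
  next
    case (step n)
    have 1: "(if b then int n else - int n) + (if b then 1 else -1) = (if b then int (Suc n) else - int (Suc n))"
      by (cases b) auto
    have "inner ?t (if b then int n else - int n)" "inner ?t (if b then int (Suc n) else - int (Suc n))"
      using step.prems by (auto intro!: in1)
    with propD[OF qv, of ?t "if b then int n else - int n" b, unfolded 1] step show ?case by simp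
  qed
  have "s (Ctl (state y (Suc t)) []) (?t + 1) 0"
    unfolding state_Suc by (rule nextD[OF qv]) (use in1[of 0] in2[of 0] full in auto)
  moreover have "s (Cell j (content y (Suc t) j i)) (?t + 1) i" if j: "j \<le> tapes M" and i: "\<bar>i\<bar> \<le> int B - int (Suc t)" for j i
  proof -
    \<comment> \<open>Cell \<open>i\<close> of the new row comes from \<open>i + off\<close> in the
      old one: it was under the head if this is 0, and otherwise lies on the side given by its
      sign.\<close>
    define off where "off = offset (snd (act M ?q ?v j))"
    have o: "\<bar>off\<bar> \<le> 1" unfolding off_def by (cases "snd (act M ?q ?v j)") auto
    show ?thesis
    proof (cases "i + off = 0")
      case True
      then have "i = 0 - off" by simp
      with True writeD[OF qv j in1[of 0] _ full] in2[of i] i show ?thesis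
        by (simp add: content_Suc[OF j] off_def[symmetric])
    next
      case False
      define b where "b \<longleftrightarrow> 0 < i + off"
      define n where "n = nat \<bar>i + off\<bar>"
      have io: "i + off = (if b then int n else - int n)" "1 \<le> n" "n \<le> B"
        using False i o by (auto simp: b_def n_def)
      have "s (Cell j (content y t j (i + off))) ?t (i + off)" using i o by (intro ce j) auto
      moreover have "s (Sh b ?q ?v) ?t (i + off)" unfolding io(1) using io by (intro sh) auto
      moreover have "inner ?t (i + off)" using i o by (intro in1) auto
      moreover have "inner (?t + 1) (i + off - off)" using i by (simp add: in2)
      ultimately have "s (Cell j (content y t j (i + off))) (?t + 1) (i + off - off)"
        unfolding off_def using content_sym by (intro moveD[OF qv j]) auto
      with False show ?thesis by (simp add: content_Suc[OF j] off_def[symmetric])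
    qed
  qed
  ultimately show ?case by (simp add: add.commute)
qed

lemma sound:
  assumes T: "0 < T"
  shows "\<exists>u. length u \<le> q \<and> fst (snd (conf (enc_word x @ u) T) ! 1) 0 = 2 \<and> fst (snd (conf (enc_word x @ u) T) ! 1) 1 = 0"
proof -
  obtain u where u: "length u \<le> q" "\<And>i. inner 0 i \<Longrightarrow> s (Cell 0 (word_content (enc_word x @ u) i)) 0 i"
    using guessed by blast
  let ?y = "enc_word x @ u"
  let ?h = "hpos ?y T"
  have ce: "s (Cell j (content ?y T j i)) (int T) i" if "j \<le> tapes M" "\<bar>i\<bar> \<le> int B - int T" for j i
    using follows[OF u(2), of T] that by simp
  have h: "\<bar>?h\<bar> \<le> int T" by (rule hpos)
  have r: "\<bar>- ?h\<bar> \<le> int B - int T" "\<bar>- ?h + 1\<bar> \<le> int B - int T" using h B by linarith+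
  have i: "inner (int T) (- ?h)" "inner (int T) (- ?h + 1)" unfolding inner_def using r m0 by linarith+
  have mk: "s (Cell (tapes M) 1) (int T) (- ?h)" using ce[of "tapes M" "- ?h"] r by (simp add: content_out)
  have k1: "1 \<le> tapes M" using k2 by simp
  have "content ?y T 1 (- ?h) = 2" using fin1D[OF T i(1) mk ce[OF k1 r(1)] content_sym] .
  moreover have "content ?y T 1 (- ?h + 1) = 0" using fin2D[OF T i mk ce[OF k1 r(2)] content_sym] .
  ultimately have "fst (snd (conf ?y T) ! 1) 0 = 2" "fst (snd (conf ?y T) ! 1) 1 = 0"
    using content_out(1)[of ?y T "- ?h"] content_out(1)[of ?y T "- ?h + 1"] by simp_all
  with u(1) show ?thesis by blast
qed

end

section \<open>Completeness of the constraint system\<close>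

context
  fixes u :: "bool list"
  assumes u: "length u \<le> q"
    and accept: "fst (snd (conf (enc_word x @ u) T) ! 1) = word_content [True]"
    and T0: "0 < T"
begin

abbreviation "y \<equiv> enc_word x @ u"

fun fact :: "tag \<Rightarrow> int \<Rightarrow> int \<Rightarrow> bool" where
  "fact (Cell j a) t i \<longleftrightarrow> content y (nat t) j i = a"
| "fact (Ctl q' v) t i \<longleftrightarrow> i = 0 \<and> q' = state y (nat t) \<and> v = take (length v) (reads y (nat t))"
| "fact (Sh b q' v) t i \<longleftrightarrow> (if b then 0 < i else i < 0) \<and> q' = state y (nat t) \<and> v = reads y (nat t)"

text \<open>A guard sees only the column of its own literal, so \<open>RMono\<close> also yields
  clauses that straddle the ends of the certificate zone. They hold because the input has no blanks
  and everything behind the certificate is blank.\<close>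

lemma mono_guess:
  assumes "inner 0 i" "3 \<le> ccode i" "word_content y i = 0"
  shows "ccode (i + 1) = 2 \<or> ccode (i + 1) = 5" "inner 0 (i + 1)"
    "word_content y (i + 1) = 0"
proof -
  have i0: "0 \<le> i" "i < int (m + q)" using assms(2) by (auto simp: ccode_def split: if_splits)
  then have i: "int (length y) \<le> i" using assms(3) by (auto simp: word_content_def split: if_splits)
  then show "word_content y (i + 1) = 0" by (simp add: word_content_def)
  have im: "int m \<le> i" using i by simp
  show "inner 0 (i + 1)" unfolding inner_def using i0 T0 B by linarith
  show "ccode (i + 1) = 2 \<or> ccode (i + 1) = 5" using im i0 T0 B by (auto simp: ccode_def)
qed

lemma mono_guess':
  assumes "inner 0 i" "ccode i = 5" "word_content y i \<noteq> 0"
  shows "3 \<le> ccode (i - 1) \<and> inrange 0 (i - 1) \<and> (inner 0 (i - 1) \<longrightarrow> word_content y (i - 1) \<noteq> 0)"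
proof -
  have i: "int m \<le> i" "i < int (m + q)" using assms(2) by (auto simp: ccode_def split: if_splits)
  have m0: "0 < m" by (cases x) auto
  have i1: "1 \<le> i" "i - 1 < int (m + q)" using i m0 by linarith+
  have "i < int (length y)" using assms(3) i by (auto simp: word_content_def split: if_splits)
  then have "word_content y (i - 1) \<noteq> 0" using i1 by (simp add: word_content_def)
  moreover have "3 \<le> ccode (i - 1)" using i1 by (auto simp: ccode_def)
  moreover have "inrange 0 (i - 1)" unfolding inrange_def using i m0 by linarith
  ultimately show ?thesis by blast
qed

lemma fact_init:
  assumes "inner 0 i" "initially M g (ccode i)"
  shows "fact g 0 i"
proof (cases g)
  case (Cell j a)
  have m0: "0 < m" by (cases x) auto
  have c: "ccode i = 6 \<or> ccode i = 7 \<longleftrightarrow> i = 0" using m0 by (auto simp: ccode_def simp del: length_greater_0_conv)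
  show ?thesis
  proof (cases "j = 0")
    case True
    have nl: "ccode i = 2 \<Longrightarrow> word_content y i = 0"
      using u by (auto simp: ccode_def word_content_def split: if_splits)
    have im: "0 \<le> i \<and> i < int m \<and> enc_word x ! nat i = (ccode i = 4 \<or> ccode i = 7)"
      if "ccode i \<in> {3, 4, 6, 7}"
      using that m0 by (auto simp: ccode_def split: if_splits)
    have "word_content y i = (if ccode i = 4 \<or> ccode i = 7 then 2 else 1)" if "ccode i \<in> {3, 4, 6, 7}"
      using im[OF that] by (simp add: word_content_def nth_append nat_less_iff)
    with assms(2) nl Cell True show ?thesis by (auto simp: content_0)
  next
    case False
    with assms(2) Cell c show ?thesis by (auto simp: content_0 split: if_splits)
  qed
next
  case (Ctl q' v)
  have m0: "0 < m" by (cases x) auto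
  have "ccode i = 6 \<or> ccode i = 7 \<longleftrightarrow> i = 0" using m0 by (auto simp: ccode_def simp del: length_greater_0_conv)
  with assms(2) Ctl show ?thesis by (auto simp: content_0)
next
  case (Sh b q' v)
  with assms(2) show ?thesis by simp
qed

lemma fact_full: "v \<in> fullvecs M \<Longrightarrow> fact (Ctl q' v) t i \<longleftrightarrow> i = 0 \<and> q' = state y (nat t) \<and> v = reads y (nat t)"
  using reads_full[of y "nat t"] by (simp add: fullvecs_def)

lemma nat_Suc: "0 \<le> t \<Longrightarrow> nat (t + 1) = Suc (nat t)"
  by simp

lemma fact_rule:
  assumes r: "r \<in> rules M" "\<forall>(sg, v, a, b, g)\<in>set (lits M r). g = always"
    and i: "list_all (\<lambda>(sg, v, a, b, g). inner (t + int a) (i + (int b - 1))) (lits M r)"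
  shows "list_ex (\<lambda>(sg, v, a, b, g). fact v (t + int a) (i + (int b - 1)) = sg) (lits M r)"
proof -
  have t: "0 \<le> t" if "(sg, v, 0, b, g) \<in> set (lits M r)" for sg v b g
    using i that by (auto simp: list_all_iff inner_def)
  show ?thesis
  proof (cases r)
    case (RScan q' v a)
    have "fact (Ctl q' (v @ [a])) t i" if "fact (Ctl q' v) t i" "fact (Cell (length v) a) t i"
    proof -
      have l: "length v \<le> tapes M" using r(1) by (simp add: RScan rule_mem)
      have "take (Suc (length v)) (reads y (nat t)) = take (length v) (reads y (nat t)) @ [content y (nat t) (length v) 0]"
        using l reads_full[of y "nat t"] by (simp add: fullvecs_def take_Suc_conv_app_nth reads_nth)
      with that show ?thesis by auto
    qed
    then show ?thesis by (auto simp: RScan)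
  next
    case (RNext q' v)
    have v: "v \<in> fullvecs M" using r(1) by (simp add: RNext rule_mem)
    have t: "0 \<le> t" using t[of False "Ctl q' v" 1 always] by (simp add: RNext)
    have "fact (Ctl (nxt M q' v) []) (t + 1) i" if "fact (Ctl q' v) t i"
      using that[unfolded fact_full[OF v]] by (simp add: nat_Suc[OF t] state_Suc)
    then show ?thesis by (simp add: RNext del: fact.simps, blast?)
  next
    case (RWrite q' v j)
    have v: "v \<in> fullvecs M" "j \<le> tapes M" using r(1) by (simp_all add: RWrite rule_mem)
    have t: "0 \<le> t" using t[of False "Ctl q' v" 1 always] by (simp add: RWrite)
    have "fact (Cell j (fst (act M q' v j))) (t + 1) (i - offset (snd (act M q' v j)))" if "fact (Ctl q' v) t i"
      using that[unfolded fact_full[OF v(1)]] by (simp add: nat_Suc[OF t] content_Suc[OF v(2)])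
    then show ?thesis by (simp add: RWrite pull_offset del: fact.simps, blast?)
  next
    case (RSh b q' v)
    have v: "v \<in> fullvecs M" using r(1) by (simp add: RSh rule_mem)
    have "fact (Sh b q' v) t (i + (int (away b) - 1))" if "fact (Ctl q' v) t i"
      using that[unfolded fact_full[OF v]] by (cases b) (simp_all add: away_def)
    then show ?thesis by (simp add: RSh del: fact.simps, blast?)
  next
    case (RProp b q' v)
    have "fact (Sh b q' v) t (i + (int (away b) - 1))" if "fact (Sh b q' v) t i"
      using that by (cases b) (simp_all add: away_def)
    then show ?thesis by (simp add: RProp del: fact.simps, blast?)
  next
    case (RMove b q' v j a)
    have v: "j \<le> tapes M" using r(1) by (simp_all add: RMove rule_mem)
    have t: "0 \<le> t" using t[of False "Sh b q' v" 1 always] by (simp add: RMove)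
    have "fact (Cell j a) (t + 1) (i - offset (snd (act M q' v j)))"
      if "fact (Sh b q' v) t i" "fact (Cell j a) t i"
      using that unfolding fact.simps nat_Suc[OF t] by (cases b) (simp_all add: content_Suc[OF v])
    then show ?thesis by (simp add: RMove pull_offset del: fact.simps, blast?)
  qed (use r(2) in \<open>auto simp: fun_eq_iff dest: spec[of _ "0 :: nat"]\<close>)
qed

text \<open>If no literal of a clause is true, those present lie in the interior. Then all its
  literals are in range and, for rules without guards, present, hence interior too; so a rule of the
  machine would be violated. The rules with guards concern the first and the last row and are
  treated one by one.\<close>

lemma complete: "consistent fact"
  unfolding consistent_def
proof (intro ballI allI impI)
  fix r t i assume r: "r \<in> rules M" and ex: "\<exists>l. lit_at r t i l"
  show "\<exists>l. lit_at r t i l \<and> lit_true fact t i l"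
  proof (rule ccontr)
    assume "\<not> ?thesis"
    then have no: "\<And>l. lit_at r t i l \<Longrightarrow> \<not> lit_true fact t i l" by blast
    have nin: "inner (t + int a) (i + (int b - 1)) \<and> fact v (t + int a) (i + (int b - 1)) \<noteq> sg"
      if "(sg, v, a, b, g) \<in> set (lits M r)" "inrange (t + int a) (i + (int b - 1))"
        "g (rcode (t + int a)) (ccode (i + (int b - 1)))" for sg v a b g
      using no[of "(sg, v, a, b, g)"] that by (simp add: lit_at_def lit_true_def)
    obtain sg0 v0 a0 b0 g0 where l0: "(sg0, v0, a0, b0, g0) \<in> set (lits M r)"
      "inrange (t + int a0) (i + (int b0 - 1))" "g0 (rcode (t + int a0)) (ccode (i + (int b0 - 1)))"
    proof -
      obtain l where "lit_at r t i l" using ex by (elim exE)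
      moreover obtain sg v a b g where "l = (sg, v, a, b, g)" by (metis prod_cases5)
      ultimately show thesis using that[of sg v a b g] by (simp add: lit_at_def)
    qed
    have in0: "inner (t + int a0) (i + (int b0 - 1))" "fact v0 (t + int a0) (i + (int b0 - 1)) \<noteq> sg0" using nin[OF l0] by (rule conjunct1, rule conjunct2)
    have ab0: "a0 \<le> 1" "b0 \<le> 2" using lits_ok[OF M r l0(1)] by auto
    have near: "inrange (t + int a) (i + (int b - 1))" if "(sg, v, a, b, g) \<in> set (lits M r)" for sg v a b g
      using lits_ok[OF M r that] in0(1) ab0 unfolding inner_def inrange_def by linarith
    have rc2: "rcode t' = 2 \<Longrightarrow> t' = 0" "rcode t' = 4 \<Longrightarrow> t' = int T" for t'
      by (auto simp: rcode_def split: if_splits)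
    show False
    proof (cases "\<forall>(sg, v, a, b, g)\<in>set (lits M r). g = always")
      case True
      have "inner (t + int a) (i + (int b - 1)) \<and> fact v (t + int a) (i + (int b - 1)) \<noteq> sg"
        if "(sg, v, a, b, g) \<in> set (lits M r)" for sg v a b g
      proof -
        have "g = always" using True that by blast
        with nin[OF that near[OF that]] show ?thesis by simp
      qed
      note h = this
      have "list_all (\<lambda>(sg, v, a, b, g). inner (t + int a) (i + (int b - 1))) (lits M r)"
        unfolding list_all_iff
      proof
        fix l assume l: "l \<in> set (lits M r)"
        obtain sg v a b g where "l = (sg, v, a, b, g)" by (metis prod_cases5)
        with h l show "case l of (sg, v, a, b, g) \<Rightarrow> inner (t + int a) (i + (int b - 1))" by simp
      qed
      from fact_rule[OF r True this] obtain l where l: "l \<in> set (lits M r)"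
        "case l of (sg, v, a, b, g) \<Rightarrow> fact v (t + int a) (i + (int b - 1)) = sg"
        unfolding list_ex_iff by (elim bexE)
      obtain sg v a b g where "l = (sg, v, a, b, g)" by (metis prod_cases5)
      with h[of sg v a b g] l show False by simp
    next
      case False
      show False
      proof (cases r)
        case (RInit g)
        with l0 in0 rc2 have "t = 0" "inner 0 i" "initially M g (ccode i)" "\<not> fact g 0 i"
          by (auto simp del: fact.simps)
        with fact_init show False by blast
      next
        case RGuess
        with l0 in0(1) have t': "rcode t = 2" "inner t i" "ccode i = 5" by auto
        with rc2(1)[of t] have t: "t = 0" "inner 0 i" "ccode i = 5" by simp_all
        have "fact (Cell 0 0) 0 i \<or> fact (Cell 0 1) 0 i \<or> fact (Cell 0 2) 0 i"
          by (simp add: content_0 word_content_def)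
        then show False
          using nin[of True "Cell 0 0" 0 1 "\<lambda>r c. r = 2 \<and> c = 5"] nin[of True "Cell 0 1" 0 1 "\<lambda>r c. r = 2 \<and> c = 5"] nin[of True "Cell 0 2" 0 1 "\<lambda>r c. r = 2 \<and> c = 5"] t inner_inrange[OF t(2)]
          by (simp add: RGuess rcode_def del: fact.simps)
      next
        case RMono
        with l0(1) have "sg0 = False \<and> v0 = Cell 0 0 \<and> a0 = 0 \<and> b0 = 1 \<and> g0 = (\<lambda>r c. r = 2 \<and> 3 \<le> c) \<or>
          sg0 = True \<and> v0 = Cell 0 0 \<and> a0 = 0 \<and> b0 = 2 \<and> g0 = (\<lambda>r c. r = 2 \<and> (c = 2 \<or> c = 5))"
          by simp
        then consider "a0 = 0" "b0 = 1" "v0 = Cell 0 0" "sg0 = False" "rcode t = 2" "3 \<le> ccode i"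
          | "a0 = 0" "b0 = 2" "v0 = Cell 0 0" "sg0 = True" "rcode t = 2" "ccode (i + 1) = 2 \<or> ccode (i + 1) = 5"
        proof (elim disjE conjE)
          assume "sg0 = False" "v0 = Cell 0 0" "a0 = 0" "b0 = 1" "g0 = (\<lambda>r c. r = 2 \<and> 3 \<le> c)"
          with l0(3) show thesis by (intro that(1)) simp_all
        next
          assume "sg0 = True" "v0 = Cell 0 0" "a0 = 0" "b0 = 2" "g0 = (\<lambda>r c. r = 2 \<and> (c = 2 \<or> c = 5))"
          with l0(3) show thesis by (intro that(2)) simp_all
        qed
        then show False
        proof cases
          case 1
          then have "t = 0" using rc2(1) by simp
          with 1 in0 have t: "t = 0" "inner 0 i" "word_content y i = 0" by (simp_all add: content_0)
          note mg = mono_guess[OF t(2) 1(6) t(3)]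
          have "rcode 0 = 2" by (simp add: rcode_def)
          with nin[of True "Cell 0 0" 0 2 "\<lambda>r c. r = 2 \<and> (c = 2 \<or> c = 5)"] mg(1,3) t(1) inner_inrange[OF mg(2)]
          show False by (simp add: RMono content_0)
        next
          case 2
          then have "t = 0" using rc2(1) by simp
          with 2 in0 have t: "t = 0" "inner 0 (i + 1)" "word_content y (i + 1) \<noteq> 0" by (simp_all add: content_0)
          have "ccode (i + 1) \<noteq> 2"
            using t(3) u by (auto simp: ccode_def word_content_def split: if_splits)
          with 2 have "ccode (i + 1) = 5" by simp
          from mono_guess'[OF t(2) this t(3)] have mg: "3 \<le> ccode i" "inrange 0 i" "inner 0 i \<longrightarrow> word_content y i \<noteq> 0"
            by simp_all
          have "rcode 0 = 2" by (simp add: rcode_def)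
          with nin[of False "Cell 0 0" 0 1 "\<lambda>r c. r = 2 \<and> 3 \<le> c"] mg t(1) show False
            by (simp add: RMono content_0)
        qed
      next
        case (RFin1 s)
        have s: "s \<noteq> 2" using r by (simp add: RFin1 rule_mem)
        from RFin1 l0 in0(1) have t': "rcode t = 4" "inner t i" by auto
        with rc2(2)[of t] have t: "t = int T" "inner (int T) i" by simp_all
        have "content y T 1 i \<noteq> s \<or> content y T (tapes M) i \<noteq> 1"
          using s accept by (auto simp: content_out word_content_def simp del: One_nat_def)
        then show False
          using nin[of False "Cell (tapes M) 1" 0 1 "\<lambda>r c. r = 4"] nin[of False "Cell 1 s" 0 1 "\<lambda>r c. r = 4"] t inner_inrange[OF t(2)] T0
          by (auto simp: RFin1 rcode_def)
      next
        case (RFin2 s)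
        have s: "s \<noteq> 0" using r by (simp add: RFin2 rule_mem)
        from RFin2 l0 have "rcode t = 4" by auto
        with rc2(2)[of t] have t: "t = int T" by simp
        have n: "inrange (int T) i" "inrange (int T) (i + 1)"
          using near[of False "Cell (tapes M) 1" 0 1 "\<lambda>r c. r = 4"] near[of False "Cell 1 s" 0 2 "\<lambda>r c. r = 4"] t by (simp_all add: RFin2)
        have r4: "rcode (int T) = 4" using T0 by (simp add: rcode_def)
        have "(False, Cell (tapes M) 1, 0, 1, \<lambda>r c. r = 4) \<in> set (lits M r)" by (simp add: RFin2)
        from nin[OF this] n r4 t have c1: "content y T (tapes M) i = 1" by simp
        have "(False, Cell 1 s, 0, 2, \<lambda>r c. r = 4) \<in> set (lits M r)" by (simp add: RFin2)
        from nin[OF this] n r4 t have c2: "content y T 1 (i + 1) = s" by simp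
        \<comment> \<open>The mark identifies column \<open>i\<close> as the origin, so column
          \<open>i + 1\<close> holds the output cell 1, which is blank.\<close>
        have "hpos y T + i = 0" using c1 unfolding content_out(2) by (simp split: if_splits)
        then have e: "hpos y T + (i + 1) = 1" by simp
        have "s = word_content [True] 1" using c2[symmetric] unfolding content_out(1) accept e .
        then show False using s by (simp add: word_content_def)
      qed (use False in auto)
    qed
  qed
qed

end

end

section \<open>The constraint system as a sequence\<close>

instance tag :: countable
  by countable_datatype

instance rule :: countable
  by countable_datatype

definition cV :: "tag \<Rightarrow> nat" where
  "cV v = to_nat (Inl v :: tag + rule)"

definition cR :: "rule \<Rightarrow> nat" where
  "cR r = to_nat (Inr r :: tag + rule)"

lemma c_inject [simp]: "cV v = cV v' \<longleftrightarrow> v = v'" "cR r = cR r' \<longleftrightarrow> r = r'" "cV v \<noteq> cR r" "cR r \<noteq> cV v"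
  by (simp_all add: cV_def cR_def)

text \<open>Coordinates in unary are what sweeps can write. The code \<open>c\<close> comes last and
  is delimited by the end of the word.\<close>

definition nm :: "nat \<Rightarrow> nat \<Rightarrow> nat \<Rightarrow> letter" where
  "nm c i j = replicate i True @ False # replicate j True @ False # replicate c True"

lemma replicate_split: "replicate i True @ False # xs = replicate j True @ False # ys \<longleftrightarrow> i = j \<and> xs = ys"
proof (induction i arbitrary: j)
  case 0
  then show ?case by (cases j) auto
next
  case (Suc i)
  then show ?case by (cases j) auto
qed

lemma nm_inject [simp]: "nm c i j = nm c' i' j' \<longleftrightarrow> c = c' \<and> i = i' \<and> j = j'"
  unfolding nm_def replicate_split by (auto dest: arg_cong[of _ _ length])

lemma nm_Nil [simp]: "nm c i j \<noteq> []"
  by (simp add: nm_def)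

text \<open>What the body of a loop finds in the swept register, iteration by iteration: the length
  of a suffix is a coordinate, its head the code of a row or column.\<close>

fun sfx :: "'a list \<Rightarrow> 'a list list" where
  "sfx [] = []"
| "sfx (x # xs) = (x # xs) # sfx xs"

lemma set_sfx: "(\<lambda>s. (length s, hd s)) ` set (sfx xs) = (\<lambda>n. (n, xs ! (length xs - n))) ` {1..length xs}"
proof (induction xs)
  case (Cons x xs)
  have "{1..length (x # xs)} = insert (Suc (length xs)) {1..length xs}" by auto
  moreover have "(\<lambda>n. (n, (x # xs) ! (length (x # xs) - n))) ` {1..length xs} = (\<lambda>n. (n, xs ! (length xs - n))) ` {1..length xs}"
    by (intro image_cong) (auto simp: Suc_diff_le)
  ultimately show ?case using Cons by simp
qed simp

lemma sum_sfx: "(\<Sum>s\<leftarrow>sfx xs. f (length s) (hd s)) = (\<Sum>n\<in>{1..length xs}. f n (xs ! (length xs - n)) :: nat)"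
proof (induction xs)
  case (Cons x xs)
  have "{1..length (x # xs)} = insert (Suc (length xs)) {1..length xs}" by auto
  moreover have "(\<Sum>n\<in>{1..length xs}. f n ((x # xs) ! (length (x # xs) - n))) = (\<Sum>n\<in>{1..length xs}. f n (xs ! (length xs - n)))"
    by (intro sum.cong) (auto simp: Suc_diff_le)
  ultimately show ?case using Cons by simp
qed simp

type_synonym sym = "nat \<times> nat \<times> nat"

text \<open>Coordinates are counted from the end of a register, so that going back from a literal to
  the position of its clause means adding the offsets.\<close>

definition inst :: "nat \<Rightarrow> nat \<Rightarrow> sym \<Rightarrow> letter" where
  "inst i j = (\<lambda>(c, a, b). nm c (i + a) (j + b))"

definition emit :: "tm \<Rightarrow> rule list \<Rightarrow> bool \<Rightarrow> tag \<Rightarrow> nat \<Rightarrow> nat \<Rightarrow> sym list" where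
  "emit M rl sg v rc cc = concat (map (\<lambda>r. concat (map (\<lambda>(sg', v', a, b, g).
     if sg' = sg \<and> v' = v \<and> g rc cc then [(cR r, a, b)] else []) (lits M r))) rl)"

definition titem :: "tm \<Rightarrow> rule list \<Rightarrow> nat \<Rightarrow> nat \<Rightarrow> tag \<Rightarrow> sym item" where
  "titem M rl rc cc v =
     (if rc = 1 \<or> cc = 1 then None else Some (cV v, 0, 0), emit M rl True v rc cc, emit M rl False v rc cc)"

definition mi :: "('a \<Rightarrow> 'b) \<Rightarrow> 'a item \<Rightarrow> 'b item" where
  "mi f = (\<lambda>(v, P, N). (map_option f v, map f P, map f N))"

lemma map_dbl: "map f (dbl xs) = dbl (map f xs)"
  by (induction xs) auto

lemma seg_mi: "seg (mi f i) = map f (seg i)"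
  by (cases i rule: seg.cases) (simp_all add: mi_def map_dbl)

definition tmpl :: "tm \<Rightarrow> tag list \<Rightarrow> rule list \<Rightarrow> nat \<Rightarrow> nat \<Rightarrow> sym list" where
  "tmpl M tgs rl rc cc = concat (map (\<lambda>v. seg (titem M rl rc cc v)) tgs)"

section \<open>Counting the occurrences of a letter\<close>

lemma set_emit: "(c, a, b) \<in> set (emit M rl sg v rc cc) \<longleftrightarrow>
    (\<exists>r\<in>set rl. \<exists>g. c = cR r \<and> (sg, v, a, b, g) \<in> set (lits M r) \<and> g rc cc)"
  unfolding emit_def by (fastforce split: if_splits)

lemma count_concat: "count_list (concat (map f xs)) a = (\<Sum>x\<leftarrow>xs. count_list (f x) a)"
  by (induction xs) auto

lemma count_dbl: "count_list (dbl xs) a = 2 * count_list xs a"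
  by (induction xs) auto

lemma sum_list_swap: "(\<Sum>x\<leftarrow>xs. \<Sum>y\<leftarrow>ys. f x y) = (\<Sum>y\<leftarrow>ys. \<Sum>x\<leftarrow>xs. f x y :: nat)"
  by (induction xs) (simp_all add: sum_list_addf)

lemma sum_list_single: "distinct xs \<Longrightarrow> (\<Sum>x\<leftarrow>xs. if x = y then c else 0) \<le> (c :: nat)"
proof (induction xs)
  case (Cons x xs)
  have "y \<notin> set xs \<Longrightarrow> (\<Sum>x\<leftarrow>xs. if x = y then c else 0) = 0" by (induction xs) auto
  with Cons show ?case by (cases "x = y") auto
qed simp

lemma count_emit:
  assumes "distinct rl"
  shows "count_list (emit M rl sg v rc cc) (cR r, a, b) \<le>
    (\<Sum>(sg', v', a', b', g)\<leftarrow>lits M r. of_bool (a' = a \<and> b' = b \<and> v' = v \<and> sg' = sg))"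
proof -
  let ?X = "\<Sum>(sg', v', a', b', g)\<leftarrow>lits M r. of_bool (a' = a \<and> b' = b \<and> v' = v \<and> sg' = sg) :: nat"
  have 1: "count_list (concat (map (\<lambda>(sg', v', a, b, g).
     if sg' = sg \<and> v' = v \<and> g rc cc then [(cR r', a, b)] else []) L)) (cR r, a, b)
     \<le> (if r' = r then (\<Sum>(sg', v', a', b', g)\<leftarrow>L. of_bool (a' = a \<and> b' = b \<and> v' = v \<and> sg' = sg)) else 0)" for r' L
  proof (induction L)
    case (Cons l L)
    obtain sg' v' a' b' g where "l = (sg', v', a', b', g)" by (metis prod_cases5)
    with Cons show ?case by (cases "r' = r") (simp_all add: trans_le_add1 le_SucI)
  qed simp
  have "count_list (emit M rl sg v rc cc) (cR r, a, b) \<le> (\<Sum>r'\<leftarrow>rl. if r' = r then ?X else 0)"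
    unfolding emit_def count_concat
  proof (rule sum_list_mono)
    fix r'
    show "(\<Sum>x\<leftarrow>lits M r'. count_list (case x of (sg', v', a, b, g) \<Rightarrow>
       if sg' = sg \<and> v' = v \<and> g rc cc then [(cR r', a, b)] else []) (cR r, a, b)) \<le> (if r' = r then ?X else 0)"
      using 1[of r' "lits M r'"] unfolding count_concat by (cases "r' = r") simp_all
  qed
  also have "\<dots> \<le> ?X" by (rule sum_list_single[OF assms])
  finally show ?thesis .
qed

lemma count_tmpl_rule:
  assumes "distinct rl" "distinct tgs"
  shows "count_list (tmpl M tgs rl rc cc) (cR r, a, b) \<le>
    2 * (\<Sum>(sg', v', a', b', g)\<leftarrow>lits M r. of_bool (a' = a \<and> b' = b))"
proof -
  let ?f = "\<lambda>sg v. \<lambda>(sg', v', a', b', g). of_bool (a' = a \<and> b' = b \<and> v' = v \<and> sg' = sg) :: nat"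
  let ?h = "\<lambda>(sg', v', a', b', g). of_bool (a' = a \<and> b' = b) :: nat"
  have s: "count_list (seg (titem M rl rc cc v)) (cR r, a, b) =
    2 * (count_list (emit M rl True v rc cc) (cR r, a, b) + count_list (emit M rl False v rc cc) (cR r, a, b))" for v
    by (simp add: titem_def count_dbl)
  have "count_list (seg (titem M rl rc cc v)) (cR r, a, b) \<le> (\<Sum>l\<leftarrow>lits M r. 2 * (?f True v l + ?f False v l))" for v
    unfolding s sum_list_const_mult sum_list_addf
    using add_mono[OF count_emit[OF assms(1), of M True v rc cc r a b] count_emit[OF assms(1), of M False v rc cc r a b]]
    by simp
  then have "count_list (tmpl M tgs rl rc cc) (cR r, a, b) \<le> (\<Sum>v\<leftarrow>tgs. \<Sum>l\<leftarrow>lits M r. 2 * (?f True v l + ?f False v l))"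
    unfolding tmpl_def count_concat by (intro sum_list_mono)
  also have "\<dots> = (\<Sum>l\<leftarrow>lits M r. \<Sum>v\<leftarrow>tgs. 2 * (?f True v l + ?f False v l))" by (rule sum_list_swap)
  also have "\<dots> \<le> (\<Sum>l\<leftarrow>lits M r. 2 * ?h l)"
  proof (rule sum_list_mono)
    fix l :: lit
    obtain sg v a' b' g where l: "l = (sg, v, a', b', g)" by (metis prod_cases5)
    have "2 * (?f True v' l + ?f False v' l) = (if v' = v then 2 * ?h l else 0)" for v'
      by (cases sg) (auto simp: l)
    then show "(\<Sum>v\<leftarrow>tgs. 2 * (?f True v l + ?f False v l)) \<le> 2 * ?h l"
      using sum_list_single[OF assms(2), of v "2 * ?h l"] by simp
  qed
  also have "\<dots> = 2 * (\<Sum>l\<leftarrow>lits M r. ?h l)" by (simp add: sum_list_const_mult)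
  finally show ?thesis .
qed

lemma count_tmpl_var:
  assumes "distinct tgs"
  shows "count_list (tmpl M tgs rl rc cc) (cV v, a, b) \<le> (if a = 0 \<and> b = 0 then 3 else 0)"
proof -
  have e: "count_list (emit M rl sg v' rc cc) (cV v, a, b) = 0" for sg v' rc cc a b
    by (rule count_notin) (simp add: set_emit)
  have "count_list (seg (titem M rl rc cc v')) (cV v, a, b) \<le> (if v' = v then if a = 0 \<and> b = 0 then 3 else 0 else 0)" for v'
    by (auto simp: titem_def count_dbl e)
  then have "count_list (tmpl M tgs rl rc cc) (cV v, a, b) \<le> (\<Sum>v'\<leftarrow>tgs. if v' = v then if a = 0 \<and> b = 0 then 3 else 0 else 0)"
    unfolding tmpl_def count_concat by (intro sum_list_mono)
  also have "\<dots> \<le> (if a = 0 \<and> b = 0 then 3 else 0)" by (rule sum_list_single[OF assms])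
  finally show ?thesis .
qed

definition body_seq :: "(nat \<Rightarrow> nat \<Rightarrow> sym list) \<Rightarrow> nat list \<Rightarrow> nat list \<Rightarrow> letter list" where
  "body_seq F rows cols = concat (map (\<lambda>r. concat (map (\<lambda>c.
     map (inst (length r) (length c)) (F (hd r) (hd c))) (sfx cols))) (sfx rows))"

lemma count_inst: "count_list (map (inst i j) xs) (nm c n k) =
    (if i \<le> n \<and> j \<le> k then count_list xs (c, n - i, k - j) else 0)"
proof (induction xs)
  case (Cons x xs)
  obtain c' a b where "x = (c', a, b)" by (metis prod_cases3)
  moreover have "i + a = n \<longleftrightarrow> i \<le> n \<and> a = n - i" "j + b = k \<longleftrightarrow> j \<le> k \<and> b = k - j" by auto
  ultimately show ?case using Cons by (auto simp: inst_def)
qed simp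

lemma count_body_seq:
  "count_list (body_seq F rows cols) (nm c n k) =
    (\<Sum>i\<in>{1..length rows}. \<Sum>j\<in>{1..length cols}.
      if i \<le> n \<and> j \<le> k then count_list (F (rows ! (length rows - i)) (cols ! (length cols - j))) (c, n - i, k - j) else 0)"
  unfolding body_seq_def count_concat count_inst
    sum_sfx[of "\<lambda>j cc. if i \<le> n \<and> j \<le> k then count_list (F r cc) (c, n - i, k - j) else 0" for i r]
    sum_sfx[of "\<lambda>i r. \<Sum>j\<in>{1..length cols}. if i \<le> n \<and> j \<le> k then count_list (F r (cols ! (length cols - j))) (c, n - i, k - j) else 0"] ..

lemma sum_one_le: "finite A \<Longrightarrow> (\<And>x y. x \<in> A \<Longrightarrow> y \<in> A \<Longrightarrow> P x \<Longrightarrow> P y \<Longrightarrow> x = y) \<Longrightarrow>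
   (\<Sum>x\<in>A. if P x then c else 0) \<le> (c :: nat)"
proof -
  assume A: "finite A" "\<And>x y. x \<in> A \<Longrightarrow> y \<in> A \<Longrightarrow> P x \<Longrightarrow> P y \<Longrightarrow> x = y"
  have "(\<Sum>x\<in>A. if P x then c else 0) = c * card {x \<in> A. P x}"
    using A(1) by (simp add: sum.If_cases Int_def conj_commute)
  moreover have "card {x \<in> A. P x} \<le> 1"
    using A by (intro card_le_Suc0_iff_eq[THEN iffD2, unfolded One_nat_def[symmetric]]) auto
  ultimately show ?thesis by (metis mult.right_neutral mult_le_mono2)
qed

text \<open>For given offsets there is at most one cell from which the position
  \<open>(n, k)\<close> is referred to.\<close>

lemma sum_cells_le:
  "(\<Sum>i\<in>{1..H :: nat}. \<Sum>j\<in>{1..W :: nat}. if i \<le> n \<and> j \<le> k \<and> a = n - i \<and> b = k - j then c else 0) \<le> (c :: nat)"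
proof -
  have "(\<Sum>i\<in>{1..H}. \<Sum>j\<in>{1..W}. if i \<le> n \<and> j \<le> k \<and> a = n - i \<and> b = k - j then c else 0)
     \<le> (\<Sum>i\<in>{1..H}. if i \<le> n \<and> a = n - i then c else 0)"
  proof (rule sum_mono)
    fix i assume "i \<in> {1..H}"
    have "(\<Sum>j\<in>{1..W}. if j \<le> k \<and> b = k - j then if i \<le> n \<and> a = n - i then c else 0 else 0) \<le> (if i \<le> n \<and> a = n - i then c else 0)"
      by (rule sum_one_le) auto
    moreover have "(if i \<le> n \<and> j \<le> k \<and> a = n - i \<and> b = k - j then c else 0) =
       (if j \<le> k \<and> b = k - j then if i \<le> n \<and> a = n - i then c else 0 else 0)" for j by simp
    ultimately show "(\<Sum>j\<in>{1..W}. if i \<le> n \<and> j \<le> k \<and> a = n - i \<and> b = k - j then c else 0) \<le> (if i \<le> n \<and> a = n - i then c else 0)"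
      by (simp only:)
  qed
  also have "\<dots> \<le> c" by (rule sum_one_le) auto
  finally show ?thesis .
qed

lemma sum_sum_list_swap: "(\<Sum>i\<in>A. \<Sum>x\<leftarrow>xs. f i x) = (\<Sum>x\<leftarrow>xs. \<Sum>i\<in>A. f i x :: nat)"
  by (induction xs) (simp_all add: sum.distrib)

lemma count_seq_var:
  assumes "distinct tgs"
  shows "count_list (body_seq (tmpl M tgs rl) rows cols) (nm (cV v) n k) \<le> 3"
proof -
  have "count_list (body_seq (tmpl M tgs rl) rows cols) (nm (cV v) n k) \<le>
    (\<Sum>i\<in>{1..length rows}. \<Sum>j\<in>{1..length cols}. if i \<le> n \<and> j \<le> k \<and> 0 = n - i \<and> 0 = k - j then 3 else 0)"
    unfolding count_body_seq
  proof (intro sum_mono)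
    fix i j
    show "(if i \<le> n \<and> j \<le> k then count_list (tmpl M tgs rl (rows ! (length rows - i)) (cols ! (length cols - j)))
        (cV v, n - i, k - j) else 0)
      \<le> (if i \<le> n \<and> j \<le> k \<and> 0 = n - i \<and> 0 = k - j then 3 else 0 :: nat)"
      using count_tmpl_var[OF assms, of M rl "rows ! (length rows - i)" "cols ! (length cols - j)" v "n - i" "k - j"]
      by (auto split: if_splits)
  qed
  also have "\<dots> \<le> 3" by (rule sum_cells_le)
  finally show ?thesis .
qed

text \<open>The letter of a clause is met at most once for each of its literals, as a literal
  determines the cell by its offsets and the segment by its tag. Each time it is doubled, hence
  \<open>2 * 3\<close>.\<close>

lemma count_seq_le:
  assumes "distinct rl" "distinct tgs"
  shows "count_list (body_seq (tmpl M tgs rl) rows cols) a \<le> 6"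
proof (cases "\<exists>c n k. a = nm c n k \<and> c \<in> range cV \<union> range cR")
  case False
  have "a \<notin> set (body_seq (tmpl M tgs rl) rows cols)"
  proof
    assume "a \<in> set (body_seq (tmpl M tgs rl) rows cols)"
    then obtain r c x where "a = inst (length r) (length c) x" "x \<in> set (tmpl M tgs rl (hd r) (hd c))"
      by (auto simp: body_seq_def)
    moreover obtain e p z where x: "x = (e, p, z)" by (metis prod_cases3)
    ultimately have "a = nm e (length r + p) (length c + z)" "(e, p, z) \<in> set (tmpl M tgs rl (hd r) (hd c))"
      by (auto simp: inst_def)
    moreover from this(2) have "e \<in> range cV \<union> range cR"
      by (auto simp: tmpl_def titem_def set_emit split: if_splits)
    ultimately show False using False by blast
  qed
  then show ?thesis by (simp add: count_notin)
next
  case True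
  then obtain c n k where a: "a = nm c n k" "c \<in> range cV \<union> range cR" by blast
  let ?H = "{1..length rows}" and ?W = "{1..length cols}"
  let ?F = "\<lambda>i j. tmpl M tgs rl (rows ! (length rows - i)) (cols ! (length cols - j))"
  from a(2) show ?thesis
  proof
    assume "c \<in> range cV"
    then obtain v where c: "c = cV v" by blast
    then show ?thesis using count_seq_var[OF assms(2), of M rl rows cols v n k] by (simp add: a)
  next
    assume "c \<in> range cR"
    then obtain r where c: "c = cR r" by blast
    let ?g = "\<lambda>i j. \<lambda>(sg', v', a', b', g). if i \<le> n \<and> j \<le> k \<and> a' = n - i \<and> b' = k - j then 2 else 0 :: nat"
    have "count_list (body_seq (tmpl M tgs rl) rows cols) a \<le> (\<Sum>i\<in>?H. \<Sum>j\<in>?W. \<Sum>l\<leftarrow>lits M r. ?g i j l)"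
      unfolding a c count_body_seq
    proof (intro sum_mono)
      fix i j
      have "2 * (\<Sum>(sg', v', a', b', g)\<leftarrow>lits M r. of_bool (a' = n - i \<and> b' = k - j)) = (\<Sum>l\<leftarrow>lits M r. ?g i j l)"
        if "i \<le> n" "j \<le> k"
        unfolding sum_list_const_mult[symmetric]
        by (rule arg_cong[of _ _ sum_list], rule map_cong[OF refl]) (use that in \<open>auto simp: of_bool_def split: prod.splits\<close>)
      note eq = this
      show "(if i \<le> n \<and> j \<le> k then count_list (?F i j) (cR r, n - i, k - j) else 0) \<le> (\<Sum>l\<leftarrow>lits M r. ?g i j l)"
      proof (cases "i \<le> n \<and> j \<le> k")
        case True
        then show ?thesis unfolding if_P[OF True] eq[OF True[THEN conjunct1] True[THEN conjunct2], symmetric]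
          by (intro count_tmpl_rule assms)
      qed (simp only: if_False le0)
    qed
    also have "\<dots> = (\<Sum>l\<leftarrow>lits M r. \<Sum>i\<in>?H. \<Sum>j\<in>?W. ?g i j l)"
      by (simp only: sum_sum_list_swap)
    also have "\<dots> \<le> (\<Sum>l\<leftarrow>lits M r. 2)"
    proof (rule sum_list_mono)
      fix l :: lit
      obtain sg v a' b' g where l: "l = (sg, v, a', b', g)" by (metis prod_cases5)
      show "(\<Sum>i\<in>?H. \<Sum>j\<in>?W. ?g i j l) \<le> 2" unfolding l prod.case by (rule sum_cells_le)
    qed
    also have "\<dots> \<le> 6" using length_lits[of M r] by (simp add: sum_list_triv)
    finally show ?thesis .
  qed
qed

section \<open>The sequence as a list of segments\<close>

definition seq_items :: "tm \<Rightarrow> tag list \<Rightarrow> rule list \<Rightarrow> nat list \<Rightarrow> nat list \<Rightarrow> letter item list" where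
  "seq_items M tgs rl rows cols = concat (map (\<lambda>r. concat (map (\<lambda>c.
     map (\<lambda>v. mi (inst (length r) (length c)) (titem M rl (hd r) (hd c) v)) tgs) (sfx cols))) (sfx rows))"

lemma seg_items: "concat (map seg (seq_items M tgs rl rows cols)) = body_seq (tmpl M tgs rl) rows cols"
proof -
  have c: "concat (map h (concat (map g xs))) = concat (map (\<lambda>x. concat (map h (g x))) xs)"
    for h :: "'x \<Rightarrow> 'y list" and g :: "'z \<Rightarrow> 'x list" and xs
    by (induction xs) auto
  have t: "concat (map seg (map (\<lambda>v. mi f (titem M rl rc cc v)) tgs)) = map f (tmpl M tgs rl rc cc)" for f rc cc
    by (simp add: tmpl_def map_concat comp_def seg_mi)
  show ?thesis unfolding seq_items_def body_seq_def c t ..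
qed

text \<open>This yields distinctness of the variables by counting: the variable of two segments
  would occur at least six times, against at most three by \<open>count_seq_var\<close>.\<close>

lemma count_var_seg: "3 * count_list (concat (map var its)) a \<le> count_list (concat (map seg its)) a"
proof (induction its)
  case (Cons i its)
  have "3 * count_list (var i) a \<le> count_list (seg i) a"
    by (cases i rule: seg.cases) (auto simp: count_dbl)
  with Cons show ?case by simp
qed simp

lemma distinct_count: "(\<And>a. count_list xs a \<le> 1) \<Longrightarrow> distinct xs"
proof (induction xs)
  case (Cons x xs)
  have "count_list xs x = 0" using Cons.prems[of x] by simp
  moreover have "count_list xs a \<le> 1" for a using Cons.prems[of a] by (simp split: if_splits)
  ultimately show ?case using Cons.IH by (simp add: count_list_0_iff)
qed simp

lemma inst_0: "inst i j (c, 0, 0) = nm c i j"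
  by (simp add: inst_def)

section \<open>Positions in the diagram and the names of letters\<close>

context tableau
begin

definition rows :: "nat list" where
  "rows = [1, 2] @ replicate (T - 1) 3 @ [4, 1]"

text \<open>Adding 3 turns the code 3 or 4 of the first input cell into 6 or 7, which marks the
  initial position of the heads.\<close>

definition inp :: "nat list" where
  "inp = (let ws = map (\<lambda>b. if b then 4 else 3) (enc_word x) in (hd ws + 3) # tl ws)"

definition cols :: "nat list" where
  "cols = [1, 1] @ replicate B 2 @ inp @ replicate q 5 @ replicate B 2 @ [1, 1]"

text \<open>\<open>rho\<close> and \<open>kap\<close> give the lengths of the suffixes of
  \<open>rows\<close> and \<open>cols\<close> that begin at row \<open>t\<close> and at column
  \<open>i\<close>; these lists begin with row -1 and column \<open>- int B - 2\<close>.\<close>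

definition rho :: "int \<Rightarrow> nat" where
  "rho t = nat (int T + 2 - t)"

definition kap :: "int \<Rightarrow> nat" where
  "kap i = nat (int (m + q + B + 2) - i)"

lemma enc_word_ne: "enc_word x \<noteq> []"
  by (cases x) auto

lemma length_inp: "length inp = m"
  using enc_word_ne by (simp add: inp_def Let_def)

lemma nth_inp:
  assumes "p < m"
  shows "inp ! p = ccode (int p)"
proof -
  have i: "inp ! p = (if enc_word x ! p then 4 else 3) + (if p = 0 then 3 else 0)"
    using assms enc_word_ne by (cases p) (auto simp: inp_def Let_def nth_tl hd_map hd_conv_nth)
  have h: "\<not> (int p < - int B \<or> int (m + q + B) \<le> int p)" "\<not> (int p < 0 \<or> int (m + q) \<le> int p)" "\<not> int m \<le> int p"
    using assms by linarith+
  show ?thesis unfolding ccode_def i if_not_P[OF h(1)] if_not_P[OF h(2)] if_not_P[OF h(3)] nat_int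
    by (cases "p = 0") simp_all
qed

lemma length_cols: "length cols = m + q + 2 * B + 4"
  by (simp add: cols_def length_inp)

lemma length_rows: "0 < T \<Longrightarrow> length rows = T + 3"
  by (simp add: rows_def)

lemma nth_rows: "0 < T \<Longrightarrow> p < T + 3 \<Longrightarrow> rows ! p = rcode (int p - 1)"
  by (auto simp: rows_def rcode_def nth_append nth_Cons split: nat.split)

lemma nth_cols:
  assumes "p < m + q + 2 * B + 4"
  shows "cols ! p = ccode (int p - int B - 2)"
proof -
  have c: "cols ! p = (if p < 2 then 1 else if p < B + 2 then 2 else if p < B + 2 + m then inp ! (p - (B + 2))
      else if p < B + 2 + m + q then 5 else if p < B + 2 + m + q + B then 2 else 1)"
    using assms by (auto simp: cols_def nth_append nth_Cons length_inp split: nat.split)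
  show ?thesis
  proof (cases "B + 2 \<le> p \<and> p < B + 2 + m")
    case True
    then have lt: "p - (B + 2) < m" and "int (p - (B + 2)) = int p - int B - 2" by linarith+
    then have "inp ! (p - (B + 2)) = ccode (int p - int B - 2)"
      using nth_inp[OF lt] by (simp only:)
    with True c show ?thesis by simp
  next
    case False
    have "0 < m" using enc_word_ne by simp
    then have "int p - int B - 2 \<noteq> 0" using False by linarith
    with False c show ?thesis by (auto simp: ccode_def)
  qed
qed

lemma row_suffixes:
  assumes "0 < T"
  shows "(\<lambda>r. (length r, hd r)) ` set (sfx rows) = (\<lambda>t. (rho t, rcode t)) ` {-1..int T + 1}"
  unfolding set_sfx length_rows[OF assms]
proof (intro equalityI subsetI)
  fix z assume "z \<in> (\<lambda>n. (n, rows ! (T + 3 - n))) ` {1..T + 3}"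
  then obtain n where n: "1 \<le> n" "n \<le> T + 3" "z = (n, rows ! (T + 3 - n))" by auto
  have "z = (rho (int T + 2 - int n), rcode (int T + 2 - int n))"
    using n nth_rows[OF assms, of "T + 3 - n"] by (simp add: rho_def of_nat_diff algebra_simps)
  then show "z \<in> (\<lambda>t. (rho t, rcode t)) ` {-1..int T + 1}"
    by (rule image_eqI) (use n in auto)
next
  fix z assume "z \<in> (\<lambda>t. (rho t, rcode t)) ` {-1..int T + 1}"
  then obtain t where t: "-1 \<le> t" "t \<le> int T + 1" "z = (rho t, rcode t)" by auto
  have "z = (rho t, rows ! (T + 3 - rho t))"
    using t nth_rows[OF assms, of "T + 3 - rho t"] by (simp add: rho_def of_nat_diff algebra_simps)
  then show "z \<in> (\<lambda>n. (n, rows ! (T + 3 - n))) ` {1..T + 3}"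
    by (rule image_eqI) (use t in \<open>auto simp: rho_def\<close>)
qed

lemma col_suffixes:
  "(\<lambda>r. (length r, hd r)) ` set (sfx cols) = (\<lambda>i. (kap i, ccode i)) ` {- int B - 2..int (m + q + B) + 1}"
  unfolding set_sfx length_cols
proof (intro equalityI subsetI)
  let ?W = "m + q + 2 * B + 4"
  fix z assume "z \<in> (\<lambda>n. (n, cols ! (?W - n))) ` {1..?W}"
  then obtain n where n: "1 \<le> n" "n \<le> ?W" "z = (n, cols ! (?W - n))" by auto
  have "z = (kap (int (m + q + B + 2) - int n), ccode (int (m + q + B + 2) - int n))"
    using n nth_cols[of "?W - n"] by (simp add: kap_def of_nat_diff algebra_simps)
  then show "z \<in> (\<lambda>i. (kap i, ccode i)) ` {- int B - 2..int (m + q + B) + 1}"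
    by (rule image_eqI) (use n in auto)
next
  let ?W = "m + q + 2 * B + 4"
  fix z assume "z \<in> (\<lambda>i. (kap i, ccode i)) ` {- int B - 2..int (m + q + B) + 1}"
  then obtain i where i: "- int B - 2 \<le> i" "i \<le> int (m + q + B) + 1" "z = (kap i, ccode i)" by auto
  have k: "1 \<le> kap i" "kap i \<le> ?W" "int (?W - kap i) = i + int B + 2" using i by (auto simp: kap_def)
  have "z = (kap i, cols ! (?W - kap i))"
    using i(3) nth_cols[of "?W - kap i"] k by simp
  then show "z \<in> (\<lambda>n. (n, cols ! (?W - n))) ` {1..?W}"
    by (rule image_eqI) (use k in auto)
qed

context
  fixes tgs :: "tag list" and rl :: "rule list"
  assumes tgs: "set tgs = tags M" "distinct tgs" and rl: "set rl = rules M" "distinct rl" and T0: "0 < T"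
begin

abbreviation "its \<equiv> seq_items M tgs rl rows cols"

definition place :: "int \<Rightarrow> int \<Rightarrow> tag \<Rightarrow> letter item" where
  "place t i v = mi (inst (rho t) (kap i)) (titem M rl (rcode t) (ccode i) v)"

lemma set_its: "set its = {place t i v |t i v. inrange t i \<and> v \<in> tags M}"
proof -
  have "set its = (\<Union>(a, b)\<in>(\<lambda>r. (length r, hd r)) ` set (sfx rows).
     \<Union>(c, d)\<in>(\<lambda>r. (length r, hd r)) ` set (sfx cols). (\<lambda>v. mi (inst a c) (titem M rl b d v)) ` tags M)"
    by (simp add: seq_items_def tgs)
  also have "\<dots> = (\<Union>t\<in>{-1..int T + 1}. \<Union>i\<in>{- int B - 2..int (m + q + B) + 1}. place t i ` tags M)"
    unfolding row_suffixes[OF T0] col_suffixes by (simp add: place_def)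
  also have "\<dots> = {place t i v |t i v. inrange t i \<and> v \<in> tags M}"
  proof -
    have "inrange t i \<longleftrightarrow> t \<in> {-1..int T + 1} \<and> i \<in> {- int B - 2..int (m + q + B) + 1}" for t i
      by (auto simp: inrange_def)
    then show ?thesis by blast
  qed
  finally show ?thesis .
qed

text \<open>The constant for the column exceeds that of \<open>kap\<close> by 1, which absorbs the
  -1 in the column of a literal.\<close>

definition cname :: "rule \<Rightarrow> int \<Rightarrow> int \<Rightarrow> letter" where
  "cname r t i = nm (cR r) (nat (int T + 2 - t)) (nat (int (m + q + B + 3) - i))"

lemma cname_place:
  assumes "inrange t i"
  shows "inst (rho t) (kap i) (cR r, a, b) = cname r (t - int a) (i - (int b - 1))"
  using assms by (auto simp: inst_def cname_def rho_def kap_def inrange_def)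

lemma clauses_place:
  assumes "inrange t i"
  shows "c \<in> clauses (place t i v) \<longleftrightarrow> (\<exists>r\<in>rules M. \<exists>sg a b g. (sg, v, a, b, g) \<in> set (lits M r) \<and>
     g (rcode t) (ccode i) \<and> c = cname r (t - int a) (i - (int b - 1)))"
proof -
  have "c \<in> clauses (place t i v) \<longleftrightarrow>
    (\<exists>sg. \<exists>e\<in>set (emit M rl sg v (rcode t) (ccode i)). c = inst (rho t) (kap i) e)"
    by (auto simp: place_def mi_def titem_def ex_bool_eq)
  also have "\<dots> \<longleftrightarrow> (\<exists>sg x a b. (x, a, b) \<in> set (emit M rl sg v (rcode t) (ccode i)) \<and> c = inst (rho t) (kap i) (x, a, b))"
    by auto
  also have "\<dots> \<longleftrightarrow> (\<exists>r\<in>rules M. \<exists>sg a b g. (sg, v, a, b, g) \<in> set (lits M r) \<and>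
     g (rcode t) (ccode i) \<and> c = cname r (t - int a) (i - (int b - 1)))"
    unfolding set_emit rl cname_place[OF assms, symmetric] by blast
  finally show ?thesis .
qed

lemma holds_place:
  assumes "inrange t i"
  shows "c \<in> holds_in \<sigma> (place t i v) \<longleftrightarrow> (\<exists>r\<in>rules M. \<exists>sg a b g. (sg, v, a, b, g) \<in> set (lits M r) \<and>
     g (rcode t) (ccode i) \<and> (inner t i \<longrightarrow> \<sigma> (nm (cV v) (rho t) (kap i)) = sg) \<and> c = cname r (t - int a) (i - (int b - 1)))"
proof -
  have "c \<in> holds_in \<sigma> (place t i v) \<longleftrightarrow>
    (\<exists>sg. (inner t i \<longrightarrow> \<sigma> (nm (cV v) (rho t) (kap i)) = sg) \<and> (\<exists>e\<in>set (emit M rl sg v (rcode t) (ccode i)). c = inst (rho t) (kap i) e))"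
    unfolding place_def mi_def titem_def inner_code
    by (auto simp: ex_bool_eq inst_0)
  also have "\<dots> \<longleftrightarrow> (\<exists>sg x a b. (inner t i \<longrightarrow> \<sigma> (nm (cV v) (rho t) (kap i)) = sg) \<and>
      (x, a, b) \<in> set (emit M rl sg v (rcode t) (ccode i)) \<and> c = inst (rho t) (kap i) (x, a, b))"
    by auto
  also have "\<dots> \<longleftrightarrow> (\<exists>r\<in>rules M. \<exists>sg a b g. (sg, v, a, b, g) \<in> set (lits M r) \<and>
     g (rcode t) (ccode i) \<and> (inner t i \<longrightarrow> \<sigma> (nm (cV v) (rho t) (kap i)) = sg) \<and> c = cname r (t - int a) (i - (int b - 1)))"
    unfolding set_emit rl cname_place[OF assms, symmetric] by blast
  finally show ?thesis .
qed

definition named :: "(letter \<Rightarrow> bool) \<Rightarrow> tag \<Rightarrow> int \<Rightarrow> int \<Rightarrow> bool" where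
  "named \<sigma> v t i = \<sigma> (nm (cV v) (rho t) (kap i))"

lemma clause_union: "c \<in> (\<Union>j\<in>set its. clauses j) \<longleftrightarrow> (\<exists>r\<in>rules M. \<exists>t i l. lit_at r t i l \<and> c = cname r t i)"
proof
  assume "c \<in> (\<Union>j\<in>set its. clauses j)"
  then obtain t i v where p: "inrange t i" "c \<in> clauses (place t i v)" unfolding set_its by blast
  from p(2)[unfolded clauses_place[OF p(1)]] obtain r sg a b g where
    l: "r \<in> rules M" "(sg, v, a, b, g) \<in> set (lits M r)" "g (rcode t) (ccode i)" "c = cname r (t - int a) (i - (int b - 1))"
    by blast
  have "lit_at r (t - int a) (i - (int b - 1)) (sg, v, a, b, g)" using l p(1) by (simp add: lit_at_def)
  with l show "\<exists>r\<in>rules M. \<exists>t i l. lit_at r t i l \<and> c = cname r t i" by blast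
next
  assume "\<exists>r\<in>rules M. \<exists>t i l. lit_at r t i l \<and> c = cname r t i"
  then obtain r t i l where r: "r \<in> rules M" "lit_at r t i l" "c = cname r t i" by blast
  obtain sg v a b g where ll: "l = (sg, v, a, b, g)" by (metis prod_cases5)
  with r(2) have l: "(sg, v, a, b, g) \<in> set (lits M r)" "inrange (t + int a) (i + (int b - 1))"
    "g (rcode (t + int a)) (ccode (i + (int b - 1)))" by (simp_all add: lit_at_def)
  have "v \<in> tags M" using lits_ok[OF M r(1) l(1)] by blast
  moreover have "c \<in> clauses (place (t + int a) (i + (int b - 1)) v)"
    unfolding clauses_place[OF l(2)] using r(1,3) l
    by (intro bexI[of _ r] exI[of _ sg] exI[of _ a] exI[of _ b] exI[of _ g]) simp_all
  ultimately show "c \<in> (\<Union>j\<in>set its. clauses j)" unfolding set_its using l(2) by blast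
qed

lemma holds_union: "c \<in> (\<Union>j\<in>set its. holds_in \<sigma> j) \<longleftrightarrow>
   (\<exists>r\<in>rules M. \<exists>t i l. lit_at r t i l \<and> lit_true (named \<sigma>) t i l \<and> c = cname r t i)"
proof
  assume "c \<in> (\<Union>j\<in>set its. holds_in \<sigma> j)"
  then obtain t i v where p: "inrange t i" "c \<in> holds_in \<sigma> (place t i v)" unfolding set_its by blast
  from p(2)[unfolded holds_place[OF p(1)]] obtain r sg a b g where
    l: "r \<in> rules M" "(sg, v, a, b, g) \<in> set (lits M r)" "g (rcode t) (ccode i)" "c = cname r (t - int a) (i - (int b - 1))"
      "inner t i \<longrightarrow> \<sigma> (nm (cV v) (rho t) (kap i)) = sg"
    by blast
  have "lit_at r (t - int a) (i - (int b - 1)) (sg, v, a, b, g)" using l p(1) by (simp add: lit_at_def)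
  moreover have "lit_true (named \<sigma>) (t - int a) (i - (int b - 1)) (sg, v, a, b, g)"
    using l(5) by (simp add: lit_true_def named_def)
  ultimately show "\<exists>r\<in>rules M. \<exists>t i l. lit_at r t i l \<and> lit_true (named \<sigma>) t i l \<and> c = cname r t i" using l by blast
next
  assume "\<exists>r\<in>rules M. \<exists>t i l. lit_at r t i l \<and> lit_true (named \<sigma>) t i l \<and> c = cname r t i"
  then obtain r t i l where r: "r \<in> rules M" "lit_at r t i l" "lit_true (named \<sigma>) t i l" "c = cname r t i" by blast
  obtain sg v a b g where ll: "l = (sg, v, a, b, g)" by (metis prod_cases5)
  with r(2) have l: "(sg, v, a, b, g) \<in> set (lits M r)" "inrange (t + int a) (i + (int b - 1))"
    "g (rcode (t + int a)) (ccode (i + (int b - 1)))" by (simp_all add: lit_at_def)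
  have "v \<in> tags M" using lits_ok[OF M r(1) l(1)] by blast
  moreover have "c \<in> holds_in \<sigma> (place (t + int a) (i + (int b - 1)) v)"
    unfolding holds_place[OF l(2)] using r(1,4) l r(3)[unfolded ll]
    by (intro bexI[of _ r] exI[of _ sg] exI[of _ a] exI[of _ b] exI[of _ g]) (simp_all add: lit_true_def named_def)
  ultimately show "c \<in> (\<Union>j\<in>set its. holds_in \<sigma> j)" unfolding set_its using l(2) by blast
qed

lemma lit_at_range:
  assumes "r \<in> rules M" "lit_at r t i l"
  shows "t \<le> int T + 1" "i \<le> int (m + q + B + 2)"
proof -
  obtain sg v a b g where ll: "l = (sg, v, a, b, g)" by (metis prod_cases5)
  with assms(2) have "inrange (t + int a) (i + (int b - 1))" by (simp add: lit_at_def)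
  then show "t \<le> int T + 1" "i \<le> int (m + q + B + 2)" by (auto simp: inrange_def)
qed

text \<open>\<open>nat\<close> truncates, so injectivity depends on the clauses having a literal in
  range; this keeps both coordinates positive.\<close>

lemma cname_inject:
  assumes "r \<in> rules M" "lit_at r t i l" "r' \<in> rules M" "lit_at r' t' i' l'" "cname r t i = cname r' t' i'"
  shows "r = r' \<and> t = t' \<and> i = i'"
  using lit_at_range[OF assms(1,2)] lit_at_range[OF assms(3,4)] assms(5)
  by (auto simp: cname_def)

lemma satisfies_iff: "satisfies \<sigma> its \<longleftrightarrow> consistent (named \<sigma>)"
proof
  assume s: "satisfies \<sigma> its"
  show "consistent (named \<sigma>)" unfolding consistent_def
  proof (intro ballI allI impI)
    fix r t i assume r: "r \<in> rules M" and "\<exists>l. lit_at r t i l"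
    then obtain l where l: "lit_at r t i l" by blast
    have "cname r t i \<in> (\<Union>j\<in>set its. clauses j)" unfolding clause_union using r l by blast
    then have "cname r t i \<in> (\<Union>j\<in>set its. holds_in \<sigma> j)" using s unfolding satisfies_def by (rule subsetD[rotated])
    then obtain r' t' i' l' where h: "r' \<in> rules M" "lit_at r' t' i' l'" "lit_true (named \<sigma>) t' i' l'" "cname r t i = cname r' t' i'"
      unfolding holds_union by blast
    from cname_inject[OF r l h(1,2,4)] h(2,3) show "\<exists>l. lit_at r t i l \<and> lit_true (named \<sigma>) t i l" by blast
  qed
next
  assume c: "consistent (named \<sigma>)"
  show "satisfies \<sigma> its" unfolding satisfies_def
  proof
    fix z assume "z \<in> (\<Union>j\<in>set its. clauses j)"
    then obtain r t i l where r: "r \<in> rules M" "lit_at r t i l" "z = cname r t i" unfolding clause_union by blast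
    with c obtain l' where "lit_at r t i l'" "lit_true (named \<sigma>) t i l'" unfolding consistent_def by blast
    with r show "z \<in> (\<Union>j\<in>set its. holds_in \<sigma> j)" unfolding holds_union by blast
  qed
qed

text \<open>Only values at interior positions matter, and there a name determines its tag and
  position.\<close>

lemma consistent_named:
  assumes "consistent s"
  shows "\<exists>\<sigma>. consistent (named \<sigma>)"
proof
  let ?\<sigma> = "\<lambda>a. \<exists>v t i. a = nm (cV v) (rho t) (kap i) \<and> inrange t i \<and> s v t i"
  have e: "named ?\<sigma> v t i = s v t i" if "inner t i" for v t i
  proof -
    have r: "inrange t i" using that by (rule inner_inrange)
    have "t = t' \<and> i = i'" if "rho t = rho t'" "kap i = kap i'" "inrange t' i'" for t' i'
      using that r by (auto simp: rho_def kap_def inrange_def)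
    then have "s v t i" if "nm (cV v) (rho t) (kap i) = nm (cV v') (rho t') (kap i')" "inrange t' i'" "s v' t' i'" for v' t' i'
      using that by auto
    with r show ?thesis unfolding named_def by blast
  qed
  have "lit_true (named ?\<sigma>) t i l" if "lit_true s t i l" for t i l
  proof -
    obtain sg v a b g where "l = (sg, v, a, b, g)" by (metis prod_cases5)
    with that e show ?thesis by (simp add: lit_true_def)
  qed
  with assms show "consistent (named ?\<sigma>)" unfolding consistent_def by blast
qed

text \<open>The empty word is the fresh letter, as no \<open>nm\<close> is empty.\<close>

definition S :: "nat \<Rightarrow> letter list" where
  "S d = body_seq (tmpl M tgs rl) rows cols @ replicate d []"

lemma var_place:
  assumes "a \<in> set (var (place t i v))"
  shows "a = nm (cV v) (rho t) (kap i)"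
proof (cases "rcode t = 1 \<or> ccode i = 1")
  case True
  then have "var (place t i v) = []" by (simp add: place_def mi_def titem_def)
  with assms show ?thesis by simp
next
  case False
  then have "var (place t i v) = [nm (cV v) (rho t) (kap i)]" by (simp add: place_def mi_def titem_def inst_0)
  with assms show ?thesis by simp
qed

lemma clause_name: "a \<in> clauses (place t i v) \<Longrightarrow> inrange t i \<Longrightarrow> \<exists>r n k. a = nm (cR r) n k"
proof -
  assume a: "a \<in> clauses (place t i v)" and r: "inrange t i"
  from a[unfolded clauses_place[OF r] cname_def] show ?thesis by blast
qed

lemma distinct_vars: "distinct (concat (map var its))"
proof (rule distinct_count)
  fix a
  show "count_list (concat (map var its)) a \<le> 1"
  proof (cases "a \<in> set (concat (map var its))")
    case True
    then obtain j where "j \<in> set its" "a \<in> set (var j)" by auto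
    then obtain t i v where "a = nm (cV v) (rho t) (kap i)" unfolding set_its using var_place by blast
    then have "count_list (concat (map seg its)) a \<le> 3"
      unfolding seg_items using count_seq_var[OF tgs(2)] by simp
    with count_var_seg[of its a] show ?thesis by linarith
  next
    case False
    then show ?thesis by (simp only: count_list_0_iff[THEN iffD2, OF False] zero_le_one)
  qed
qed

lemma LLDS_iff:
  assumes "2 \<le> d"
  shows "LLDS_plus (set (S d)) (S d) 0 \<longleftrightarrow> (\<exists>s. consistent s)"
proof
  assume L: "LLDS_plus (set (S d)) (S d) 0"
  have "\<exists>\<sigma>. satisfies \<sigma> its"
  proof (rule LLDS_imp_satisfies[OF L[unfolded S_def seg_items[symmetric]] distinct_vars])
    fix i j v assume i: "i \<in> set its" "j \<in> set its" "v \<in> set (var i)"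
    obtain t p w where "i = place t p w" using i(1) unfolding set_its by blast
    then have v: "v = nm (cV w) (rho t) (kap p)" using i(3) var_place by simp
    obtain t' p' w' where j: "j = place t' p' w'" "inrange t' p'" using i(2) unfolding set_its by blast
    show "v \<notin> clauses j"
    proof
      assume "v \<in> clauses j"
      then obtain r n k where "v = nm (cR r) n k" using clause_name j by blast
      with v show False by simp
    qed
  next
    fix i assume i: "i \<in> set its"
    obtain t p w where p: "i = place t p w" "inrange t p" using i unfolding set_its by blast
    have "[] \<notin> set (var i)" using var_place[of "[]" t p w] nm_Nil[symmetric] unfolding p by blast
    moreover have "[] \<notin> clauses i" using clause_name[of "[]" t p w] nm_Nil[symmetric] p by blast
    ultimately show "[] \<notin> set (var i) \<union> clauses i" by blast
  qed
  then show "\<exists>s. consistent s" unfolding satisfies_iff by blast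
next
  assume "\<exists>s. consistent s"
  then obtain \<sigma> where "satisfies \<sigma> its" unfolding satisfies_iff using consistent_named by blast
  from satisfies_imp_LLDS[OF this assms] show "LLDS_plus (set (S d)) (S d) 0"
    unfolding S_def seg_items .
qed

lemma max_occ:
  assumes "6 \<le> d"
  shows "max_occurrences (set (S d)) (S d) d"
proof -
  have n: "[] \<notin> set (body_seq (tmpl M tgs rl) rows cols)"
    by (auto simp: body_seq_def inst_def nm_Nil[symmetric] simp del: nm_Nil)
  have r: "count_list (replicate d x) a = (if a = x then d else 0)" for a x :: letter by (induction d) auto
  have "count_list (S d) a \<le> d" for a
  proof (cases "a = []")
    case True
    then show ?thesis by (simp add: S_def count_notin[OF n] r)
  next
    case False
    then show ?thesis using count_seq_le[OF rl(2) tgs(2), of M rows cols a] assms by (simp add: S_def r)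
  qed
  moreover have "[] \<in> set (S d)" "count_list (S d) [] = d"
    using assms by (auto simp: S_def count_notin[OF n] r)
  ultimately show ?thesis unfolding max_occurrences_def by blast
qed

text \<open>A word contains no blank and is followed by blanks only, so two cells decide.\<close>

lemma word_content_True: "w = [True] \<longleftrightarrow> word_content w 0 = 2 \<and> word_content w 1 = 0"
proof (cases w)
  case (Cons b w')
  then show ?thesis by (cases w') (auto simp: word_content_def)
qed (simp add: word_content_def)

lemma conf_halted:
  assumes "conf w t = (states M, ts)" "t \<le> t'"
  shows "conf w t' = (states M, ts)"
  using assms(2) by (induction rule: dec_induct) (simp_all add: assms(1) conf_Suc)

lemma instance_iff:
  assumes d: "2 \<le> d" and f: "computes_in_time M f p"
    and p: "\<And>n. n \<le> m + q \<Longrightarrow> p n \<le> T"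
  shows "LLDS_plus (set (S d)) (S d) 0 \<longleftrightarrow> (\<exists>u. length u \<le> q \<and> f (enc_pair x u) = [True])"
proof -
  have out: "fst (snd (conf (enc_pair x u) T) ! 1) = word_content (f (enc_pair x u))" if "length u \<le> q" for u
  proof -
    obtain t ts where t: "t \<le> p (length (enc_pair x u))" "(Defs.step M ^^ t) (init_config M (enc_pair x u)) = (states M, ts)"
      "fst (ts ! 1) = word_content (f (enc_pair x u))" using f unfolding computes_in_time_def by blast
    have "p (length (enc_pair x u)) \<le> T" using that by (intro p) (simp add: enc_pair_def)
    with t(1) have "t \<le> T" by simp
    with t(2,3) show ?thesis using conf_halted[of "enc_pair x u" t ts T] by (simp add: conf_def)
  qed
  show ?thesis unfolding LLDS_iff[OF d]
  proof
    assume "\<exists>s. consistent s"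
    then obtain s where "consistent s" by blast
    from sound[OF this T0] obtain u where u: "length u \<le> q" "fst (snd (conf (enc_pair x u) T) ! 1) 0 = 2"
      "fst (snd (conf (enc_pair x u) T) ! 1) 1 = 0" unfolding enc_pair_def by blast
    have "f (enc_pair x u) = [True]" using u(2,3) unfolding out[OF u(1)] word_content_True by (rule conjI)
    with u(1) show "\<exists>u. length u \<le> q \<and> f (enc_pair x u) = [True]" by blast
  next
    assume "\<exists>u. length u \<le> q \<and> f (enc_pair x u) = [True]"
    then obtain u where u: "length u \<le> q" "f (enc_pair x u) = [True]" by blast
    have "fst (snd (conf (enc_word x @ u) T) ! 1) = word_content [True]"
      using out[OF u(1), unfolded u(2)] unfolding enc_pair_def .
    from complete[OF u(1) this T0] show "\<exists>s. consistent s" by blast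
  qed
qed

end

end

section \<open>The reduction\<close>

lemma exec_For_push:
  assumes "\<And>s. exec c s = s(r := ws @ s r)" "q \<noteq> r"
  shows "exec (For q c) s = s(r := concat (replicate (length (s q)) ws) @ s r)"
proof -
  let ?S = "\<lambda>zs. s(r := concat (replicate (length zs) ws) @ s r)"
  have c: "ws @ concat (replicate n ws) = concat (replicate n ws) @ ws" for n
    by (induction n) auto
  have "exec (For q c) s = (?S (s q))(q := s q)"
  proof (rule exec_For)
    fix zs a ys
    show "exec c ((?S zs)(q := a # ys)) = (?S (zs @ [a]))(q := a # ys)"
      using assms(2) by (simp add: assms(1) fun_eq_iff replicate_append_same[symmetric] c)
  qed simp
  then show ?thesis using assms(2) by (simp add: fun_eq_iff)
qed

lemma concat_replicate_single: "concat (replicate n [a]) = replicate n a"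
  by (induction n) auto

text \<open>Horner's rule in unary: the value of the inner polynomial is left in register
  \<open>Suc r\<close>, and register \<open>r\<close> receives its product with the input length,
  plus \<open>a\<close>. The registers from \<open>lim\<close> on stay untouched.\<close>

lemma exec_poly:
  fixes p :: "nat poly"
  assumes "2 \<le> r"
  shows "\<exists>c lim. r < lim \<and> wfc c \<and> good c \<and> mods c \<subseteq> {r..<lim} \<and>
    (\<forall>s. (\<forall>i. r \<le> i \<longrightarrow> s i = []) \<longrightarrow> exec c s r = replicate (poly p (length (s 0))) 1)"
  using assms
proof (induction p arbitrary: r)
  case 0
  show ?case
    by (rule exI[of _ Skip], rule exI[of _ "Suc r"]) (auto intro: good_bnd[of "{}"])
next
  case (pCons a p)
  have "2 \<le> Suc r" using pCons.prems by simp
  from pCons.IH[OF this] obtain c lim where c: "Suc r < lim" "wfc c" "good c" "mods c \<subseteq> {Suc r..<lim}"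
    "\<And>s. (\<forall>i. Suc r \<le> i \<longrightarrow> s i = []) \<Longrightarrow> exec c s (Suc r) = replicate (poly p (length (s 0))) 1" by blast
  let ?l = "For (Suc r) (For 0 (Push r 1))"
  let ?a = "seqs (map (Push r) (replicate a 1))"
  let ?c = "Seq c (Seq ?l ?a)"
  have "wfc ?c" using c(2) pCons.prems by (auto simp: in_set_replicate)
  moreover have "good ?c"
    using pCons.prems by (intro good_Seq c(3) good_bnd[of "{0, Suc r}"]) (auto simp: in_set_replicate)
  moreover have "mods ?c \<subseteq> {r..<lim}" using c(1,4) by (auto simp: in_set_replicate)
  moreover have "exec ?c s r = replicate (poly (pCons a p) (length (s 0))) 1" if s: "\<forall>i. r \<le> i \<longrightarrow> s i = []" for s
  proof -
    let ?t = "exec c s"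
    have nm: "0 \<notin> mods c" "r \<notin> mods c" using c(4) by auto
    have t: "?t (Suc r) = replicate (poly p (length (s 0))) 1" "?t 0 = s 0" "?t r = []"
      using c(5)[of s] s exec_unmod[OF nm(1), of s] exec_unmod[OF nm(2), of s] by auto
    have i: "exec (For 0 (Push r 1)) s' = s'(r := replicate (length (s' 0)) 1 @ s' r)" for s'
      using exec_For_push[of "Push r 1" r "[1]" 0 s'] pCons.prems by (simp add: concat_replicate_single)
    define n where "n = length (s 0)"
    let ?S = "\<lambda>zs. ?t(r := replicate (length zs * n) 1)"
    have "exec ?l ?t = (?S (?t (Suc r)))(Suc r := ?t (Suc r))"
    proof (rule exec_For)
      show "(?S [])(Suc r := ?t (Suc r)) = ?t" using t by (simp add: fun_eq_iff)
      fix zs b ys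
      show "exec (For 0 (Push r 1)) ((?S zs)(Suc r := b # ys)) = (?S (zs @ [b]))(Suc r := b # ys)"
        unfolding i using pCons.prems t(2) by (simp add: fun_eq_iff n_def replicate_add[symmetric])
    qed
    then have "exec ?l ?t r = replicate (poly p n * n) 1" using t(1) by (simp add: n_def)
    moreover have "exec ?a s' r = replicate a 1 @ s' r" for s'
      unfolding exec_pushes by simp
    ultimately have "exec ?c s r = replicate a 1 @ replicate (poly p n * n) 1" by (simp only: exec.simps(5))
    then show ?thesis by (simp add: n_def[symmetric] replicate_add[symmetric] mult.commute)
  qed
  moreover have "r < lim" using c(1) by simp
  ultimately show ?case by blast
qed

section \<open>Programs that write letters\<close>

definition outs :: "nat list \<Rightarrow> com" where
  "outs w = seqs (map Out w)"

lemma exec_outs [simp]: "exec (outs w) s = s(1 := s 1 @ w)"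
  unfolding outs_def by (induction w arbitrary: s) auto

lemma wfc_outs [simp]: "wfc (outs w) \<longleftrightarrow> set w \<subseteq> {1, 2}"
  unfolding outs_def by auto

lemma mods_outs: "mods (outs w) \<subseteq> {1}"
  unfolding outs_def by auto

lemma bnd_outs [simp]: "1 \<notin> X \<Longrightarrow> bnd X (outs w)"
  unfolding outs_def by auto

lemma length_sfx [simp]: "length (sfx xs) = length xs"
  by (induction xs) auto

lemma nth_sfx: "n < length xs \<Longrightarrow> sfx xs ! n = drop n xs"
proof (induction xs arbitrary: n)
  case (Cons x xs)
  then show ?case by (cases n) auto
qed simp

lemma exec_For_outs:
  assumes "\<And>s' ys. ys \<in> set (sfx (s r)) \<Longrightarrow> s' r = ys \<Longrightarrow> (\<forall>i. i \<noteq> r \<longrightarrow> i \<noteq> 1 \<longrightarrow> s' i = s i) \<Longrightarrow>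
      exec c s' = s'(1 := s' 1 @ w ys)" "r \<noteq> 1"
  shows "exec (For r c) s = s(1 := s 1 @ concat (map w (sfx (s r))))"
proof -
  let ?S = "\<lambda>zs. s(1 := s 1 @ concat (map w (take (length zs) (sfx (s r)))))"
  have "exec (For r c) s = (?S (s r))(r := s r)"
  proof (rule exec_For[where S = ?S])
    fix zs a ys assume e: "s r = zs @ a # ys"
    have l: "length zs < length (sfx (s r))" by (simp add: e)
    have n: "sfx (s r) ! length zs = a # ys" using l by (simp add: nth_sfx) (simp add: e)
    then have m: "a # ys \<in> set (sfx (s r))" using nth_mem[OF l] by simp
    have t: "take (Suc (length zs)) (sfx (s r)) = take (length zs) (sfx (s r)) @ [a # ys]"
      using take_Suc_conv_app_nth[OF l] n by simp
    have "exec c ((?S zs)(r := a # ys)) = ((?S zs)(r := a # ys))(1 := ((?S zs)(r := a # ys)) 1 @ w (a # ys))"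
      by (rule assms(1)[OF m]) auto
    also have "\<dots> = (?S (zs @ [a]))(r := a # ys)" using assms(2) t by (simp add: fun_eq_iff)
    finally show "exec c ((?S zs)(r := a # ys)) = (?S (zs @ [a]))(r := a # ys)" .
  qed simp
  also have "\<dots> = s(1 := s 1 @ concat (map w (sfx (s r))))" using assms(2) by (simp add: fun_eq_iff)
  finally show ?thesis .
qed

abbreviation bits :: "bool list \<Rightarrow> nat list" where
  "bits w \<equiv> map bit (ews w)"

lemma ews_append: "ews (v @ w) = ews v @ ews w" "ews (b # w) = True # b # ews w" "ews [] = []"
  by (simp_all add: ews_def)

lemma ews_replicate: "ews (replicate n b) = concat (replicate n [True, b])"
  by (induction n) (simp_all add: ews_def)

text \<open>Registers 2 and 3 hold the suffixes of the enclosing sweeps, so sweeping them writes the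
  two coordinates in unary. \<open>[2, 2]\<close> is an announced bit 1; the first 2 announces the
  letter and the last 1 closes it.\<close>

definition out_sym :: "sym \<Rightarrow> com" where
  "out_sym = (\<lambda>(c, a, b). seqs [outs [2], For 2 (outs [2, 2]), outs (bits (replicate a True @ [False])),
     For 3 (outs [2, 2]), outs (bits (replicate b True @ [False]) @ bits (replicate c True) @ [1])])"

lemma concat_map_const: "concat (map (\<lambda>_. w) xs) = concat (replicate (length xs) w)"
  by (induction xs) auto

lemma exec_out_sym:
  "exec (out_sym e) s = s(1 := s 1 @ map bit (ewl [inst (length (s 2)) (length (s 3)) e]))"
proof -
  obtain c a b where e: "e = (c, a, b)" by (metis prod_cases3)
  have f: "exec (For r (outs [2, 2])) s' = s'(1 := s' 1 @ bits (replicate (length (s' r)) True))" if "r \<noteq> 1" for r s'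
  proof -
    have "exec (For r (outs [2, 2])) s' = s'(1 := s' 1 @ concat (map (\<lambda>_. [2, 2]) (sfx (s' r))))"
      by (rule exec_For_outs) (use that in auto)
    also have "concat (map (\<lambda>_. [2, 2]) (sfx (s' r))) = bits (replicate (length (s' r)) True)"
      by (simp add: concat_map_const ews_replicate map_concat)
    finally show ?thesis .
  qed
  show ?thesis
    by (simp add: e out_sym_def f inst_def nm_def ewl_def enc_word_ews ews_append replicate_add fun_eq_iff del: exec.simps(7))
qed

definition out_main :: "(nat \<Rightarrow> nat \<Rightarrow> sym list) \<Rightarrow> com" where
  "out_main F = For 2 (For 3 (branch 2 4 (\<lambda>x. branch 3 7 (\<lambda>y. seqs (map out_sym (F x y))))))"

lemma ewl_append: "ewl (xs @ ys) = ewl xs @ ewl ys" "ewl [] = []"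
  by (simp_all add: ewl_def)

lemma exec_out_syms:
  "exec (seqs (map out_sym L)) s = s(1 := s 1 @ map bit (ewl (map (inst (length (s 2)) (length (s 3))) L)))"
proof (induction L arbitrary: s)
  case Nil
  then show ?case by (simp add: ewl_append)
next
  case (Cons e L)
  have "ewl (map (inst i j) (e # L)) = ewl [inst i j e] @ ewl (map (inst i j) L)" for i j
    by (simp add: ewl_def)
  with Cons show ?case by (simp add: exec_out_sym fun_eq_iff)
qed

lemma ewl_concat: "ewl (concat xss) = concat (map ewl xss)"
  by (induction xss) (simp_all add: ewl_append)

lemma hd_sfx: "ys \<in> set (sfx xs) \<Longrightarrow> ys \<noteq> [] \<and> hd ys \<in> set xs"
  by (induction xs) auto

lemma top_hd: "ys \<noteq> [] \<Longrightarrow> top ys = hd ys"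
  by (cases ys) auto

lemma exec_out_main:
  assumes "set (s 2) \<subseteq> {..4}" "set (s 3) \<subseteq> {..7}"
  shows "exec (out_main F) s = s(1 := s 1 @ map bit (ewl (body_seq F (s 2) (s 3))))"
proof -
  let ?w = "\<lambda>r c. map bit (ewl (map (inst (length r) (length c)) (F (hd r) (hd c))))"
  have "exec (out_main F) s = s(1 := s 1 @ concat (map (\<lambda>r. concat (map (?w r) (sfx (s 3)))) (sfx (s 2))))"
    unfolding out_main_def
  proof (rule exec_For_outs)
    fix s' r assume r: "r \<in> set (sfx (s 2))" and s'2: "s' 2 = r" and s': "\<forall>i. i \<noteq> 2 \<longrightarrow> i \<noteq> 1 \<longrightarrow> s' i = s i"
    have h: "top r \<le> 4" "top r = hd r" using hd_sfx[OF r] assms(1) by (auto simp: top_hd)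
    have "exec (For 3 (branch 2 4 (\<lambda>x. branch 3 7 (\<lambda>y. seqs (map out_sym (F x y)))))) s' =
      s'(1 := s' 1 @ concat (map (?w r) (sfx (s' 3))))"
    proof (rule exec_For_outs)
      fix s'' c assume c: "c \<in> set (sfx (s' 3))" and s3: "s'' 3 = c" and s'': "\<forall>i. i \<noteq> 3 \<longrightarrow> i \<noteq> 1 \<longrightarrow> s'' i = s' i"
      have h': "top c \<le> 7" "top c = hd c" using hd_sfx[OF c] assms(2) s' by (auto simp: top_hd)
      have s2: "s'' 2 = r" using s'' s'2 by simp
      show "exec (branch 2 4 (\<lambda>x. branch 3 7 (\<lambda>y. seqs (map out_sym (F x y))))) s'' = s''(1 := s'' 1 @ ?w r c)"
        using h h' by (simp add: exec_branch s2 s3 exec_out_syms)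
    qed simp
    moreover have "s' 3 = s 3" using s' by simp
    ultimately show "exec (For 3 (branch 2 4 (\<lambda>x. branch 3 7 (\<lambda>y. seqs (map out_sym (F x y)))))) s' =
      s'(1 := s' 1 @ concat (map (?w r) (sfx (s 3))))" by simp
  qed simp
  also have "concat (map (\<lambda>r. concat (map (?w r) (sfx (s 3)))) (sfx (s 2))) = map bit (ewl (body_seq F (s 2) (s 3)))"
    by (simp add: body_seq_def ewl_concat map_concat comp_def)
  finally show ?thesis .
qed

lemma wfc_out_main: "wfc (out_main F)"
proof -
  have b: "set (bits w) \<subseteq> {1, 2}" for w by (auto simp: bit_def)
  have m: "mods (out_sym e) \<subseteq> {1}" for e
    using mods_outs by (cases e) (auto simp: out_sym_def dest!: subsetD[OF mods_outs])
  have "wfc (out_sym e)" for e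
    using b by (cases e) (auto simp: out_sym_def dest!: subsetD[OF mods_outs] simp del: set_map)
  with m show ?thesis
    by (auto simp: out_main_def mods_branch intro!: wfc_branch dest!: subsetD[OF m])
qed

lemma good_out_main: "good (out_main F)"
proof (rule good_bnd[of "{2, 3}"])
  have "bnd {2, 3} (out_sym e)" for e by (cases e) (simp add: out_sym_def)
  then show "bnd {2, 3} (out_main F)" by (auto simp: out_main_def intro!: bnd_branch)
qed

section \<open>Programs that build the lists of row and column codes\<close>

definition row_prog :: "nat \<Rightarrow> com" where
  "row_prog rp = seqs [Push 2 1, Push 2 4, For rp (Push 2 3), Push 2 2, Push 2 1]"

text \<open>\<open>P\<close> symbols in register \<open>rp\<close> yield a margin of
  \<open>B = 2 * P + 4\<close> cells. For \<open>T = P + 1\<close> this is at least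
  \<open>2 * T + 1\<close>.\<close>

definition blanks :: "nat \<Rightarrow> com" where
  "blanks rp = seqs [For rp (seqs (map (Push 3) [2, 2])), seqs (map (Push 3) [2, 2, 2, 2])]"

text \<open>Register 4 holds the input in reverse, so \<open>enc_word\<close> is built from its end:
  a 3 for the final 0, then for each bit its code and in front of it a 4 for the announcing
  1.\<close>

definition input_prog :: com where
  "input_prog = seqs [Push 3 3, For 4 (branch 4 2 (\<lambda>c. if c = 0 then Skip else seqs [Push 3 (c + 2), Push 3 4])),
     branch 3 4 (\<lambda>t. Put 3 (t + 3))]"

definition col_prog :: "nat \<Rightarrow> nat \<Rightarrow> com" where
  "col_prog rq rp = seqs [Push 3 1, Push 3 1, blanks rp, For rq (Push 3 5), rev_copy 0 4, input_prog,
     blanks rp, Push 3 1, Push 3 1]"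

lemma exec_row_prog:
  assumes "rp \<noteq> 2" "s 2 = []"
  shows "exec (row_prog rp) s = s(2 := [1, 2] @ replicate (length (s rp)) 3 @ [4, 1])"
proof -
  have "exec (For rp (Push 2 3)) s' = s'(2 := replicate (length (s' rp)) 3 @ s' 2)" for s'
    using exec_For_push[of "Push 2 3" 2 "[3]" rp s'] assms(1) by (simp add: concat_replicate_single)
  then show ?thesis using assms by (simp add: row_prog_def fun_eq_iff del: exec.simps(7))
qed

lemma concat_replicate_pair: "concat (replicate n [a, a]) = replicate (2 * n) a"
  by (induction n) auto

lemma exec_blanks:
  assumes "rp \<noteq> 3"
  shows "exec (blanks rp) s = s(3 := replicate (2 * length (s rp) + 4) 2 @ s 3)"
proof -
  have "exec (For rp (seqs (map (Push 3) [2, 2]))) s' = s'(3 := concat (replicate (length (s' rp)) [2, 2]) @ s' 3)" for s'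
    by (rule exec_For_push) (use assms in \<open>simp_all\<close>)
  then show ?thesis
    by (simp add: blanks_def fun_eq_iff concat_replicate_pair numeral_eq_Suc del: exec.simps(7))
qed

definition word_codes :: "bool list \<Rightarrow> nat list" where
  "word_codes w = map (\<lambda>b. if b then 4 else 3) (enc_word w)"

lemma word_codes_concat: "concat (map (\<lambda>c. [4, c + 2]) (map bit w)) @ [3] = word_codes w"
  by (induction w) (auto simp: word_codes_def bit_def)

lemma exec_input_prog:
  assumes "s 4 = rev (map bit w)"
  shows "exec input_prog s = s(3 := (hd (word_codes w) + 3) # tl (word_codes w) @ s 3)"
proof -
  let ?c = "branch 4 2 (\<lambda>c. if c = 0 then Skip else seqs [Push 3 (c + 2), Push 3 4])"
  let ?t = "s(3 := 3 # s 3)"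
  let ?S = "\<lambda>zs. ?t(3 := concat (map (\<lambda>c. [4, c + 2]) (rev zs)) @ 3 # s 3)"
  have "exec (For 4 ?c) ?t = (?S (?t 4))(4 := ?t 4)"
  proof (rule exec_For[where S = ?S])
    fix zs a ys assume "?t 4 = zs @ a # ys"
    then have "rev (map bit w) = zs @ a # ys" using assms by simp
    then have "a \<in> set (rev (map bit w))" by (simp only: in_set_conv_decomp) blast
    then have "1 \<le> a" "a \<le> 2" by (auto simp: bit_def)
    then show "exec ?c ((?S zs)(4 := a # ys)) = (?S (zs @ [a]))(4 := a # ys)"
      by (simp add: exec_branch fun_eq_iff)
  qed (simp add: fun_eq_iff)
  also have "\<dots> = s(3 := word_codes w @ s 3)"
    using assms by (simp add: word_codes_concat[symmetric] fun_eq_iff)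
  finally have 1: "exec (For 4 ?c) ?t = s(3 := word_codes w @ s 3)" .
  obtain a ws where w: "word_codes w = a # ws" "a \<le> 4"
    by (cases w) (auto simp: word_codes_def)
  have "exec input_prog s = exec (branch 3 4 (\<lambda>t. Put 3 (t + 3))) (exec (For 4 ?c) ?t)"
    by (simp add: input_prog_def del: exec.simps(7))
  also have "\<dots> = s(3 := (a + 3) # ws @ s 3)" unfolding 1 w(1) using w(2) by (simp add: exec_branch)
  finally show ?thesis by (simp add: w(1))
qed

lemma exec_col_prog:
  assumes "s 0 = map bit w" "s 3 = []" "s 4 = []" "5 \<le> rq" "5 \<le> rp"
  shows "exec (col_prog rq rp) s = s(4 := rev (map bit w), 3 := [1, 1] @ replicate (2 * length (s rp) + 4) 2 @
     (hd (word_codes w) + 3) # tl (word_codes w) @ replicate (length (s rq)) 5 @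
     replicate (2 * length (s rp) + 4) 2 @ [1, 1])"
proof -
  have q: "exec (For rq (Push 3 5)) s' = s'(3 := replicate (length (s' rq)) 5 @ s' 3)" for s'
    using exec_For_push[of "Push 3 5" 3 "[5]" rq s'] assms(4) by (simp add: concat_replicate_single)
  have r3: "rp \<noteq> 3" using assms by simp
  let ?b = "replicate (2 * length (s rp) + 4) 2 :: nat list"
  define s1 where "s1 = s(3 := replicate (length (s rq)) 5 @ ?b @ [1, 1])"
  have 1: "exec (For rq (Push 3 5)) (exec (blanks rp) (s(3 := [1, 1]))) = s1"
    unfolding q exec_blanks[OF r3] using assms by (simp add: s1_def fun_eq_iff)
  have 2: "exec (rev_copy 0 4) s1 = s1(4 := rev (map bit w))"
    using exec_rev_copy[of s1 0 4] assms set_map_bit by (simp add: s1_def)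
  have 3: "exec input_prog (s1(4 := rev (map bit w))) =
     s1(4 := rev (map bit w), 3 := (hd (word_codes w) + 3) # tl (word_codes w) @ s1 3)"
    by (subst exec_input_prog[where w = w]) simp_all
  have "exec (col_prog rq rp) s = exec (seqs [Push 3 1, Push 3 1]) (exec (blanks rp) (exec input_prog (exec (rev_copy 0 4)
     (exec (For rq (Push 3 5)) (exec (blanks rp) (s(3 := [1, 1])))))))"
    using assms(2) by (simp add: col_prog_def del: exec.simps(7))
  also have "\<dots> = s(4 := rev (map bit w), 3 := [1, 1] @ ?b @
     (hd (word_codes w) + 3) # tl (word_codes w) @ replicate (length (s rq)) 5 @ ?b @ [1, 1])"
    unfolding 1 2 3 unfolding exec_blanks[OF r3] using assms by (simp add: s1_def fun_eq_iff)
  finally show ?thesis .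
qed

text \<open>The sequence itself enumerates its alphabet, so the same output is written twice. The
  closing \<open>[1, 1]\<close> encodes the bound 0.\<close>

definition reduction :: "com \<Rightarrow> com \<Rightarrow> nat \<Rightarrow> nat \<Rightarrow> (nat \<Rightarrow> nat \<Rightarrow> sym list) \<Rightarrow> nat \<Rightarrow> com" where
  "reduction cq cp rq rp F d = (let E = seqs [out_main F, outs (map bit (ewl (replicate d []) @ [False]))] in
     seqs [cq, cp, row_prog rp, col_prog rq rp, E, E, outs [1, 1]])"

lemma wfc_reduction:
  assumes "wfc cq" "wfc cp" "5 \<le> rq" "5 \<le> rp"
  shows "wfc (reduction cq cp rq rp F d)"
proof -
  have "set (map bit w) \<subseteq> {1, 2}" for w by (auto simp: bit_def)
  moreover have "wfc (row_prog rp)" "wfc (col_prog rq rp)"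
    using assms(3,4)
    by (auto simp: row_prog_def col_prog_def blanks_def rev_copy_def input_prog_def mods_branch
        intro!: wfc_branch split: if_splits)
  ultimately show ?thesis using assms wfc_out_main by (simp add: reduction_def Let_def del: set_map)
qed

lemma good_reduction:
  assumes "good cq" "good cp" "5 \<le> rq" "5 \<le> rp"
  shows "good (reduction cq cp rq rp F d)"
proof -
  have "good (row_prog rp)"
    by (rule good_bnd[of "{rp}"]) (use assms in \<open>simp add: row_prog_def\<close>)
  moreover
  have b: "bnd {rp} (blanks rp)" "bnd {rq} (For rq (Push 3 5))" "bnd {0} (rev_copy 0 4)" "bnd {4} input_prog"
    using assms by (auto simp: blanks_def rev_copy_def input_prog_def intro!: bnd_branch)
  have p: "good (Push 3 1)" by (rule good_bnd[of "{}"]) simp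
  have "good (col_prog rq rp)" unfolding col_prog_def
    using b[THEN good_bnd] p by (intro good_seqs) simp
  moreover have o: "good (outs w)" for w by (rule good_bnd[of "{}"]) simp
  moreover have "good (seqs [out_main F, outs w])" for w
    by (intro good_seqs) (simp add: good_out_main o)
  ultimately show ?thesis unfolding reduction_def Let_def
    using assms(1,2) by (intro good_seqs) (simp del: seqs.simps)
qed

lemma poly_mono_nat: "k \<le> k' \<Longrightarrow> poly p k \<le> poly (p :: nat poly) k'"
  by (induction p) (auto intro: add_mono mult_mono)

lemma length_enc_word: "length (enc_word x) = 2 * length x + 1"
  by (induction x) auto

lemma enc_int_0: "enc_int 0 = [False, False]"
  by (simp add: enc_int_def nat_bits.simps)

theorem NP_hard_LLDS_plus:
  assumes d: "6 \<le> d"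
  shows "NP_hard (LLDS_plus_lang d)"
  unfolding NP_hard_def
proof
  fix L assume "L \<in> NP"
  then obtain f and pq :: "nat poly" where f: "polytime f" and
    L: "\<And>x. x \<in> L \<longleftrightarrow> (\<exists>u. length u \<le> poly pq (length x) \<and> f (enc_pair x u) = [True])"
    unfolding NP_def by blast
  obtain M and pt :: "nat poly" where M: "wf_tm M" "computes_in_time M f (poly pt)"
    using f unfolding polytime_def by blast
  obtain tgs where tgs: "set tgs = tags M" "distinct tgs" using finite_distinct_list[OF finite_tags] by blast
  obtain rl where rl: "set rl = rules M" "distinct rl" using finite_distinct_list[OF finite_rules] by blast
  \<comment> \<open>For \<open>x\<close> of length \<open>n\<close>, the word
    \<open>enc_pair x u\<close> has length \<open>2 * n + 1\<close> plus that of \<open>u\<close>,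
    which is at most \<open>poly pq n\<close>.\<close>
  define pp where "pp = pcompose pt ([:1, 2:] + pq)"
  \<comment> \<open>Registers 0 and 1 are input and output, and 2 to 4 belong to
    \<open>row_prog\<close> and \<open>col_prog\<close>; those from 5 on are free for the
    polynomials.\<close>
  have "2 \<le> (5 :: nat)" by simp
  from exec_poly[OF this, of pq] obtain cq rp where cq: "5 < rp" "wfc cq" "good cq" "mods cq \<subseteq> {5..<rp}"
    "\<And>s. (\<forall>i. 5 \<le> i \<longrightarrow> s i = []) \<Longrightarrow> exec cq s 5 = replicate (poly pq (length (s 0))) 1" by blast
  have "2 \<le> rp" using cq(1) by simp
  from exec_poly[OF this, of pp] obtain cp lim where cp: "wfc cp" "good cp" "mods cp \<subseteq> {rp..<lim}"
    "\<And>s. (\<forall>i. rp \<le> i \<longrightarrow> s i = []) \<Longrightarrow> exec cp s rp = replicate (poly pp (length (s 0))) 1" by blast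
  define F where "F = tmpl M tgs rl"
  define c where "c = reduction cq cp 5 rp F d"
  have "polytime (result c)" unfolding c_def
    by (rule polytimeI) (use cq cp in \<open>auto intro!: wfc_reduction good_reduction\<close>)
  moreover have "x \<in> L \<longleftrightarrow> result c x \<in> LLDS_plus_lang d" for x
  proof -
    define q where "q = poly pq (length x)"
    define P where "P = poly pp (length x)"
    \<comment> \<open>The successor keeps the first and the last row apart even if
      \<open>P = 0\<close>; exactly \<open>P\<close> rows remain in between.\<close>
    define T where "T = Suc P"
    define B where "B = 2 * P + 4"
    interpret tb: tableau M x q B T
      by unfold_locales (simp_all add: M T_def B_def)
    let ?S = "tb.S tgs rl d"
    have T0: "0 < T" by (simp add: T_def)
    have time: "poly pt n \<le> T" if "n \<le> length (enc_word x) + q" for n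
    proof -
      have "poly pt n \<le> poly pt (length (enc_word x) + q)" using that by (rule poly_mono_nat)
      also have "\<dots> = P" by (simp add: P_def pp_def poly_pcompose q_def length_enc_word mult.commute)
      finally show ?thesis by (simp add: T_def)
    qed
    have "2 \<le> d" using d by simp
    from tb.instance_iff[OF tgs rl T0 this M(2) time]
    have 1: "LLDS_plus (set ?S) ?S 0 \<longleftrightarrow> x \<in> L" unfolding L q_def .
    have 2: "max_occurrences (set ?S) ?S d" by (rule tb.max_occ[OF tgs rl T0 d])
    let ?s0 = "start x"
    let ?s1 = "exec cq ?s0"
    let ?s2 = "exec cp ?s1"
    have u1: "?s1 i = ?s0 i" if "i < 5 \<or> rp \<le> i" for i
    proof (rule exec_unmod)
      show "i \<notin> mods cq" using cq(4) that by auto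
    qed
    have u2: "?s2 i = ?s1 i" if "i < rp" for i
    proof (rule exec_unmod)
      show "i \<notin> mods cp" using cp(3) that by auto
    qed
    have v0: "?s2 0 = map bit x" "?s2 1 = []" "?s2 2 = []" "?s2 3 = []" "?s2 4 = []"
      using u1 u2 cq(1) by (simp_all add: start_simps)
    have v5: "?s2 5 = replicate q 1" using u2[of 5] cq(1) cq(5)[of ?s0] by (simp add: start_simps q_def)
    have vp: "?s2 rp = replicate P 1" using cp(4)[of ?s1] u1 cq(1) by (simp add: start_simps P_def)
    let ?s3 = "exec (row_prog rp) ?s2"
    have s3: "?s3 = ?s2(2 := tb.rows)"
    proof -
      have "tb.rows = [1, 2] @ replicate P 3 @ [4, 1]" unfolding tb.rows_def by (simp add: T_def)
      then show ?thesis using exec_row_prog[of rp ?s2] v0 cq(1) by (simp only: vp length_replicate)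
    qed
    let ?s4 = "exec (col_prog 5 rp) ?s3"
    have ws: "(hd (word_codes x) + 3) # tl (word_codes x) = tb.inp"
      by (simp add: word_codes_def tb.inp_def Let_def)
    have "?s4 = ?s3(4 := rev (map bit x), 3 := [1, 1] @ replicate (2 * length (?s3 rp) + 4) 2 @
       (hd (word_codes x) + 3) # tl (word_codes x) @ replicate (length (?s3 5)) 5 @
       replicate (2 * length (?s3 rp) + 4) 2 @ [1, 1])"
      by (rule exec_col_prog) (use v0 cq(1) in \<open>simp_all add: s3\<close>)
    moreover have "?s3 rp = replicate P 1" "?s3 5 = replicate q 1" using cq(1) by (simp_all add: s3 v5 vp)
    moreover have "tb.cols = [1, 1] @ replicate (2 * P + 4) 2 @ tb.inp @ replicate q 5 @ replicate (2 * P + 4) 2 @ [1, 1]"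
      using tb.cols_def unfolding B_def .
    ultimately have s4: "?s4 = ?s3(4 := rev (map bit x), 3 := tb.cols)"
      by (simp only: length_replicate ws[symmetric] append_Cons)
    define s4 where "s4 = ?s4"
    have s4v: "s4 1 = []" "s4 2 = tb.rows" "s4 3 = tb.cols" unfolding s4_def unfolding s4 unfolding s3 using v0 by simp_all
    have rows: "set tb.rows \<subseteq> {..4}" by (auto simp: tb.rows_def)
    have "set tb.inp \<subseteq> {..7}"
    proof -
      have "set tb.inp \<subseteq> insert (hd (word_codes x) + 3) (set (word_codes x))"
        unfolding ws[symmetric] by (cases "word_codes x") auto
      moreover have "set (word_codes x) \<subseteq> {..4}" "word_codes x \<noteq> []"
        by (auto simp: word_codes_def tb.enc_word_ne)
      ultimately show ?thesis using hd_in_set[of "word_codes x"] by fastforce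
    qed
    then have cols: "set tb.cols \<subseteq> {..7}" by (auto simp: tb.cols_def)
    let ?E = "seqs [out_main F, outs (map bit (ewl (replicate d []) @ [False]))]"
    have "?S = body_seq F tb.rows tb.cols @ replicate d []"
      using tb.S_def[OF tgs rl T0] by (simp add: F_def)
    then have eS: "enc_list enc_word ?S = ewl (body_seq F tb.rows tb.cols) @ ewl (replicate d []) @ [False]"
      by (simp add: enc_list_ewl ewl_append)
    have E: "exec ?E s = s(1 := s 1 @ map bit (enc_list enc_word ?S))" if "s 2 = tb.rows" "s 3 = tb.cols" for s
      using that rows cols by (simp add: exec_out_main eS fun_eq_iff)
    have "exec c ?s0 1 = exec (outs [1, 1]) (exec ?E (exec ?E s4)) 1"
      unfolding c_def reduction_def Let_def s4_def by (simp only: seqs.simps exec.simps)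
    also have "\<dots> = map bit (enc_list enc_word ?S @ enc_list enc_word ?S @ [False, False])"
    proof -
      let ?Y = "map bit (enc_list enc_word ?S)"
      have 1: "exec ?E s4 = s4(1 := s4 1 @ ?Y)" by (rule E) (use s4v in simp_all)
      have 2: "exec ?E (s4(1 := s4 1 @ ?Y)) = (s4(1 := s4 1 @ ?Y))(1 := (s4(1 := s4 1 @ ?Y)) 1 @ ?Y)"
        by (rule E) (use s4v in simp_all)
      show ?thesis unfolding 1 unfolding 2 using s4v by simp
    qed
    finally have "exec c ?s0 1 = map bit (enc_instance ?S ?S 0)"
      by (simp add: enc_instance_def enc_int_0)
    then have r: "result c x = enc_instance ?S ?S 0" by (simp add: result_def bit_def comp_def)
    show ?thesis unfolding 1[symmetric] r
    proof
      assume "LLDS_plus (set ?S) ?S 0"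
      with 2 show "enc_instance ?S ?S 0 \<in> LLDS_plus_lang d" unfolding LLDS_plus_lang_def by blast
    next
      assume "enc_instance ?S ?S 0 \<in> LLDS_plus_lang d"
      then obtain A' S' l where "enc_instance ?S ?S 0 = enc_instance A' S' l" "LLDS_plus (set A') S' l"
        unfolding LLDS_plus_lang_def by blast
      with enc_instance_inject show "LLDS_plus (set ?S) ?S 0" by metis
    qed
  qed
  ultimately show "polytime_reducible L (LLDS_plus_lang d)" unfolding polytime_reducible_def by blast
qed

theorem theorem1:
  fixes d :: nat
  assumes "6 \<le> d"
  shows "NP_complete (LLDS_plus_lang d)"
  unfolding NP_complete_def using LLDS_plus_NP NP_hard_LLDS_plus[OF assms] by blast

end
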